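(* Let $d\ge 2$, $a>0$, and let $(p_n)_{n\ge 2}$ be a sequence in $[0,1]$ with $p_n=a/n$ for all $n\ge n_0$, for some $n_0$. Let $S$ be the conservative random walk on $\mathbb{Z}^d$ started at the origin corresponding to $(p_n)$, extended to all non-negative times by linear interpolation, and for $n\ge 1$ define the rescaled walk $$S^n(t):=\frac{S_{nt}}{n},\qquad t\ge 0.$$ Let $\mathcal{Z}^{(d)}$ denote the law of the $d$-dimensional zigzag process with parameter $b=\frac{(2d-1)a}{2d}$. Then $\lim_{n\to\infty}\mathsf{Law}(S^n)=\mathcal{Z}^{(d)}$ weakly on $C([0,\infty),\mathbb{R}^d)$.
   Context: Conservative random walk on $\mathbb{Z}^d$, $d\ge 2$, corresponding to a sequence $(p_n)_{n\ge 2}$ in $[0,1]$ (with the convention $p_1:=1$): let $e_1,\dots,e_d$ be the standard basis vectors of $\mathbb{R}^d$. Let $Y_1$ be uniform on the $2d$-element set $\{\pm e_1,\dots,\pm e_d\}$, and let $Y_1,Y_2,\dots$ be the (time-inhomogeneous) Markov chain on this set whose transition matrix between times $n$ and $n+1$ is $(1-p_n)I+\frac{p_n}{2d}A$, $n\ge 1$, where $I$ is the $2d\times 2d$ identity matrix and $A$ the $2d\times 2d$ matrix of ones; i.e. with probability $1-p_n$ the next step repeats the previous one, and with probability $p_n$ a fresh direction is chosen uniformly among all $2d$ directions. Set $S_0=\mathbf{0}$, $S_n=Y_1+\dots+Y_n$. Zigzag process in $\mathbb{R}^d$ with parameter $b>0$: take a Poisson point process on $(0,\infty)$ with intensity measure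 $\frac{b}{x}\,dx$. Almost surely its points are locally finite in $(0,\infty)$ and accumulate exactly at $0$ and $\infty$, so they split $(0,\infty)$ into consecutive intervals $(I_i)_{i\in\mathbb{Z}}$, ordered from left to right, with $I_0$ the interval containing $1$. Independently of the point process, assign to each interval $I_i$ a label (direction) $V_i\in\{\pm e_1,\dots,\pm e_d\}$ as follows: $V_0$ is uniform on the $2d$ directions; going forward ($i=1,2,\dots$), $V_i$ is chosen uniformly among the $2d-1$ directions different from $V_{i-1}$; going backward ($i=-1,-2,\dots$), $V_i$ is chosen uniformly among the $2d-1$ directions different from $V_{i+1}$; all choices are independent. The zigzag process is $Z_0=\mathbf{0}$ and $Z_t=\sum_{i\in\mathbb{Z}}\mathrm{Leb}(I_i\cap[0,t])\,V_i$ for $t>0$, i.e. it moves with unit speed in direction $V_i$ during the time interval $I_i$. $C([0,\infty),\mathbb{R}^d)$ carries the topology of uniform convergence on compact sets. *)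

theory Defs
  imports "HOL-Probability.Probability"
begin

section \<open>Continuous paths, uniform convergence on compact sets, weak convergence\<close>

text \<open>
  A path on \<open>[0,\<infinity>)\<close> is an extensional function: outside \<open>{0..}\<close> it has the value \<open>undefined\<close>,
  so that distinct elements of \<open>cpaths\<close> are distinct as functions on \<open>[0,\<infinity>)\<close>.
\<close>

definition cpaths :: "(real \<Rightarrow> 'a::metric_space) set" where
  "cpaths = {f \<in> extensional {0..}. continuous_on {0..} f}"

definition cpath_nbhd :: "(real \<Rightarrow> 'a::metric_space) \<Rightarrow> real set \<Rightarrow> real \<Rightarrow> (real \<Rightarrow> 'a) set" where
  "cpath_nbhd f K e = {g \<in> cpaths. \<forall>t\<in>K. dist (g t) (f t) < e}"

definition cpath_open :: "(real \<Rightarrow> 'a::metric_space) set \<Rightarrow> bool" where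
  "cpath_open U \<longleftrightarrow> U \<subseteq> cpaths \<and>
     (\<forall>f\<in>U. \<exists>K e. compact K \<and> K \<subseteq> {0..} \<and> e > 0 \<and> cpath_nbhd f K e \<subseteq> U)"

lemma cpath_openD:
  assumes "cpath_open U" "f \<in> U"
  obtains K e where "compact K" "K \<subseteq> {0..}" "e > 0" "cpath_nbhd f K e \<subseteq> U"
  using assms unfolding cpath_open_def by meson

lemma istopology_cpath_open: "istopology cpath_open"
  unfolding istopology_def
proof (intro conjI allI impI)
  fix S T :: "(real \<Rightarrow> 'a) set"
  assume ST: "cpath_open S" "cpath_open T"
  show "cpath_open (S \<inter> T)"
    unfolding cpath_open_def
  proof (intro conjI ballI)
    show "S \<inter> T \<subseteq> cpaths"
      using ST(1) unfolding cpath_open_def by blast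
    fix f assume f: "f \<in> S \<inter> T"
    obtain K e where K: "compact K" "K \<subseteq> {0..}" "e > 0" "cpath_nbhd f K e \<subseteq> S"
      using cpath_openD[OF ST(1) IntD1[OF f]] .
    obtain K' e' where K': "compact K'" "K' \<subseteq> {0..}" "e' > 0" "cpath_nbhd f K' e' \<subseteq> T"
      using cpath_openD[OF ST(2) IntD2[OF f]] .
    show "\<exists>K e. compact K \<and> K \<subseteq> {0..} \<and> e > 0 \<and> cpath_nbhd f K e \<subseteq> S \<inter> T"
    proof (intro exI conjI)
      show "compact (K \<union> K')"
        using K(1) K'(1) by (rule compact_Un)
      show "K \<union> K' \<subseteq> {0..}"
        using K(2) K'(2) by (rule Un_least)
      show "min e e' > 0"
        using K(3) K'(3) by simp
      have "cpath_nbhd f (K \<union> K') (min e e') \<subseteq> cpath_nbhd f K e"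
        and "cpath_nbhd f (K \<union> K') (min e e') \<subseteq> cpath_nbhd f K' e'"
        unfolding cpath_nbhd_def by (simp_all add: subset_iff)
      with K(4) K'(4) show "cpath_nbhd f (K \<union> K') (min e e') \<subseteq> S \<inter> T"
        by blast
    qed
  qed
next
  fix \<K> :: "(real \<Rightarrow> 'a) set set"
  assume \<K>: "\<forall>U\<in>\<K>. cpath_open U"
  show "cpath_open (\<Union>\<K>)"
    unfolding cpath_open_def
  proof (intro conjI ballI)
    show "\<Union>\<K> \<subseteq> cpaths"
      using \<K> unfolding cpath_open_def by blast
    fix f assume "f \<in> \<Union>\<K>"
    then obtain U where U: "U \<in> \<K>" "f \<in> U" by blast
    obtain K e where K: "compact K" "K \<subseteq> {0..}" "e > 0" "cpath_nbhd f K e \<subseteq> U"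
      using cpath_openD[OF bspec[OF \<K> U(1)] U(2)] .
    from K(4) U(1) have "cpath_nbhd f K e \<subseteq> \<Union>\<K>" by blast
    with K(1-3) show "\<exists>K e. compact K \<and> K \<subseteq> {0..} \<and> e > 0 \<and> cpath_nbhd f K e \<subseteq> \<Union>\<K>"
      by (intro exI conjI)
  qed
qed

definition cpath_topology :: "(real \<Rightarrow> 'a::metric_space) topology" where
  "cpath_topology = topology cpath_open"

lemma openin_cpath_topology: "openin cpath_topology U \<longleftrightarrow> cpath_open U"
  by (simp add: cpath_topology_def topology_inverse' istopology_cpath_open)

lemma topspace_cpath_topology: "topspace cpath_topology = cpaths"
proof -
  have "cpath_open (cpaths :: (real \<Rightarrow> 'a) set)"
    unfolding cpath_open_def
  proof (intro conjI ballI exI)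
    show "cpath_nbhd f {} 1 \<subseteq> cpaths" for f :: "real \<Rightarrow> 'a"
      unfolding cpath_nbhd_def by blast
  qed simp_all
  moreover have "U \<subseteq> cpaths" if "cpath_open U" for U :: "(real \<Rightarrow> 'a) set"
    using that unfolding cpath_open_def by (rule conjunct1)
  ultimately show ?thesis
    unfolding topspace_def openin_cpath_topology by blast
qed

definition borel_of :: "'a topology \<Rightarrow> 'a measure" where
  "borel_of T = sigma (topspace T) {U. openin T U}"

definition weakly_converges :: "'a topology \<Rightarrow> (nat \<Rightarrow> 'a measure) \<Rightarrow> 'a measure \<Rightarrow> bool" where
  "weakly_converges T \<mu>s \<mu> \<longleftrightarrow>
     (\<forall>n. prob_space (\<mu>s n) \<and> sets (\<mu>s n) = sets (borel_of T)) \<and>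
     prob_space \<mu> \<and> sets \<mu> = sets (borel_of T) \<and>
     (\<forall>F :: 'a \<Rightarrow> real. continuous_map T euclideanreal F \<and> bounded (F ` topspace T) \<longrightarrow>
        (\<lambda>n. \<integral>x. F x \<partial>\<mu>s n) \<longlonglongrightarrow> (\<integral>x. F x \<partial>\<mu>))"


section \<open>The conservative random walk\<close>

definition directions :: "(real ^ 'd) set" where
  "directions = (\<Union>i. {axis i 1, - axis i 1})"

definition step_matrix :: "(nat \<Rightarrow> real) \<Rightarrow> nat \<Rightarrow> real ^ 'd \<Rightarrow> real ^ 'd \<Rightarrow> real" where
  "step_matrix p n x y =
     (1 - p n) * (if x = y then 1 else 0) + p n / (2 * real CARD('d))"

text \<open>
  The steps are \<open>Y 1, Y 2, \<dots>\<close>; the value \<open>Y 0\<close> is irrelevant.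
\<close>

definition conservative_steps ::
    "'w measure \<Rightarrow> (nat \<Rightarrow> real) \<Rightarrow> (nat \<Rightarrow> 'w \<Rightarrow> real ^ 'd) \<Rightarrow> bool" where
  "conservative_steps M p Y \<longleftrightarrow>
     prob_space M \<and>
     (\<forall>n\<ge>1. Y n \<in> M \<rightarrow>\<^sub>M count_space directions) \<and>
     (\<forall>v\<in>directions. \<P>(\<omega> in M. Y 1 \<omega> = v) = pmf (pmf_of_set directions) v) \<and>
     (\<forall>n\<ge>1. \<forall>y. \<forall>v\<in>directions.
        \<P>(\<omega> in M. \<forall>k\<in>{1..n}. Y k \<omega> = y k) > 0 \<longrightarrow>
        \<P>(\<omega> in M. Y (Suc n) \<omega> = v \<bar> \<forall>k\<in>{1..n}. Y k \<omega> = y k) = step_matrix p n (y n) v)"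

definition walk :: "(nat \<Rightarrow> 'w \<Rightarrow> real ^ 'd) \<Rightarrow> nat \<Rightarrow> 'w \<Rightarrow> real ^ 'd" where
  "walk Y n \<omega> = (\<Sum>k=1..n. Y k \<omega>)"

definition interpolate :: "(nat \<Rightarrow> 'a::real_vector) \<Rightarrow> real \<Rightarrow> 'a" where
  "interpolate s t = (1 - frac t) *\<^sub>R s (nat \<lfloor>t\<rfloor>) + frac t *\<^sub>R s (Suc (nat \<lfloor>t\<rfloor>))"

definition rescaled_walk ::
    "(nat \<Rightarrow> 'w \<Rightarrow> real ^ 'd) \<Rightarrow> nat \<Rightarrow> 'w \<Rightarrow> real \<Rightarrow> real ^ 'd" where
  "rescaled_walk Y n \<omega> =
     (\<lambda>t\<in>{0..}. interpolate (\<lambda>m. walk Y m \<omega>) (real n * t) /\<^sub>R real n)"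


section \<open>Poisson point processes\<close>

definition point_count :: "('w \<Rightarrow> 'a set) \<Rightarrow> 'a set \<Rightarrow> 'w \<Rightarrow> enat" where
  "point_count P B \<omega> = (if finite (P \<omega> \<inter> B) then enat (card (P \<omega> \<inter> B)) else \<infinity>)"

text \<open>
  The process is a random set rather than a random counting measure. This is adequate when
  the intensity \<open>\<mu>\<close> has no atoms, since the process then almost surely has no multiple points.
\<close>

definition poisson_point_process ::
    "'w measure \<Rightarrow> 'a measure \<Rightarrow> ('w \<Rightarrow> 'a set) \<Rightarrow> bool" where
  "poisson_point_process M \<mu> P \<longleftrightarrow>
     prob_space M \<and>
     (\<forall>\<omega>\<in>space M. P \<omega> \<subseteq> space \<mu>) \<and>
     (\<forall>B\<in>sets \<mu>. point_count P B \<in> M \<rightarrow>\<^sub>M count_space UNIV) \<and>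
     (\<forall>B\<in>sets \<mu>. emeasure \<mu> B < \<infinity> \<longrightarrow>
        (\<forall>k. \<P>(\<omega> in M. point_count P B \<omega> = enat k) =
               exp (- measure \<mu> B) * measure \<mu> B ^ k / fact k)) \<and>
     (\<forall>B\<in>sets \<mu>. emeasure \<mu> B = \<infinity> \<longrightarrow> (AE \<omega> in M. point_count P B \<omega> = \<infinity>)) \<and>
     (\<forall>(J :: nat set) B. finite J \<and> B ` J \<subseteq> sets \<mu> \<and> disjoint_family_on B J \<longrightarrow>
        prob_space.indep_vars M (\<lambda>_. count_space UNIV) (\<lambda>j. point_count P (B j)) J)"


section \<open>The zigzag process\<close>

definition zigzag_intensity :: "real \<Rightarrow> real measure" where
  "zigzag_intensity b = density (restrict_space lborel {0<..}) (\<lambda>x. ennreal (b / x))"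

definition regular_points :: "real set \<Rightarrow> bool" where
  "regular_points A \<longleftrightarrow>
     A \<subseteq> {0<..} \<and> (\<forall>K. compact K \<and> K \<subseteq> {0<..} \<longrightarrow> finite (A \<inter> K)) \<and>
     (\<forall>x>0. \<exists>y\<in>A. y < x) \<and> (\<forall>x. \<exists>y\<in>A. x < y)"

text \<open>
  For \<open>regular_points A\<close>, the increasing enumeration of \<open>A\<close> by the integers is unique once it is
  normalised so that interval number 0 contains 1.
\<close>

definition turning_time :: "real set \<Rightarrow> int \<Rightarrow> real" where
  "turning_time A = (THE T. strict_mono T \<and> range T = A \<and> T 0 \<le> 1 \<and> 1 < T 1)"

definition zigzag_interval :: "real set \<Rightarrow> int \<Rightarrow> real set" where
  "zigzag_interval A i = {turning_time A i ..< turning_time A (i + 1)}"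

text \<open>
  The first branch applies almost surely; the zero path on the exceptional null set only serves
  to make every sample path an element of \<open>cpaths\<close>.
\<close>

definition zigzag_path :: "real set \<Rightarrow> (int \<Rightarrow> real ^ 'd) \<Rightarrow> real \<Rightarrow> real ^ 'd" where
  "zigzag_path A v = (\<lambda>t\<in>{0..}.
     if regular_points A
     then \<Sum>\<^sub>\<infinity>i. measure lborel (zigzag_interval A i \<inter> {0..t}) *\<^sub>R v i
     else 0)"

text \<open>
  Each choice of a further label, forward or backward, is independent of all labels already
  chosen apart from the adjacent one: the conditioning is on a whole window \<open>{- m..n}\<close> around 0.
\<close>

definition zigzag_labels :: "'w measure \<Rightarrow> (int \<Rightarrow> 'w \<Rightarrow> real ^ 'd) \<Rightarrow> bool" where
  "zigzag_labels M V \<longleftrightarrow>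
     prob_space M \<and>
     (\<forall>i. V i \<in> M \<rightarrow>\<^sub>M count_space directions) \<and>
     (\<forall>v\<in>directions. \<P>(\<omega> in M. V 0 \<omega> = v) = pmf (pmf_of_set directions) v) \<and>
     (\<forall>m\<ge>0. \<forall>n\<ge>0. \<forall>w. \<forall>v\<in>directions.
        \<P>(\<omega> in M. \<forall>i\<in>{-m..n}. V i \<omega> = w i) > 0 \<longrightarrow>
        \<P>(\<omega> in M. V (n + 1) \<omega> = v \<bar> \<forall>i\<in>{-m..n}. V i \<omega> = w i)
          = pmf (pmf_of_set (directions - {w n})) v \<and>
        \<P>(\<omega> in M. V (- m - 1) \<omega> = v \<bar> \<forall>i\<in>{-m..n}. V i \<omega> = w i)
          = pmf (pmf_of_set (directions - {w (- m)})) v)"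

text \<open>
  The last conjunct is the independence of the point process, seen as the random family of all
  its counts, and of the family of labels.
\<close>

definition zigzag_data ::
    "'w measure \<Rightarrow> real \<Rightarrow> ('w \<Rightarrow> real set) \<Rightarrow> (int \<Rightarrow> 'w \<Rightarrow> real ^ 'd) \<Rightarrow> bool" where
  "zigzag_data M b P V \<longleftrightarrow>
     prob_space M \<and>
     poisson_point_process M (zigzag_intensity b) P \<and>
     zigzag_labels M V \<and>
     prob_space.indep_set M
       (sets (vimage_algebra (space M)
          (\<lambda>\<omega>. \<lambda>B\<in>sets (zigzag_intensity b). point_count P B \<omega>)
          (\<Pi>\<^sub>M B\<in>sets (zigzag_intensity b). count_space UNIV)))
       (sets (vimage_algebra (space M)
          (\<lambda>\<omega> i. V i \<omega>)
          (\<Pi>\<^sub>M i\<in>UNIV. count_space directions)))"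

definition zigzag_law ::
    "'w measure \<Rightarrow> ('w \<Rightarrow> real set) \<Rightarrow> (int \<Rightarrow> 'w \<Rightarrow> real ^ 'd) \<Rightarrow> (real \<Rightarrow> real ^ 'd) measure" where
  "zigzag_law M P V =
     distr M (borel_of cpath_topology) (\<lambda>\<omega>. zigzag_path (P \<omega>) (\<lambda>i. V i \<omega>))"

end

theory Submission
  imports Defs
begin

text \<open>
  All paths involved are 1-Lipschitz and start at 0. Such paths form a compact set, so on it a continuous
  functional is uniformly continuous for the supremum over some \<open>[0, T]\<close>, and no tightness argument
  is needed. On a grid of mesh \<open>h = T / J\<close> both processes are replaced by the polygonal path whose slope
  on the \<open>j\<close>-th cell is the current direction at time \<open>j h\<close>. The direction changes during the \<open>j\<close>-th cell
  with probability \<open>O(1/j)\<close>, uniformly in \<open>n\<close>, so the error is \<open>O(ln J / J)\<close> in mean, and it remains to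
  prove convergence of the finite-dimensional distributions of the directions.

  With \<open>\<Pi>\<close> the projection on constants, a transition matrix \<open>c I + (1 - c) \<Pi>\<close> depends
  multiplicatively on \<open>c\<close>. For the walk, \<open>c = 1 - a/k\<close>, and the product of these numbers over
  \<open>n s < k \<le> n t\<close> tends to \<open>(s/t)\<^sup>a\<close>. For the labels, \<open>c = - 1 / (2 d - 1)\<close>, and the number of points
  in \<open>(s, t]\<close> is Poisson with mean \<open>\<lambda> = b ln (t/s)\<close>, which gives the factor
  \<open>exp (\<lambda> (c - 1)) = (s/t)\<^sup>a\<close> as well.
\<close>

section \<open>Lipschitz paths and their grid approximations\<close>

text \<open>The zigzag process turns infinitely often near time 0, and \<open>p\<close> is
  prescribed only from \<open>n0\<close> on. Both difficulties are removed by leaving the cell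
  \<open>[0, h]\<close> out of every comparison, at the price \<open>h\<close>: at any later time a
  single direction has the uniform law, whatever the transitions before. Walk and zigzag live on
  different probability spaces, so only laws can be compared; following directions instead of
  positions makes this a matter of finitely many word probabilities. The bound \<open>O(1/j)\<close>
  arises because a cell holds about \<open>n h\<close> steps, each of which turns with probability
  at most about \<open>a / (n j h)\<close>. The value of \<open>b\<close> reflects a thinning: a
  fresh uniform direction differs from the old one with probability
  \<open>(2 d - 1) / (2 d)\<close>; algebraically, \<open>b (1 - c) = a\<close>. The direction of
  the zigzag at a grid time is a label with a random index. That index depends on the counts of
  points alone, so independence allows it to be frozen before the chain of labels is
  evaluated.\<close>

definition lip_paths :: "(real \<Rightarrow> 'a::real_normed_vector) set" where
  "lip_paths = {f \<in> extensional {0..}. f 0 = 0 \<and>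
     (\<forall>s\<in>{0..}. \<forall>t\<in>{0..}. dist (f s) (f t) \<le> \<bar>s - t\<bar>)}"

lemma lip_pathsD:
  assumes "f \<in> lip_paths"
  shows "f 0 = 0" "s \<ge> 0 \<Longrightarrow> t \<ge> 0 \<Longrightarrow> dist (f s) (f t) \<le> \<bar>s - t\<bar>"
    "f \<in> extensional {0..}"
  using assms unfolding lip_paths_def by auto

lemma lip_paths_subset_cpaths: "lip_paths \<subseteq> cpaths"
proof
  fix f :: "real \<Rightarrow> 'a" assume f: "f \<in> lip_paths"
  have "1-lipschitz_on {0..} f"
    using lip_pathsD(2)[OF f] by (auto simp: lipschitz_on_def dist_real_def)
  then show "f \<in> cpaths"
    using lip_pathsD(3)[OF f] lipschitz_on_continuous_on unfolding cpaths_def by auto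
qed

text \<open>\<open>compact\<close> refers here to pointwise convergence on the whole function type,
  so Tychonoff applies: the value at \<open>t\<close> is confined to the ball of radius
  \<open>t\<close>. The Lipschitz conditions each bind two coordinates and are closed.\<close>

lemma compact_lip_paths: "compact (lip_paths :: (real \<Rightarrow> 'a::euclidean_space) set)"
proof -
  \<comment> \<open>The singleton at negative times encodes membership in
    \<open>extensional {0..}\<close> and keeps every factor compact; at time 0 the ball has radius 0
    and forces \<open>f 0 = 0\<close>.\<close>
  define C :: "real \<Rightarrow> 'a set" where "C t = (if t \<ge> 0 then cball 0 t else {undefined})" for t
  have "compact (C t)" for t
    unfolding C_def by auto
  then have "compactin (product_topology (\<lambda>_. euclidean) UNIV) (PiE UNIV C)"
    by (simp add: compactin_PiE)
  then have cpt: "compact (PiE UNIV C)"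
    by (simp add: euclidean_product_topology)
  have ev: "continuous_on UNIV (\<lambda>f::real \<Rightarrow> 'a. f t)" for t
    by (rule continuous_on_product_coordinates)
  have cl: "closed {f::real \<Rightarrow> 'a. dist (f s) (f t) \<le> \<bar>s - t\<bar>}" for s t
    by (intro closed_Collect_le continuous_on_dist ev continuous_on_const)
  have eq: "lip_paths = PiE UNIV C \<inter> (\<Inter>s\<in>{0..}. \<Inter>t\<in>{0..}. {f. dist (f s) (f t) \<le> \<bar>s - t\<bar>})" (is "_ = ?R")
  proof (intro equalityI subsetI)
    fix f :: "real \<Rightarrow> 'a" assume f: "f \<in> lip_paths"
    have "f t \<in> C t" for t
    proof (cases "t \<ge> 0")
      case True
      then show ?thesis
        using lip_pathsD(2)[OF f, of 0 t] lip_pathsD(1)[OF f] by (simp add: C_def)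
    next
      case False
      then show ?thesis
        using lip_pathsD(3)[OF f] by (simp add: C_def extensional_def)
    qed
    then show "f \<in> ?R"
      using lip_pathsD(2)[OF f] by auto
  next
    fix f :: "real \<Rightarrow> 'a" assume f: "f \<in> ?R"
    then have fC: "f t \<in> C t" for t by auto
    have "f t = undefined" if "t \<notin> {0..}" for t
      using fC[of t] that by (simp add: C_def)
    then have "f \<in> extensional {0..}"
      unfolding extensional_def by blast
    moreover have "f 0 = 0" using fC[of 0] by (simp add: C_def)
    ultimately show "f \<in> lip_paths"
      using f unfolding lip_paths_def by auto
  qed
  show ?thesis
    unfolding eq by (intro compact_Int_closed cpt closed_INT ballI cl)
qed

text \<open>A Lebesgue number argument. For Lipschitz paths, a compact-open neighbourhood of
  \<open>f\<close> can be detected at finitely many times, hence contains a set that is open for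
  pointwise convergence, and the compactness just proved yields a finite subcover.\<close>

lemma lip_paths_uniformly_continuous:
  fixes F :: "(real \<Rightarrow> 'a::euclidean_space) \<Rightarrow> real"
  assumes F: "continuous_map cpath_topology euclideanreal F" and e: "e > 0"
  obtains T d where "T > 0" "d > 0"
    "\<And>f g. f \<in> lip_paths \<Longrightarrow> g \<in> lip_paths \<Longrightarrow> (\<And>t. t \<in> {0..T} \<Longrightarrow> dist (f t) (g t) < d) \<Longrightarrow>
       \<bar>F f - F g\<bar> < e"
proof -
  \<comment> \<open>The two closeness conditions differ on purpose: \<open>g\<close> is close to
    \<open>f\<close> only on the finite set \<open>G\<close>, which gives an open set of the product
    topology, whereas \<open>g'\<close> is close to \<open>g\<close> uniformly, as in the
    claim.\<close>
  have "\<exists>T d G. T > 0 \<and> d > 0 \<and> finite G \<and>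
      (\<forall>g\<in>lip_paths. \<forall>g'\<in>lip_paths. (\<forall>t\<in>G. dist (g t) (f t) < d) \<longrightarrow>
          (\<forall>t\<in>{0..T}. dist (g t) (g' t) < d) \<longrightarrow> \<bar>F g - F g'\<bar> < e)"
    if f: "f \<in> lip_paths" for f
  proof -
    have "openin cpath_topology {x \<in> topspace cpath_topology. F x \<in> ball (F f) (e/2)}"
      using F by (intro openin_continuous_map_preimage) auto
    then have op: "cpath_open {x \<in> cpaths. F x \<in> ball (F f) (e/2)}"
      by (simp add: openin_cpath_topology topspace_cpath_topology)
    have "f \<in> {x \<in> cpaths. F x \<in> ball (F f) (e/2)}"
      using f lip_paths_subset_cpaths e by auto
    from cpath_openD[OF op this] obtain K r where K: "compact K" "K \<subseteq> {0..}" "r > 0"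
      "cpath_nbhd f K r \<subseteq> {x \<in> cpaths. F x \<in> ball (F f) (e/2)}" .
    obtain T0 where T0: "\<And>x. x \<in> K \<Longrightarrow> \<bar>x\<bar> \<le> T0"
      using compact_imp_bounded[OF K(1)] by (auto simp: bounded_iff)
    define T where "T = max T0 1"
    have T: "T > 0" "\<And>x. x \<in> K \<Longrightarrow> x \<in> {0..T}"
      using T0 K(2) by (fastforce simp: T_def)+
    \<comment> \<open>From \<open>g\<close> to \<open>f\<close> at time \<open>t\<close> costs
      \<open>3 * d\<close>: two Lipschitz moves to a nearby grid time and the distance there. One
      more \<open>d\<close> leads from \<open>g'\<close> to \<open>g\<close>, which makes
      \<open>r\<close>.\<close>
    define d where "d = r / 4"
    define G where "G = (\<lambda>i. real i * d) ` {..nat \<lfloor>T / d\<rfloor>}"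
    have d: "d > 0" using K(3) by (simp add: d_def)
    have near: "\<exists>s\<in>G. s \<ge> 0 \<and> \<bar>s - t\<bar> < d" if t: "t \<in> {0..T}" for t
    proof -
      define i where "i = nat \<lfloor>t / d\<rfloor>"
      have "t / d \<ge> 0" using t d by auto
      then have i: "real i \<le> t / d" "t / d < real i + 1"
        unfolding i_def by linarith+
      have "t / d \<le> T / d" using t d by (intro divide_right_mono) auto
      then have "i \<le> nat \<lfloor>T / d\<rfloor>"
        unfolding i_def by (intro nat_mono floor_mono)
      then have "real i * d \<in> G" unfolding G_def by auto
      moreover have "real i * d \<le> t" "t < real i * d + d"
        using i d by (auto simp: field_simps)
      ultimately show ?thesis using d by (intro bexI[of _ "real i * d"]) auto
    qed
    have "\<bar>F g - F g'\<bar> < e"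
      if g: "g \<in> lip_paths" and g': "g' \<in> lip_paths"
        and gf: "\<forall>t\<in>G. dist (g t) (f t) < d" and gg: "\<forall>t\<in>{0..T}. dist (g t) (g' t) < d" for g g'
    proof -
      have *: "dist (g t) (f t) < 3 * d" if t: "t \<in> {0..T}" for t
      proof -
        obtain s where s: "s \<in> G" "s \<ge> 0" "\<bar>s - t\<bar> < d" using near[OF t] by blast
        have "dist (g t) (f t) \<le> dist (g t) (g s) + dist (g s) (f s) + dist (f s) (f t)"
          by (smt (verit) dist_triangle)
        moreover have "dist (g t) (g s) < d"
          using lip_pathsD(2)[OF g, of t s] s t by auto
        moreover have "dist (f s) (f t) < d"
          using lip_pathsD(2)[OF f, of s t] s t by auto
        ultimately show ?thesis using gf s(1) by fastforce
      qed
      have "g \<in> cpath_nbhd f K r"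
        unfolding cpath_nbhd_def using * T(2) g lip_paths_subset_cpaths d
        by (force simp: d_def)
      moreover have "dist (g' t) (f t) < r" if t: "t \<in> {0..T}" for t
        using *[OF t] gg t dist_triangle[of "g' t" "f t" "g t"]
        by (force simp: d_def dist_commute)
      then have "g' \<in> cpath_nbhd f K r"
        unfolding cpath_nbhd_def using T(2) g' lip_paths_subset_cpaths by auto
      ultimately have "F g \<in> ball (F f) (e/2)" "F g' \<in> ball (F f) (e/2)"
        using K(4) by auto
      then have "\<bar>F f - F g\<bar> < e/2" "\<bar>F f - F g'\<bar> < e/2" by (auto simp: dist_real_def)
      then show ?thesis by linarith
    qed
    then show ?thesis
      using T(1) d by (intro exI[of _ T] exI[of _ d] exI[of _ G]) (auto simp: G_def)
  qed
  then obtain T d G where TdG: "\<And>f. f \<in> lip_paths \<Longrightarrow> T f > (0::real) \<and> d f > (0::real) \<and> finite (G f) \<and>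
      (\<forall>g\<in>lip_paths. \<forall>g'\<in>lip_paths. (\<forall>t\<in>G f. dist (g t) (f t) < d f) \<longrightarrow>
          (\<forall>t\<in>{0..T f}. dist (g t) (g' t) < d f) \<longrightarrow> \<bar>F g - F g'\<bar> < e)"
    by metis
  define U where "U f = (\<Inter>t\<in>G f. {g::real \<Rightarrow> 'a. dist (g t) (f t) < d f})" for f
  have "open (U f)" if "f \<in> lip_paths" for f
    unfolding U_def using TdG[OF that]
    by (intro open_INT ballI open_Collect_less continuous_on_dist continuous_on_product_coordinates
        continuous_on_const) auto
  moreover have "lip_paths \<subseteq> (\<Union>f\<in>lip_paths. U f)"
    using TdG by (force simp: U_def)
  ultimately obtain L where L: "L \<subseteq> lip_paths" "finite L" "lip_paths \<subseteq> (\<Union>f\<in>L. U f)"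
    using compactE_image[OF compact_lip_paths] by metis
  define T' where "T' = Max (insert 1 (T ` L))"
  define d' where "d' = Min (insert 1 (d ` L))"
  show ?thesis
  proof (rule that)
    show "T' > 0" unfolding T'_def using L(2) by (auto simp: less_max_iff_disj Max_gr_iff)
    show "d' > 0" unfolding d'_def using L(1,2) TdG by auto
    fix g g' :: "real \<Rightarrow> 'a"
    assume g: "g \<in> lip_paths" "g' \<in> lip_paths" and gg: "\<And>t. t \<in> {0..T'} \<Longrightarrow> dist (g t) (g' t) < d'"
    obtain f where f: "f \<in> L" "g \<in> U f" using L(3) g by auto
    have "T f \<le> T'" "d' \<le> d f"
      unfolding T'_def d'_def using f L(2) by auto
    then have "\<forall>t\<in>{0..T f}. dist (g t) (g' t) < d f" using gg by force
    then show "\<bar>F g - F g'\<bar> < e"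
      using TdG[of f] f L(1) g unfolding U_def by auto
  qed
qed

text \<open>The coefficient is the time spent in cell \<open>j\<close> before \<open>t\<close>. Cell
  0 is absent, so the path rests at 0 until \<open>h\<close>; after \<open>real (Suc J) * h\<close>
  it stands still.\<close>

definition grid_path :: "real \<Rightarrow> nat \<Rightarrow> (nat \<Rightarrow> 'a::real_vector) \<Rightarrow> real \<Rightarrow> 'a" where
  "grid_path h J y = (\<lambda>t\<in>{0..}.
     \<Sum>j\<in>{1..J}. (min t (real (Suc j) * h) - min t (real j * h)) *\<^sub>R y j)"

lemma telescope_grid:
  fixes g :: "nat \<Rightarrow> 'a::ab_group_add"
  shows "(\<Sum>j\<in>{1..J}. g (Suc j) - g j) = g (Suc J) - g 1"
  by (induction J) (auto simp: algebra_simps)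

text \<open>Every coefficient is nondecreasing in \<open>t\<close>, and their sum telescopes to a
  function of \<open>t\<close> with slope at most 1.\<close>

lemma grid_path_in_lip_paths:
  fixes y :: "nat \<Rightarrow> 'a::real_normed_vector"
  assumes h: "h > 0" and y: "\<And>j. j \<in> {1..J} \<Longrightarrow> norm (y j) \<le> 1"
  shows "grid_path h J y \<in> lip_paths"
proof -
  let ?c = "\<lambda>t j. min t (real (Suc j) * h) - min t (real j * h)"
  have jh: "real j * h \<le> real (Suc j) * h" for j
    using h by (simp add: algebra_simps)
  have le: "dist (grid_path h J y s) (grid_path h J y t) \<le> t - s" if "0 \<le> s" "s \<le> t" for s t
  proof -
    have mono: "?c s j \<le> ?c t j" for j
      using jh[of j] that by (auto simp: min_def)
    have "dist (grid_path h J y s) (grid_path h J y t) = norm (\<Sum>j\<in>{1..J}. (?c t j - ?c s j) *\<^sub>R y j)"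
      unfolding grid_path_def dist_norm using that
      by (subst norm_minus_commute) (simp add: sum_subtractf[symmetric] scaleR_diff_left)
    also have "\<dots> \<le> (\<Sum>j\<in>{1..J}. norm ((?c t j - ?c s j) *\<^sub>R y j))"
      by (rule norm_sum)
    also have "\<dots> \<le> (\<Sum>j\<in>{1..J}. ?c t j - ?c s j)"
    proof (rule sum_mono)
      fix j assume "j \<in> {1..J}"
      with y mono[of j] show "norm ((?c t j - ?c s j) *\<^sub>R y j) \<le> ?c t j - ?c s j"
        by (simp add: mult_left_le)
    qed
    also have "\<dots> = (min t (real (Suc J) * h) - min t (real 1 * h))
         - (min s (real (Suc J) * h) - min s (real 1 * h))"
      unfolding sum_subtractf
      using telescope_grid[of "\<lambda>j. min t (real j * h)" J] telescope_grid[of "\<lambda>j. min s (real j * h)" J]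
      by (simp add: sum_subtractf)
    also have "\<dots> \<le> t - s"
      using that by (auto simp: min_def)
    finally show ?thesis .
  qed
  have "dist (grid_path h J y s) (grid_path h J y t) \<le> \<bar>s - t\<bar>" if "s \<ge> 0" "t \<ge> 0" for s t
    using le[of s t] le[of t s] that by (cases "s \<le> t") (auto simp: dist_commute)
  moreover have "grid_path h J y 0 = 0"
    unfolding grid_path_def using h by (auto simp: min_def intro!: sum.neutral)
  ultimately show ?thesis
    unfolding lip_paths_def by (auto simp: grid_path_def)
qed

text \<open>In a cell of \<open>B\<close> each of the two paths moves at most \<open>h\<close>,
  which accounts for \<open>2 * h\<close> per bad cell; in the other cells the increments agree. The
  single \<open>h\<close> pays for cell 0, where \<open>f\<close> may move and the grid path
  rests.\<close>

lemma grid_path_approx: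
  fixes f :: "real \<Rightarrow> 'a::real_normed_vector"
  assumes f: "f \<in> lip_paths" and h: "h > 0" and y: "\<And>j. j \<in> {1..J} \<Longrightarrow> norm (y j) \<le> 1"
    and good: "\<And>j t. j \<in> {1..J} \<Longrightarrow> j \<notin> B \<Longrightarrow> t \<in> {real j * h..real (Suc j) * h} \<Longrightarrow>
        f t = f (real j * h) + (t - real j * h) *\<^sub>R y j"
    and t: "t \<in> {0..real (Suc J) * h}"
  shows "dist (f t) (grid_path h J y t) \<le> h + 2 * h * real (card ({1..J} \<inter> B))"
proof -
  let ?c = "\<lambda>j. min t (real (Suc j) * h) - min t (real j * h)"
  let ?d = "\<lambda>j. f (min t (real (Suc j) * h)) - f (min t (real j * h))"
  have 1: "f t - f (min t (real 1 * h)) = (\<Sum>j\<in>{1..J}. ?d j)"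
    using t by (subst telescope_grid[of "\<lambda>j. f (min t (real j * h))"]) simp
  have 2: "grid_path h J y t = (\<Sum>j\<in>{1..J}. ?c j *\<^sub>R y j)"
    using t by (simp add: grid_path_def)
  have eq: "f t - grid_path h J y t = f (min t (real 1 * h)) + (\<Sum>j\<in>{1..J}. ?d j - ?c j *\<^sub>R y j)"
    unfolding sum_subtractf[of ?d] 1[symmetric] 2[symmetric] by simp
  have first: "norm (f (min t (real 1 * h))) \<le> h"
    using lip_pathsD(2)[OF f, of "min t (real 1 * h)" 0] lip_pathsD(1)[OF f] t h by auto
  have summand: "norm (?d j - ?c j *\<^sub>R y j) \<le> (if j \<in> B then 2 * h else 0)" if j: "j \<in> {1..J}" for j
  proof -
    have jh: "real (Suc j) * h = real j * h + h" "real j * h \<ge> 0"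
      using h by (auto simp: algebra_simps)
    have c: "0 \<le> ?c j" "?c j \<le> h"
      unfolding jh using h by (auto simp: min_def)
    have "norm (?d j) \<le> ?c j"
      using lip_pathsD(2)[OF f, of "min t (real (Suc j) * h)" "min t (real j * h)"] t c jh h
      by (auto simp: dist_norm)
    moreover have "norm (?c j *\<^sub>R y j) \<le> ?c j"
      using c(1) y[OF j] by (simp add: mult_left_le)
    ultimately have "norm (?d j - ?c j *\<^sub>R y j) \<le> 2 * h"
      using norm_triangle_ineq4[of "?d j" "?c j *\<^sub>R y j"] c by linarith
    moreover have "?d j = ?c j *\<^sub>R y j" if nb: "j \<notin> B"
    proof (cases "t \<le> real j * h")
      case True
      then show ?thesis using jh h by simp
    next
      case False
      then have "min t (real (Suc j) * h) \<in> {real j * h..real (Suc j) * h}"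
        using jh h by auto
      from good[OF j nb this] show ?thesis
        using False by (simp add: min_def)
    qed
    ultimately show ?thesis by auto
  qed
  have "norm (\<Sum>j\<in>{1..J}. ?d j - ?c j *\<^sub>R y j) \<le> (\<Sum>j\<in>{1..J}. if j \<in> B then 2 * h else 0)"
    using summand by (rule sum_norm_le)
  also have "\<dots> = 2 * h * real (card ({1..J} \<inter> B))"
    by (simp add: sum.If_cases Int_def)
  finally show ?thesis
    using first norm_triangle_ineq unfolding dist_norm eq by (smt (verit, best))
qed

lemma grid_path_cong: "(\<And>j. j \<in> {1..J} \<Longrightarrow> y j = y' j) \<Longrightarrow> grid_path h J y = grid_path h J y'"
  unfolding grid_path_def by (intro restrict_ext sum.cong) auto

section \<open>Weak convergence through grid approximations\<close>

lemma space_borel_of [simp]: "space (borel_of T) = topspace T"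
  unfolding borel_of_def by (rule space_measure_of) (auto dest: openin_subset)

lemma measurable_borel_ofI:
  assumes "\<And>\<omega>. \<omega> \<in> space M \<Longrightarrow> X \<omega> \<in> topspace T"
    and "\<And>U. openin T U \<Longrightarrow> X -` U \<inter> space M \<in> sets M"
  shows "X \<in> M \<rightarrow>\<^sub>M borel_of T"
  unfolding borel_of_def
proof (rule measurable_measure_of)
  show "{U. openin T U} \<subseteq> Pow (topspace T)" by (auto dest: openin_subset)
qed (use assms in auto)

lemma borel_measurable_continuous_map:
  assumes "continuous_map T euclideanreal F"
  shows "F \<in> borel_measurable (borel_of T)"
proof (rule borel_measurableI)
  fix S :: "real set" assume "open S"
  then have "openin T {x \<in> topspace T. F x \<in> S}"
    using assms by (intro openin_continuous_map_preimage) auto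
  then have "{x \<in> topspace T. F x \<in> S} \<in> sets (borel_of T)"
    unfolding borel_of_def by (subst sets_measure_of) (auto dest: openin_subset)
  then show "F -` S \<inter> space (borel_of T) \<in> sets (borel_of T)"
    by (simp add: Int_def conj_commute)
qed

text \<open>
  The approximants are measurable for the discrete \<open>\<sigma>\<close>-algebra, so that arbitrary sets of paths,
  such as the erosions \<open>G j\<close> of an open set, may be tested against them.
\<close>

lemma measurable_cpath_limit:
  fixes X :: "'w \<Rightarrow> real \<Rightarrow> 'a::metric_space"
  assumes X: "\<And>\<omega>. \<omega> \<in> space M \<Longrightarrow> X \<omega> \<in> cpaths"
    and Xk: "\<And>k. Xk k \<in> M \<rightarrow>\<^sub>M count_space UNIV"
    and Xkc: "\<And>k \<omega>. \<omega> \<in> space M \<Longrightarrow> Xk k \<omega> \<in> cpaths"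
    and lim: "\<And>\<omega> T e. \<omega> \<in> space M \<Longrightarrow> e > 0 \<Longrightarrow>
      eventually (\<lambda>k. \<forall>t\<in>{0..T}. dist (Xk k \<omega> t) (X \<omega> t) < e) sequentially"
  shows "X \<in> M \<rightarrow>\<^sub>M borel_of cpath_topology"
proof (rule measurable_borel_ofI)
  fix \<omega> assume "\<omega> \<in> space M"
  then show "X \<omega> \<in> topspace cpath_topology" by (simp add: X topspace_cpath_topology)
next
  fix U :: "(real \<Rightarrow> 'a) set" assume "openin cpath_topology U"
  then have U: "cpath_open U" by (simp add: openin_cpath_topology)
  define G where "G j = {f \<in> cpaths. cpath_nbhd f {0..real j} (1 / (real j + 1)) \<subseteq> U}" for j
  \<comment> \<open>The right-hand side says that the approximants eventually stay in one erosion
    \<open>G j\<close>.\<close>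
  have "X -` U \<inter> space M = (\<Union>j. \<Union>n. \<Inter>k. Xk (n + k) -` G j \<inter> space M)"
  proof (intro equalityI subsetI)
    fix \<omega> assume "\<omega> \<in> X -` U \<inter> space M"
    then have \<omega>: "\<omega> \<in> space M" "X \<omega> \<in> U" by auto
    from cpath_openD[OF U \<omega>(2)] obtain K e where K: "compact K" "K \<subseteq> {0..}" "0 < e"
      "cpath_nbhd (X \<omega>) K e \<subseteq> U" .
    obtain T where T: "\<And>x. x \<in> K \<Longrightarrow> \<bar>x\<bar> \<le> T"
      using compact_imp_bounded[OF K(1)] by (auto simp: bounded_iff)
    define j where "j = nat \<lceil>max T (2 / e)\<rceil>"
    have j: "T \<le> real j" "2 / e \<le> real j"
      unfolding j_def by linarith+
    \<comment> \<open>Half of \<open>e\<close> is spent on the radius of the erosion, half on the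
      distance from the approximant to the limit.\<close>
    have ej: "2 * (1 / (real j + 1)) \<le> e"
      using j(2) K(3) by (auto simp: field_simps)
    have "eventually (\<lambda>k. \<forall>t\<in>{0..real j}. dist (Xk k \<omega> t) (X \<omega> t) < 1 / (real j + 1)) sequentially"
      by (rule lim) (use \<omega> in auto)
    then obtain n where n: "\<And>k. k \<ge> n \<Longrightarrow> \<forall>t\<in>{0..real j}. dist (Xk k \<omega> t) (X \<omega> t) < 1 / (real j + 1)"
      unfolding eventually_sequentially by blast
    have "cpath_nbhd (Xk (n + k) \<omega>) {0..real j} (1 / (real j + 1)) \<subseteq> U" for k
    proof
      fix g assume g: "g \<in> cpath_nbhd (Xk (n + k) \<omega>) {0..real j} (1 / (real j + 1))"
      have "dist (g t) (X \<omega> t) < e" if t: "t \<in> K" for t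
      proof -
        have tj: "t \<in> {0..real j}" using t K(2) T[OF t] j(1) by auto
        have "dist (g t) (X \<omega> t) \<le> dist (g t) (Xk (n + k) \<omega> t) + dist (Xk (n + k) \<omega> t) (X \<omega> t)"
          by (rule dist_triangle)
        also have "\<dots> < 1 / (real j + 1) + 1 / (real j + 1)"
          using g tj n[of "n + k"] unfolding cpath_nbhd_def by (intro add_strict_mono) auto
        finally show ?thesis using ej by simp
      qed
      then have "g \<in> cpath_nbhd (X \<omega>) K e"
        using g unfolding cpath_nbhd_def by auto
      with K(4) show "g \<in> U" by blast
    qed
    then show "\<omega> \<in> (\<Union>j. \<Union>n. \<Inter>k. Xk (n + k) -` G j \<inter> space M)"
      using \<omega> Xkc by (auto simp: G_def)
  next
    fix \<omega> assume "\<omega> \<in> (\<Union>j. \<Union>n. \<Inter>k. Xk (n + k) -` G j \<inter> space M)"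
    then obtain j n where jn: "\<omega> \<in> space M" "\<And>k. Xk (n + k) \<omega> \<in> G j" by auto
    have "eventually (\<lambda>k. \<forall>t\<in>{0..real j}. dist (Xk k \<omega> t) (X \<omega> t) < 1 / (real j + 1)) sequentially"
      by (rule lim) (use jn in auto)
    then obtain n' where n': "\<And>k. k \<ge> n' \<Longrightarrow> \<forall>t\<in>{0..real j}. dist (Xk k \<omega> t) (X \<omega> t) < 1 / (real j + 1)"
      unfolding eventually_sequentially by blast
    have "X \<omega> \<in> cpath_nbhd (Xk (n + n') \<omega>) {0..real j} (1 / (real j + 1))"
      using X[OF jn(1)] n'[of "n + n'"] by (auto simp: cpath_nbhd_def dist_commute)
    then show "\<omega> \<in> X -` U \<inter> space M"
      using jn(2)[of n'] jn(1) by (auto simp: G_def)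
  qed
  also have "\<dots> \<in> sets M"
    using measurable_sets[OF Xk] by (intro sets.countable_UN sets.countable_INT image_subsetI) auto
  finally show "X -` U \<inter> space M \<in> sets M" .
qed

lemma measurable_finite_coordinates:
  assumes "finite I" "finite S" "\<And>i. i \<in> I \<Longrightarrow> D i \<in> M \<rightarrow>\<^sub>M count_space S"
  shows "(\<lambda>\<omega>. \<lambda>i\<in>I. D i \<omega>) \<in> M \<rightarrow>\<^sub>M count_space (PiE I (\<lambda>_. S))"
proof -
  have "(\<lambda>\<omega>. \<lambda>i\<in>I. D i \<omega>) \<in> M \<rightarrow>\<^sub>M (\<Pi>\<^sub>M i\<in>I. count_space S)"
    by (intro measurable_restrict assms)
  then show ?thesis
    using assms(1,2) by (subst (asm) count_space_PiM_finite) (auto intro: countable_finite)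
qed

lemma measurable_grid_path:
  assumes "finite S" "\<And>j. j \<in> {1..J} \<Longrightarrow> D j \<in> M \<rightarrow>\<^sub>M count_space S"
  shows "(\<lambda>\<omega>. grid_path h J (\<lambda>j. D j \<omega>)) \<in> M \<rightarrow>\<^sub>M count_space UNIV"
proof -
  have "(\<lambda>\<omega>. \<lambda>j\<in>{1..J}. D j \<omega>) \<in> M \<rightarrow>\<^sub>M count_space (PiE {1..J} (\<lambda>_. S))"
    by (rule measurable_finite_coordinates) (use assms in auto)
  from measurable_compose[OF this, of "grid_path h J" "count_space UNIV"]
  have "(\<lambda>\<omega>. grid_path h J (\<lambda>j\<in>{1..J}. D j \<omega>)) \<in> M \<rightarrow>\<^sub>M count_space UNIV"
    by simp
  moreover have "grid_path h J (\<lambda>j\<in>{1..J}. D j \<omega>) = grid_path h J (\<lambda>j. D j \<omega>)" for \<omega>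
    by (intro grid_path_cong) auto
  ultimately show ?thesis by simp
qed

lemma sets_finite_coordinates:
  assumes "finite I" "\<And>i. i \<in> I \<Longrightarrow> X i \<in> M \<rightarrow>\<^sub>M count_space S"
  shows "{\<omega> \<in> space M. \<forall>i\<in>I. X i \<omega> = w i} \<in> sets M"
proof -
  have "{\<omega> \<in> space M. X i \<omega> = w i} \<in> sets M" if "i \<in> I" for i
  proof -
    have "X i -` ({w i} \<inter> S) \<inter> space M \<in> sets M"
      using assms(2)[OF that] by (rule measurable_sets) simp
    moreover have "X i -` ({w i} \<inter> S) \<inter> space M = {\<omega> \<in> space M. X i \<omega> = w i}"
      using measurable_space[OF assms(2)[OF that]] by auto
    ultimately show ?thesis by simp
  qed
  then show ?thesis using assms(1) by (rule sets.sets_Collect_finite_All)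
qed

text \<open>The alphabet is finite, so the expectation is a finite sum over words. This turns
  convergence of word probabilities into convergence of expectations for an arbitrary
  \<open>G\<close>, such as \<open>F\<close> composed with \<open>grid_path h J\<close>.\<close>

lemma expectation_finite_coordinates:
  fixes G :: "('i \<Rightarrow> 'a) \<Rightarrow> real"
  assumes M: "prob_space M" and I: "finite I" and S: "finite S"
    and D: "\<And>i. i \<in> I \<Longrightarrow> D i \<in> M \<rightarrow>\<^sub>M count_space S"
  shows "(\<integral>\<omega>. G (\<lambda>i\<in>I. D i \<omega>) \<partial>M) =
    (\<Sum>w\<in>PiE I (\<lambda>_. S). G w * \<P>(\<omega> in M. \<forall>i\<in>I. D i \<omega> = w i))"
proof -
  interpret prob_space M by fact
  let ?W = "PiE I (\<lambda>_. S)"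
  let ?A = "\<lambda>w. {\<omega> \<in> space M. \<forall>i\<in>I. D i \<omega> = w i}"
  have finW: "finite ?W" using I S by (intro finite_PiE) auto
  have meas: "?A w \<in> sets M" for w
    by (rule sets_finite_coordinates[OF I D])
  have "G (\<lambda>i\<in>I. D i \<omega>) = (\<Sum>w\<in>?W. G w * indicator (?A w) \<omega>)" if \<omega>: "\<omega> \<in> space M" for \<omega>
  proof -
    let ?u = "\<lambda>i\<in>I. D i \<omega>"
    have u: "?u \<in> ?W" using measurable_space[OF D \<omega>] by auto
    have "indicator (?A w) \<omega> = (if w = ?u then 1 else 0 :: real)" if "w \<in> ?W" for w
    proof -
      have "\<omega> \<in> ?A w \<longleftrightarrow> w = ?u"
        using that \<omega> by (auto simp: PiE_iff extensional_def fun_eq_iff)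
      then show ?thesis by (simp add: indicator_def)
    qed
    then have "(\<Sum>w\<in>?W. G w * indicator (?A w) \<omega>) = (\<Sum>w\<in>?W. if w = ?u then G w else 0)"
      by (intro sum.cong) auto
    then show ?thesis using finW u by simp
  qed
  then have "(\<integral>\<omega>. G (\<lambda>i\<in>I. D i \<omega>) \<partial>M) = (\<integral>\<omega>. (\<Sum>w\<in>?W. G w * indicator (?A w) \<omega>) \<partial>M)"
    by (intro Bochner_Integration.integral_cong) auto
  also have "\<dots> = (\<Sum>w\<in>?W. G w * measure M (?A w))"
    using meas by (subst Bochner_Integration.integral_sum) (auto simp: emeasure_eq_measure)
  finally show ?thesis .
qed

text \<open>
  The bounds \<open>C / j\<close> add up to \<open>C\<close> times a harmonic number, so that for mesh \<open>T / J\<close> the mean distance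
  to the grid path on \<open>[0, T]\<close> is of order \<open>ln J / J\<close>.
\<close>

definition grid_approximable ::
  "'w measure \<Rightarrow> 'a::real_normed_vector set \<Rightarrow> real \<Rightarrow> real \<Rightarrow> nat \<Rightarrow> ('w \<Rightarrow> real \<Rightarrow> 'a) \<Rightarrow> (nat \<Rightarrow> 'w \<Rightarrow> 'a) \<Rightarrow> bool"
  where
  "grid_approximable M S C h J X D \<longleftrightarrow>
     (\<forall>j\<in>{1..J}. D j \<in> M \<rightarrow>\<^sub>M count_space S) \<and>
     (\<exists>Bad. (\<forall>j\<in>{1..J}. Bad j \<in> sets M \<and> measure M (Bad j) \<le> C / real j) \<and>
        (AE \<omega> in M. \<forall>j\<in>{1..J}. \<omega> \<notin> Bad j \<longrightarrow>
           (\<forall>t\<in>{real j * h..real (Suc j) * h}.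
               X \<omega> t = X \<omega> (real j * h) + (t - real j * h) *\<^sub>R D j \<omega>)))"

text \<open>Pathwise, either the distance bound \<open>K\<close> is below \<open>d\<close> and
  uniform continuity gives \<open>e\<close>, or \<open>2 * B\<close> is at most
  \<open>2 * B / d * K\<close>, as in Markov's inequality. The sum of both bounds is affine in the
  number of bad cells, so only the mean of that number enters.\<close>

lemma grid_comparison:
  fixes F :: "(real \<Rightarrow> 'a::euclidean_space) \<Rightarrow> real"
  assumes M: "prob_space M"
    and X: "X \<in> M \<rightarrow>\<^sub>M borel_of cpath_topology" "\<And>\<omega>. \<omega> \<in> space M \<Longrightarrow> X \<omega> \<in> lip_paths"
    and S: "finite S" "\<And>v. v \<in> S \<Longrightarrow> norm v \<le> 1"
    and J: "J > 0" and T: "T > 0"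
    and approx: "grid_approximable M S C (T / real J) J X D"
    and F: "continuous_map cpath_topology euclideanreal F" "\<And>f. f \<in> cpaths \<Longrightarrow> \<bar>F f\<bar> \<le> B"
    and d: "d > 0" and e: "e \<ge> 0"
    and unif: "\<And>f g. f \<in> lip_paths \<Longrightarrow> g \<in> lip_paths \<Longrightarrow>
      (\<And>t. t \<in> {0..T} \<Longrightarrow> dist (f t) (g t) < d) \<Longrightarrow> \<bar>F f - F g\<bar> < e"
  shows "\<bar>(\<integral>\<omega>. F (X \<omega>) \<partial>M) - (\<integral>\<omega>. F (grid_path (T / real J) J (\<lambda>j. D j \<omega>)) \<partial>M)\<bar>
    \<le> e + 2 * B / d * (T / real J * (1 + 2 * C * harm J))"
proof -
  interpret prob_space M by fact
  define h where "h = T / real J"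
  have h: "h > 0" "real (Suc J) * h \<ge> T" using J T by (auto simp: h_def field_simps)
  define P where "P \<omega> = grid_path h J (\<lambda>j. D j \<omega>)" for \<omega>
  from approx have D: "\<And>j. j \<in> {1..J} \<Longrightarrow> D j \<in> M \<rightarrow>\<^sub>M count_space S"
    unfolding grid_approximable_def by blast
  from approx obtain Bad where Bad: "\<And>j. j \<in> {1..J} \<Longrightarrow> Bad j \<in> sets M \<and> measure M (Bad j) \<le> C / real j"
    and good: "AE \<omega> in M. \<forall>j\<in>{1..J}. \<omega> \<notin> Bad j \<longrightarrow>
           (\<forall>t\<in>{real j * h..real (Suc j) * h}.
               X \<omega> t = X \<omega> (real j * h) + (t - real j * h) *\<^sub>R D j \<omega>)"
    unfolding grid_approximable_def h_def by blast
  have norm_D: "norm (D j \<omega>) \<le> 1" if "j \<in> {1..J}" "\<omega> \<in> space M" for j \<omega>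
    using measurable_space[OF D[OF that(1)] that(2)] S(2) by simp
  have Pl: "P \<omega> \<in> lip_paths" if "\<omega> \<in> space M" for \<omega>
    unfolding P_def using h(1) norm_D that by (intro grid_path_in_lip_paths) auto
  have B: "B \<ge> 0"
  proof -
    obtain \<omega> where "\<omega> \<in> space M" using not_empty by blast
    then show ?thesis using F(2)[of "P \<omega>"] Pl lip_paths_subset_cpaths by force
  qed
  have Fm: "F \<in> borel_measurable (borel_of cpath_topology)"
    using F(1) by (rule borel_measurable_continuous_map)
  have FX: "(\<lambda>\<omega>. F (X \<omega>)) \<in> borel_measurable M"
    using Fm X(1) by (rule measurable_compose_rev)
  have "P \<in> M \<rightarrow>\<^sub>M count_space UNIV"
    unfolding P_def using measurable_grid_path S(1) D by blast
  then have FP: "(\<lambda>\<omega>. F (P \<omega>)) \<in> borel_measurable M"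
    by (rule measurable_compose) simp
  have iX: "integrable M (\<lambda>\<omega>. F (X \<omega>))"
    using F(2) X(2) lip_paths_subset_cpaths by (intro integrable_const_bound[of _ B] FX) auto
  have iP: "integrable M (\<lambda>\<omega>. F (P \<omega>))"
    using F(2) Pl lip_paths_subset_cpaths by (intro integrable_const_bound[of _ B] FP) auto
  define N where "N \<omega> = (\<Sum>j\<in>{1..J}. indicator (Bad j) \<omega> :: real)" for \<omega>
  have iN: "integrable M N"
    unfolding N_def using Bad by (intro Bochner_Integration.integrable_sum) (auto simp: emeasure_eq_measure)
  have bound: "AE \<omega> in M. \<bar>F (X \<omega>) - F (P \<omega>)\<bar> \<le> e + 2 * B / d * (h + 2 * h * N \<omega>)"
    using good AE_space
  proof eventually_elim
    case (elim \<omega>)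
    define K where "K = h + 2 * h * N \<omega>"
    have N: "N \<omega> = real (card ({1..J} \<inter> {j. \<omega> \<in> Bad j}))"
      unfolding N_def indicator_def by (simp add: sum.If_cases Int_def)
    have dist: "dist (X \<omega> t) (P \<omega> t) \<le> K" if "t \<in> {0..T}" for t
      unfolding K_def N P_def
    proof (rule grid_path_approx)
      show "X \<omega> \<in> lip_paths" using X(2) elim(2) .
      show "0 < h" by (rule h)
      show "norm (D j \<omega>) \<le> 1" if "j \<in> {1..J}" for j using norm_D that elim(2) .
      show "t \<in> {0..real (Suc J) * h}" using that h(2) by auto
      show "X \<omega> s = X \<omega> (real j * h) + (s - real j * h) *\<^sub>R D j \<omega>"
        if "j \<in> {1..J}" "j \<notin> {j. \<omega> \<in> Bad j}" "s \<in> {real j * h..real (Suc j) * h}" for j s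
        using elim(1) that by blast
    qed
    have "N \<omega> \<ge> 0" unfolding N by simp
    then have K: "K \<ge> 0" unfolding K_def using h by auto
    show ?case
    proof (cases "K < d")
      case True
      have "\<bar>F (X \<omega>) - F (P \<omega>)\<bar> < e"
      proof (rule unif)
        show "X \<omega> \<in> lip_paths" "P \<omega> \<in> lip_paths" using X(2) Pl elim(2) by blast+
        show "dist (X \<omega> t) (P \<omega> t) < d" if "t \<in> {0..T}" for t using dist[OF that] True by simp
      qed
      moreover have "0 \<le> 2 * B / d * K" using B d K by simp
      ultimately show ?thesis unfolding K_def by linarith
    next
      case False
      have "\<bar>F (X \<omega>)\<bar> \<le> B" "\<bar>F (P \<omega>)\<bar> \<le> B"
        using F(2) X(2) Pl elim lip_paths_subset_cpaths by blast+
      then have "\<bar>F (X \<omega>) - F (P \<omega>)\<bar> \<le> 2 * B" by linarith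
      also have "\<dots> = 2 * B / d * d" using d by simp
      also have "\<dots> \<le> 2 * B / d * K" using False B d by (intro mult_left_mono) auto
      finally show ?thesis using e unfolding K_def by linarith
    qed
  qed
  have "\<bar>(\<integral>\<omega>. F (X \<omega>) \<partial>M) - (\<integral>\<omega>. F (P \<omega>) \<partial>M)\<bar> = \<bar>\<integral>\<omega>. F (X \<omega>) - F (P \<omega>) \<partial>M\<bar>"
    using iX iP by simp
  also have "\<dots> \<le> (\<integral>\<omega>. \<bar>F (X \<omega>) - F (P \<omega>)\<bar> \<partial>M)"
    by (rule integral_abs_bound)
  also have "\<dots> \<le> (\<integral>\<omega>. e + 2 * B / d * (h + 2 * h * N \<omega>) \<partial>M)"
    using iX iP iN bound by (intro integral_mono_AE) auto
  also have "\<dots> = e + 2 * B / d * (h + 2 * h * (\<integral>\<omega>. N \<omega> \<partial>M))"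
    using iN by (simp add: prob_space)
  also have "(\<integral>\<omega>. N \<omega> \<partial>M) = (\<Sum>j\<in>{1..J}. measure M (Bad j))"
    unfolding N_def using Bad by (subst Bochner_Integration.integral_sum) (auto simp: emeasure_eq_measure)
  also have "e + 2 * B / d * (h + 2 * h * (\<Sum>j\<in>{1..J}. measure M (Bad j)))
      \<le> e + 2 * B / d * (h + 2 * h * (\<Sum>j\<in>{1..J}. C / real j))"
    using Bad B d h(1) by (intro add_left_mono mult_left_mono sum_mono) auto
  also have "(\<Sum>j\<in>{1..J}. C / real j) = C * harm J"
    unfolding harm_def by (simp add: sum_distrib_left divide_inverse)
  finally show ?thesis
    unfolding P_def h_def by (simp add: algebra_simps)
qed

lemma harm_over_n_tendsto_0: "(\<lambda>n. harm n / real n) \<longlonglongrightarrow> (0::real)"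
proof -
  have "(\<lambda>n. (harm n - ln (real n)) * (1 / real n) + ln (real n) / real n) \<longlonglongrightarrow> euler_mascheroni * 0 + (0::real)"
    by (intro tendsto_add tendsto_mult euler_mascheroni_LIMSEQ lim_1_over_n lim_ln_over_n)
  then show ?thesis
    by (simp add: diff_divide_distrib)
qed

text \<open>The order of the choices matters: \<open>F\<close> determines \<open>T\<close> and
  \<open>d\<close>, the harmonic bound then determines \<open>J\<close>, and only afterwards
  \<open>n\<close> grows. This works because \<open>C\<close> depends neither on \<open>n\<close>
  nor on the mesh. The error budget is \<open>r / 4\<close> for each of the two grid replacements
  and \<open>r / 4\<close> for the finite sums.\<close>

theorem weakly_converges_via_grid:
  fixes X :: "nat \<Rightarrow> 'w \<Rightarrow> real \<Rightarrow> 'a::euclidean_space" and Z :: "'v \<Rightarrow> real \<Rightarrow> 'a"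
  assumes M: "prob_space M" and N: "prob_space N"
    and X: "\<And>n. X n \<in> M \<rightarrow>\<^sub>M borel_of cpath_topology" "\<And>n \<omega>. \<omega> \<in> space M \<Longrightarrow> X n \<omega> \<in> lip_paths"
    and Z: "Z \<in> N \<rightarrow>\<^sub>M borel_of cpath_topology" "\<And>\<omega>. \<omega> \<in> space N \<Longrightarrow> Z \<omega> \<in> lip_paths"
    and S: "finite S" "\<And>v. v \<in> S \<Longrightarrow> norm v \<le> 1"
    and approxX: "\<And>h J. h > 0 \<Longrightarrow> eventually (\<lambda>n. grid_approximable M S C h J (X n) (E h n)) sequentially"
    and approxZ: "\<And>h J. h > 0 \<Longrightarrow> grid_approximable N S C h J Z (D h)"
    and fdd: "\<And>h J w. h > 0 \<Longrightarrow> w \<in> PiE {1..J} (\<lambda>_. S) \<Longrightarrow>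
      (\<lambda>n. \<P>(\<omega> in M. \<forall>j\<in>{1..J}. E h n j \<omega> = w j))
        \<longlonglongrightarrow> \<P>(\<omega> in N. \<forall>j\<in>{1..J}. D h j \<omega> = w j)"
  shows "weakly_converges cpath_topology (\<lambda>n. distr M (borel_of cpath_topology) (X n))
     (distr N (borel_of cpath_topology) Z)"
proof -
  have "(\<lambda>n. \<integral>x. F x \<partial>distr M (borel_of cpath_topology) (X n))
      \<longlonglongrightarrow> (\<integral>x. F x \<partial>distr N (borel_of cpath_topology) Z)"
    if F: "continuous_map cpath_topology euclideanreal F" and bF: "bounded (F ` topspace cpath_topology)"
    for F :: "(real \<Rightarrow> 'a) \<Rightarrow> real"
  proof -
    have Fm: "F \<in> borel_measurable (borel_of cpath_topology)"
      using F by (rule borel_measurable_continuous_map)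
    obtain B where B: "\<And>f. f \<in> cpaths \<Longrightarrow> \<bar>F f\<bar> \<le> B"
      using bF unfolding bounded_iff topspace_cpath_topology by auto
    have "(\<lambda>n. \<integral>\<omega>. F (X n \<omega>) \<partial>M) \<longlonglongrightarrow> (\<integral>\<omega>. F (Z \<omega>) \<partial>N)"
    proof (rule LIMSEQ_I)
      fix r :: real assume r: "r > 0"
      obtain T d where T: "T > 0" and d: "d > 0" and unif:
        "\<And>f g. f \<in> lip_paths \<Longrightarrow> g \<in> lip_paths \<Longrightarrow> (\<And>t. t \<in> {0..T} \<Longrightarrow> dist (f t) (g t) < d) \<Longrightarrow>
           \<bar>F f - F g\<bar> < r / 8"
        using lip_paths_uniformly_continuous[OF F, of "r / 8"] r by auto
      have "(\<lambda>J. 2 * B / d * (T * (1 / real J) + T * 2 * C * (harm J / real J)))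
          \<longlonglongrightarrow> 2 * B / d * (T * 0 + T * 2 * C * 0)"
        by (intro tendsto_intros harm_over_n_tendsto_0 lim_1_over_n)
      then have "eventually (\<lambda>J. 2 * B / d * (T * (1 / real J) + T * 2 * C * (harm J / real J)) < r / 8) sequentially"
        using r by (intro order_tendstoD) auto
      then have "eventually (\<lambda>J. J > 0 \<and> 2 * B / d * (T / real J * (1 + 2 * C * harm J)) < r / 8) sequentially"
        using eventually_gt_at_top[of 0]
        by eventually_elim (auto simp: algebra_simps add_divide_distrib)
      then obtain J where J: "J > 0" "2 * B / d * (T / real J * (1 + 2 * C * harm J)) < r / 8"
        by (metis (mono_tags, lifting) eventually_happens sequentially_bot)
      define h where "h = T / real J"
      have h: "h > 0" using T J by (simp add: h_def)
      let ?G = "\<lambda>w. F (grid_path h J w)"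
      let ?SX = "\<lambda>n. \<Sum>w\<in>PiE {1..J} (\<lambda>_. S). ?G w * \<P>(\<omega> in M. \<forall>j\<in>{1..J}. E h n j \<omega> = w j)"
      let ?SZ = "\<Sum>w\<in>PiE {1..J} (\<lambda>_. S). ?G w * \<P>(\<omega> in N. \<forall>j\<in>{1..J}. D h j \<omega> = w j)"
      have G: "(\<integral>\<omega>. ?G (\<lambda>j. U j \<omega>) \<partial>R) =
          (\<Sum>w\<in>PiE {1..J} (\<lambda>_. S). ?G w * \<P>(\<omega> in R. \<forall>j\<in>{1..J}. U j \<omega> = w j))"
        if "grid_approximable R S C h J Q U" "prob_space R" for R :: "'r measure" and Q U
      proof -
        have "grid_path h J (\<lambda>j. U j \<omega>) = grid_path h J (\<lambda>j\<in>{1..J}. U j \<omega>)" for \<omega>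
          by (rule grid_path_cong) auto
        then show ?thesis
          using that expectation_finite_coordinates[of R "{1..J}" S U ?G] S(1)
          by (simp add: grid_approximable_def)
      qed
      have lim: "?SX \<longlonglongrightarrow> ?SZ"
        using fdd[OF h] by (intro tendsto_sum tendsto_mult tendsto_const) auto
      \<comment> \<open>Stated for an arbitrary probability space because it is applied to
        \<open>M\<close> and to \<open>N\<close>.\<close>
      have cmp: "\<bar>(\<integral>\<omega>. F (Q \<omega>) \<partial>R) - (\<integral>\<omega>. ?G (\<lambda>j. U j \<omega>) \<partial>R)\<bar> < r / 4"
        if "prob_space R" "Q \<in> R \<rightarrow>\<^sub>M borel_of cpath_topology" "\<And>\<omega>. \<omega> \<in> space R \<Longrightarrow> Q \<omega> \<in> lip_paths"
          "grid_approximable R S C h J Q U" for R :: "'r measure" and Q U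
      proof -
        have "\<bar>(\<integral>\<omega>. F (Q \<omega>) \<partial>R) - (\<integral>\<omega>. ?G (\<lambda>j. U j \<omega>) \<partial>R)\<bar>
            \<le> r / 8 + 2 * B / d * (T / real J * (1 + 2 * C * harm J))"
          unfolding h_def
          by (rule grid_comparison[OF that(1-3) S J(1) T that(4)[unfolded h_def] F B d _ unif]) (use r in auto)
        then show ?thesis using J(2) by linarith
      qed
      have "eventually (\<lambda>n. \<bar>?SX n - ?SZ\<bar> < r / 4) sequentially"
        using tendstoD[OF lim, of "r / 4"] r by (simp add: dist_real_def)
      with approxX[OF h, of J] have "eventually (\<lambda>n. norm ((\<integral>\<omega>. F (X n \<omega>) \<partial>M) - (\<integral>\<omega>. F (Z \<omega>) \<partial>N)) < r) sequentially"
      proof eventually_elim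
        case (elim n)
        show ?case
          using cmp[OF M X elim(1)] cmp[OF N Z approxZ[OF h]] elim(2)
          unfolding G[OF elim(1) M] G[OF approxZ[OF h] N] real_norm_def by linarith
      qed
      then show "\<exists>no. \<forall>n\<ge>no. norm ((\<integral>\<omega>. F (X n \<omega>) \<partial>M) - (\<integral>\<omega>. F (Z \<omega>) \<partial>N)) < r"
        by (simp add: eventually_sequentially)
    qed
    then show ?thesis
      using Fm X(1) Z(1) by (simp add: integral_distr)
  qed
  then show ?thesis
    unfolding weakly_converges_def
    using X(1) Z(1) M N by (auto intro: prob_space.prob_space_distr)
qed

section \<open>Markov chains with transition matrices \<open>c I + (1 - c) \<Pi>\<close>\<close>

text \<open>
  Both the walk and the labels have transition matrices of the form \<open>c I + (1 - c) \<Pi>\<close>, where \<open>\<Pi>\<close> is the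
  projection on constants; such matrices multiply by multiplying the parameters \<open>c\<close>.
\<close>

definition mix :: "'a set \<Rightarrow> real \<Rightarrow> 'a \<Rightarrow> 'a \<Rightarrow> real" where
  "mix S c x y = c * (if x = y then 1 else 0) + (1 - c) / real (card S)"

text \<open>\<open>\<Pi>\<close> is idempotent, so the product of \<open>c I + (1 - c) \<Pi>\<close>
  and \<open>c' I + (1 - c') \<Pi>\<close> collapses. The identity is purely algebraic and covers
  negative parameters, as the labels require.\<close>

lemma mix_compose:
  assumes S: "finite S" and xy: "x \<in> S" "y \<in> S"
  shows "(\<Sum>z\<in>S. mix S c x z * mix S c' z y) = mix S (c * c') x y"
proof -
  let ?m = "real (card S)"
  have m: "?m > 0" using S xy(1) by (auto simp: card_gt_0_iff)
  have "(\<Sum>z\<in>S. mix S c x z * mix S c' z y) =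
     (\<Sum>z\<in>S. (if x = z then c * (c' * (if x = y then 1 else 0) + (1 - c') / ?m) else 0)
        + (if z = y then (1 - c) / ?m * c' else 0) + (1 - c) / ?m * ((1 - c') / ?m))"
    unfolding mix_def by (intro sum.cong) (auto simp: algebra_simps)
  also have "\<dots> = c * (c' * (if x = y then 1 else 0) + (1 - c') / ?m) + (1 - c) / ?m * c'
      + ?m * ((1 - c) / ?m * ((1 - c') / ?m))"
    using S xy by (simp add: sum.distrib)
  also have "\<dots> = mix S (c * c') x y"
    using m unfolding mix_def by (simp add: field_simps)
  finally show ?thesis .
qed

lemma mix_1: "x \<in> S \<Longrightarrow> mix S 1 x y = (if x = y then 1 else 0)"
  by (simp add: mix_def)

lemma mix_commute: "mix S c x y = mix S c y x"
  by (simp add: mix_def)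

lemma sum_mix:
  assumes "finite S" "x \<in> S"
  shows "(\<Sum>y\<in>S. mix S c x y) = 1"
proof -
  have "real (card S) > 0" "S \<noteq> {}" using assms by (auto simp: card_gt_0_iff)
  then show ?thesis
    using assms by (simp add: mix_def sum.distrib sum_distrib_left[symmetric])
qed

lemma tendsto_mix:
  assumes "(f \<longlongrightarrow> c) G"
  shows "((\<lambda>n. mix S (f n) x y) \<longlongrightarrow> mix S c x y) G"
  unfolding mix_def divide_inverse by (intro tendsto_intros assms)

text \<open>The law is given by word probabilities instead of conditional ones, which avoids
  conditioning on null events. The uniform initial law is invariant under every
  \<open>mix S c\<close>.\<close>

definition mix_chain :: "'w measure \<Rightarrow> 'a set \<Rightarrow> (nat \<Rightarrow> real) \<Rightarrow> (nat \<Rightarrow> 'w \<Rightarrow> 'a) \<Rightarrow> bool" where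
  "mix_chain M S c X \<longleftrightarrow> prob_space M \<and> finite S \<and> S \<noteq> {} \<and>
     (\<forall>k\<ge>1. X k \<in> M \<rightarrow>\<^sub>M count_space S) \<and>
     (\<forall>n\<ge>1. \<forall>w. w \<in> {1..n} \<rightarrow> S \<longrightarrow>
        \<P>(\<omega> in M. \<forall>k\<in>{1..n}. X k \<omega> = w k) =
          1 / real (card S) * (\<Prod>k\<in>{1..<n}. mix S (c k) (w k) (w (Suc k))))"

context
  fixes M :: "'w measure" and S :: "'a set" and c X
  assumes chain: "mix_chain M S c X"
begin

interpretation prob_space M
  using chain by (simp add: mix_chain_def)

lemma chain_S: "finite S" "S \<noteq> {}" and chain_measurable: "k \<ge> 1 \<Longrightarrow> X k \<in> M \<rightarrow>\<^sub>M count_space S"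
  and chain_word: "n \<ge> 1 \<Longrightarrow> w \<in> {1..n} \<rightarrow> S \<Longrightarrow>
    \<P>(\<omega> in M. \<forall>k\<in>{1..n}. X k \<omega> = w k) =
      1 / real (card S) * (\<Prod>k\<in>{1..<n}. mix S (c k) (w k) (w (Suc k)))"
  using chain by (auto simp: mix_chain_def)

lemma chain_history_event: "{\<omega> \<in> space M. Q (\<lambda>k\<in>{1..n}. X k \<omega>)} \<in> events"
proof -
  have "(\<lambda>\<omega>. \<lambda>k\<in>{1..n}. X k \<omega>) \<in> M \<rightarrow>\<^sub>M count_space (PiE {1..n} (\<lambda>_. S))"
    using chain_S chain_measurable by (intro measurable_finite_coordinates) auto
  from measurable_compose[OF this, of Q "count_space UNIV"]
  have "(\<lambda>\<omega>. Q (\<lambda>k\<in>{1..n}. X k \<omega>)) \<in> M \<rightarrow>\<^sub>M count_space UNIV" by simp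
  then show ?thesis by (simp add: pred_def[symmetric])
qed

lemma chain_split_history:
  assumes E: "E \<in> events"
  shows "\<P>(\<omega> in M. Q (\<lambda>k\<in>{1..n}. X k \<omega>) \<and> \<omega> \<in> E) =
    (\<Sum>w\<in>{w \<in> PiE {1..n} (\<lambda>_. S). Q w}. \<P>(\<omega> in M. (\<forall>k\<in>{1..n}. X k \<omega> = w k) \<and> \<omega> \<in> E))"
proof -
  let ?W = "{w \<in> PiE {1..n} (\<lambda>_. S). Q w}"
  let ?A = "\<lambda>w. {\<omega> \<in> space M. (\<forall>k\<in>{1..n}. X k \<omega> = w k) \<and> \<omega> \<in> E}"
  have fin: "finite ?W"
    using chain_S(1) by (intro finite_subset[OF _ finite_PiE[of "{1..n}" "\<lambda>_. S"]]) auto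
  have uniq: "w = (\<lambda>k\<in>{1..n}. X k \<omega>)" if "w \<in> ?W" "\<omega> \<in> ?A w" for w \<omega>
    using that by (auto simp: PiE_iff extensional_def fun_eq_iff)
  have "{\<omega> \<in> space M. Q (\<lambda>k\<in>{1..n}. X k \<omega>) \<and> \<omega> \<in> E} = (\<Union>w\<in>?W. ?A w)"
  proof (intro equalityI subsetI)
    fix \<omega> assume \<omega>: "\<omega> \<in> {\<omega> \<in> space M. Q (\<lambda>k\<in>{1..n}. X k \<omega>) \<and> \<omega> \<in> E}"
    have "X k \<omega> \<in> S" if "k \<in> {1..n}" for k
      using measurable_space[OF chain_measurable] that \<omega> by auto
    then show "\<omega> \<in> (\<Union>w\<in>?W. ?A w)"
      using \<omega> by (intro UN_I[of "\<lambda>k\<in>{1..n}. X k \<omega>"]) auto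
  next
    fix \<omega> assume "\<omega> \<in> (\<Union>w\<in>?W. ?A w)"
    then obtain w where w: "w \<in> ?W" "\<omega> \<in> ?A w" by auto
    then have "w = (\<lambda>k\<in>{1..n}. X k \<omega>)"
      by (rule uniq)
    then show "\<omega> \<in> {\<omega> \<in> space M. Q (\<lambda>k\<in>{1..n}. X k \<omega>) \<and> \<omega> \<in> E}" using w by auto
  qed
  moreover have "disjoint_family_on ?A ?W"
    unfolding disjoint_family_on_def using uniq by blast
  moreover have "?A w \<in> events" for w
  proof -
    have "{\<omega> \<in> space M. \<forall>k\<in>{1..n}. (\<lambda>k\<in>{1..n}. X k \<omega>) k = w k} \<inter> E \<in> events"
      using chain_history_event[of "\<lambda>v. \<forall>k\<in>{1..n}. v k = w k" n] E by (rule sets.Int)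
    moreover have "{\<omega> \<in> space M. \<forall>k\<in>{1..n}. (\<lambda>k\<in>{1..n}. X k \<omega>) k = w k} \<inter> E = ?A w" by auto
    ultimately show ?thesis by simp
  qed
  ultimately show ?thesis
    using fin by (subst finite_measure_finite_Union[symmetric]) auto
qed

lemma chain_event: "k \<ge> 1 \<Longrightarrow> {\<omega> \<in> space M. X k \<omega> = y} \<in> events"
  using chain_history_event[of "\<lambda>v. v k = y" k] by simp

text \<open>Splitting the past into words reduces the Markov property to the product formula, whose
  last factor separates. \<open>Q\<close> is arbitrary so that the later inductions can hide any
  event of earlier times in it.\<close>

lemma chain_step:
  assumes n: "n \<ge> 1" and y: "y \<in> S"
  shows "\<P>(\<omega> in M. Q (\<lambda>k\<in>{1..n}. X k \<omega>) \<and> X n \<omega> = x \<and> X (Suc n) \<omega> = y) =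
    \<P>(\<omega> in M. Q (\<lambda>k\<in>{1..n}. X k \<omega>) \<and> X n \<omega> = x) * mix S (c n) x y"
proof -
  let ?Q = "\<lambda>v. Q v \<and> v n = x"
  let ?W = "{w \<in> PiE {1..n} (\<lambda>_. S). ?Q w}"
  have "\<P>(\<omega> in M. Q (\<lambda>k\<in>{1..n}. X k \<omega>) \<and> X n \<omega> = x \<and> X (Suc n) \<omega> = y) =
      \<P>(\<omega> in M. ?Q (\<lambda>k\<in>{1..n}. X k \<omega>) \<and> \<omega> \<in> {\<omega> \<in> space M. X (Suc n) \<omega> = y})"
    using n by (intro arg_cong[where f=prob]) auto
  also have "\<dots> = (\<Sum>w\<in>?W. \<P>(\<omega> in M. (\<forall>k\<in>{1..n}. X k \<omega> = w k) \<and> \<omega> \<in> {\<omega> \<in> space M. X (Suc n) \<omega> = y}))"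
    by (rule chain_split_history) (simp add: chain_event)
  also have "\<dots> = (\<Sum>w\<in>?W. \<P>(\<omega> in M. \<forall>k\<in>{1..n}. X k \<omega> = w k) * mix S (c n) x y)"
  proof (rule sum.cong)
    fix w assume w: "w \<in> ?W"
    let ?w = "w(Suc n := y)"
    have "\<P>(\<omega> in M. (\<forall>k\<in>{1..n}. X k \<omega> = w k) \<and> \<omega> \<in> {\<omega> \<in> space M. X (Suc n) \<omega> = y})
        = \<P>(\<omega> in M. \<forall>k\<in>{1..Suc n}. X k \<omega> = ?w k)"
      by (intro arg_cong[where f=prob]) (auto simp: atLeastAtMostSuc_conv simp del: One_nat_def)
    also have "\<dots> = 1 / real (card S) * (\<Prod>k\<in>{1..<Suc n}. mix S (c k) (?w k) (?w (Suc k)))"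
      using w y by (intro chain_word) (auto simp: PiE_iff le_Suc_eq)
    also have "(\<Prod>k\<in>{1..<Suc n}. mix S (c k) (?w k) (?w (Suc k))) =
        (\<Prod>k\<in>{1..<n}. mix S (c k) (w k) (w (Suc k))) * mix S (c n) x y"
      using n w by (simp add: prod.op_ivl_Suc)
    also have "1 / real (card S) * ((\<Prod>k\<in>{1..<n}. mix S (c k) (w k) (w (Suc k))) * mix S (c n) x y) =
       \<P>(\<omega> in M. \<forall>k\<in>{1..n}. X k \<omega> = w k) * mix S (c n) x y"
      using w n by (subst chain_word) (auto simp: PiE_iff)
    finally show "\<P>(\<omega> in M. (\<forall>k\<in>{1..n}. X k \<omega> = w k) \<and> \<omega> \<in> {\<omega> \<in> space M. X (Suc n) \<omega> = y}) =
       \<P>(\<omega> in M. \<forall>k\<in>{1..n}. X k \<omega> = w k) * mix S (c n) x y" .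
  qed simp
  also have "\<dots> = \<P>(\<omega> in M. ?Q (\<lambda>k\<in>{1..n}. X k \<omega>)) * mix S (c n) x y"
  proof -
    have "{\<omega> \<in> space M. R \<omega> \<and> \<omega> \<in> space M} = {\<omega> \<in> space M. R \<omega>}" for R by auto
    with chain_split_history[OF sets.top, of ?Q n]
    show ?thesis by (simp only: sum_distrib_right)
  qed
  also have "{\<omega> \<in> space M. ?Q (\<lambda>k\<in>{1..n}. X k \<omega>)} =
      {\<omega> \<in> space M. Q (\<lambda>k\<in>{1..n}. X k \<omega>) \<and> X n \<omega> = x}"
    using n by auto
  finally show ?thesis .
qed

lemma prob_sum_over_state:
  assumes "k \<ge> 1" "A \<in> events"
  shows "prob A = (\<Sum>z\<in>S. \<P>(\<omega> in M. \<omega> \<in> A \<and> X k \<omega> = z))"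
proof -
  have A: "A = (\<Union>z\<in>S. {\<omega> \<in> space M. \<omega> \<in> A \<and> X k \<omega> = z})"
    using sets.sets_into_space[OF assms(2)] measurable_space[OF chain_measurable[OF assms(1)]] by auto
  have "{\<omega> \<in> space M. \<omega> \<in> A \<and> X k \<omega> = z} = A \<inter> {\<omega> \<in> space M. X k \<omega> = z}" for z
    using sets.sets_into_space[OF assms(2)] by auto
  then have "{\<omega> \<in> space M. \<omega> \<in> A \<and> X k \<omega> = z} \<in> events" for z
    using chain_event[OF assms(1)] assms(2) by simp
  then have "prob (\<Union>z\<in>S. {\<omega> \<in> space M. \<omega> \<in> A \<and> X k \<omega> = z}) =
      (\<Sum>z\<in>S. \<P>(\<omega> in M. \<omega> \<in> A \<and> X k \<omega> = z))"
    by (intro finite_measure_finite_Union chain_S) (auto simp: disjoint_family_on_def)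
  then show ?thesis using A by simp
qed

text \<open>Chapman-Kolmogorov: summing over the state at time \<open>n + r\<close> composes two
  matrices, which \<open>mix_compose\<close> merges into one.\<close>

lemma chain_steps:
  assumes n: "n \<ge> 1" and x: "x \<in> S" and y: "y \<in> S"
  shows "\<P>(\<omega> in M. Q (\<lambda>k\<in>{1..n}. X k \<omega>) \<and> X n \<omega> = x \<and> X (n + r) \<omega> = y) =
    \<P>(\<omega> in M. Q (\<lambda>k\<in>{1..n}. X k \<omega>) \<and> X n \<omega> = x) * mix S (\<Prod>k\<in>{n..<n + r}. c k) x y"
  using y
proof (induction r arbitrary: y)
  case 0
  show ?case
  proof (cases "x = y")
    case True
    then show ?thesis using x by (simp add: mix_1)
  next
    case False
    then have "{\<omega> \<in> space M. Q (\<lambda>k\<in>{1..n}. X k \<omega>) \<and> X n \<omega> = x \<and> X (n + 0) \<omega> = y} = {}" by auto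
    then show ?thesis using x False by (simp only:) (simp add: mix_1)
  qed
next
  case (Suc r)
  \<comment> \<open>For \<open>chain_step\<close> at time \<open>n + r\<close>, the past up to
    \<open>n\<close> has to be presented as a property of the longer history; restricting that
    history recovers it.\<close>
  let ?Q = "\<lambda>v. Q (restrict v {1..n}) \<and> v n = x"
  have hist: "restrict (\<lambda>k\<in>{1..n + r}. X k \<omega>) {1..n} = (\<lambda>k\<in>{1..n}. X k \<omega>)"
    "(\<lambda>k\<in>{1..n + r}. X k \<omega>) n = X n \<omega>" for \<omega>
    using n by (auto simp: restrict_def fun_eq_iff)
  let ?A = "{\<omega> \<in> space M. Q (\<lambda>k\<in>{1..n}. X k \<omega>) \<and> X n \<omega> = x \<and> X (n + Suc r) \<omega> = y}"
  let ?P0 = "\<P>(\<omega> in M. Q (\<lambda>k\<in>{1..n}. X k \<omega>) \<and> X n \<omega> = x)"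
  let ?q = "\<Prod>k\<in>{n..<n + r}. c k"
  have "?A = {\<omega> \<in> space M. Q (restrict (\<lambda>k\<in>{1..n + Suc r}. X k \<omega>) {1..n})
      \<and> (\<lambda>k\<in>{1..n + Suc r}. X k \<omega>) n = x \<and> (\<lambda>k\<in>{1..n + Suc r}. X k \<omega>) (n + Suc r) = y}"
    using n by (simp add: restrict_restrict Int_absorb1 Int_absorb2)
  also have "\<dots> \<in> events" by (rule chain_history_event)
  finally have A: "?A \<in> events" .
  have "prob ?A = (\<Sum>z\<in>S. \<P>(\<omega> in M. \<omega> \<in> ?A \<and> X (n + r) \<omega> = z))"
    using n by (intro prob_sum_over_state A) auto
  also have "\<dots> = (\<Sum>z\<in>S. ?P0 * (mix S ?q x z * mix S (c (n + r)) z y))"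
  proof (rule sum.cong)
    fix z assume z: "z \<in> S"
    have "\<P>(\<omega> in M. \<omega> \<in> ?A \<and> X (n + r) \<omega> = z) =
        \<P>(\<omega> in M. ?Q (\<lambda>k\<in>{1..n + r}. X k \<omega>) \<and> X (n + r) \<omega> = z \<and> X (Suc (n + r)) \<omega> = y)"
      by (intro arg_cong[where f=prob]) (auto simp: hist simp del: restrict_apply One_nat_def)
    also have "\<dots> = \<P>(\<omega> in M. ?Q (\<lambda>k\<in>{1..n + r}. X k \<omega>) \<and> X (n + r) \<omega> = z) * mix S (c (n + r)) z y"
      using n Suc.prems by (intro chain_step) auto
    also have "{\<omega> \<in> space M. ?Q (\<lambda>k\<in>{1..n + r}. X k \<omega>) \<and> X (n + r) \<omega> = z} =
        {\<omega> \<in> space M. Q (\<lambda>k\<in>{1..n}. X k \<omega>) \<and> X n \<omega> = x \<and> X (n + r) \<omega> = z}"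
      by (auto simp: hist simp del: restrict_apply One_nat_def)
    also have "prob \<dots> = ?P0 * mix S ?q x z"
      by (rule Suc.IH[OF z])
    finally show "\<P>(\<omega> in M. \<omega> \<in> ?A \<and> X (n + r) \<omega> = z) =
        ?P0 * (mix S ?q x z * mix S (c (n + r)) z y)" by (simp only: mult.assoc)
  qed simp
  also have "\<dots> = ?P0 * mix S (?q * c (n + r)) x y"
    unfolding sum_distrib_left[symmetric] using chain_S x Suc.prems by (simp add: mix_compose)
  also have "?q * c (n + r) = (\<Prod>k\<in>{n..<n + Suc r}. c k)" by simp
  finally show ?case .
qed

text \<open>Row sums are 1 and \<open>mix\<close> is symmetric, so column sums are 1 as well and the
  uniform law is preserved.\<close>

lemma chain_marginal:
  assumes n: "n \<ge> 1" and y: "y \<in> S"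
  shows "\<P>(\<omega> in M. X n \<omega> = y) = 1 / real (card S)"
proof -
  have start: "\<P>(\<omega> in M. X 1 \<omega> = x) = 1 / real (card S)" if "x \<in> S" for x
    using chain_word[of 1 "\<lambda>_. x"] that by simp
  have "\<P>(\<omega> in M. X n \<omega> = y) = (\<Sum>x\<in>S. \<P>(\<omega> in M. \<omega> \<in> {\<omega> \<in> space M. X n \<omega> = y} \<and> X 1 \<omega> = x))"
    using n by (intro prob_sum_over_state chain_event) auto
  also have "\<dots> = (\<Sum>x\<in>S. 1 / real (card S) * mix S (\<Prod>k\<in>{1..<1 + (n - 1)}. c k) x y)"
  proof (rule sum.cong)
    fix x assume x: "x \<in> S"
    have "{\<omega> \<in> space M. \<omega> \<in> {\<omega> \<in> space M. X n \<omega> = y} \<and> X 1 \<omega> = x} =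
       {\<omega> \<in> space M. True \<and> X 1 \<omega> = x \<and> X (1 + (n - 1)) \<omega> = y}" using n by auto
    then show "\<P>(\<omega> in M. \<omega> \<in> {\<omega> \<in> space M. X n \<omega> = y} \<and> X 1 \<omega> = x) =
        1 / real (card S) * mix S (\<Prod>k\<in>{1..<1 + (n - 1)}. c k) x y"
      using chain_steps[of 1 x y "\<lambda>_. True" "n - 1"] x y start by simp
  qed simp
  also have "\<dots> = 1 / real (card S)"
    unfolding sum_distrib_left[symmetric] using chain_S y by (subst mix_commute) (simp add: sum_mix)
  finally show ?thesis .
qed

text \<open>Times may coincide: the product over an empty range is 1, and \<open>mix S 1\<close> is
  the identity. This does occur, when no step or no turning point separates two grid times.\<close>

theorem chain_fdd:
  assumes J: "J \<ge> 1" and m: "m 1 \<ge> 1" "mono_on {1..J} m" and w: "w \<in> {1..J} \<rightarrow> S"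
  shows "\<P>(\<omega> in M. \<forall>j\<in>{1..J}. X (m j) \<omega> = w j) =
    1 / real (card S) * (\<Prod>j\<in>{1..<J}. mix S (\<Prod>k\<in>{m j..<m (Suc j)}. c k) (w j) (w (Suc j)))"
  using J m(2) w
proof (induction J rule: dec_induct)
  case base
  then show ?case using chain_marginal m(1) by simp
next
  case (step J)
  let ?Q = "\<lambda>v. \<forall>j\<in>{1..J}. v (m j) = w j"
  have mono: "m j \<le> m J" if "j \<in> {1..J}" for j
    using step that by (intro mono_onD[OF step.prems(1)]) auto
  have m1: "m j \<ge> 1" if "j \<in> {1..J}" for j
    using mono_onD[OF step.prems(1), of 1 j] m(1) that by auto
  have mS: "m J \<le> m (Suc J)"
    using step by (intro mono_onD[OF step.prems(1)]) auto
  have hist: "(\<lambda>k\<in>{1..m J}. X k \<omega>) (m j) = X (m j) \<omega>" if "j \<in> {1..J}" for j \<omega>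
    using mono[OF that] m1[OF that] by simp
  have hQ: "?Q (\<lambda>k\<in>{1..m J}. X k \<omega>) \<longleftrightarrow> (\<forall>j\<in>{1..J}. X (m j) \<omega> = w j)" for \<omega>
    using hist by metis
  have J: "J \<in> {1..J}" using step.hyps by simp
  have ins: "{1..Suc J} = insert (Suc J) {1..J}" by auto
  let ?H = "{\<omega> \<in> space M. ?Q (\<lambda>k\<in>{1..m J}. X k \<omega>) \<and> X (m J) \<omega> = w J}"
  have H: "?H = {\<omega> \<in> space M. \<forall>j\<in>{1..J}. X (m j) \<omega> = w j}"
    unfolding hQ by (rule Collect_cong) (use J in blast)
  have ev: "(\<forall>j\<in>{1..Suc J}. X (m j) \<omega> = w j) \<longleftrightarrow>
      ?Q (\<lambda>k\<in>{1..m J}. X k \<omega>) \<and> X (m J) \<omega> = w J \<and> X (m J + (m (Suc J) - m J)) \<omega> = w (Suc J)" for \<omega>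
    unfolding hQ ins using mS J by auto
  have "\<P>(\<omega> in M. \<forall>j\<in>{1..Suc J}. X (m j) \<omega> = w j) = prob ?H
      * mix S (\<Prod>k\<in>{m J..<m J + (m (Suc J) - m J)}. c k) (w J) (w (Suc J))"
    unfolding ev by (rule chain_steps) (use m1[OF J] step.prems(2) J in auto)
  also have "prob ?H = 1 / real (card S) * (\<Prod>j\<in>{1..<J}. mix S (\<Prod>k\<in>{m j..<m (Suc j)}. c k) (w j) (w (Suc j)))"
    unfolding H by (rule step.IH) (use mono_on_subset[OF step.prems(1), of "{1..J}"] step.prems(2) in auto)
  finally show ?case
    using mS step.hyps by (simp add: prod.op_ivl_Suc)
qed

end

section \<open>The walk\<close>

lemma directions_eq: "(directions :: (real ^ 'd) set) = Basis \<union> uminus ` Basis"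
  unfolding directions_def Basis_vec_def by auto

lemma finite_directions: "finite (directions :: (real ^ 'd) set)"
  by (simp add: directions_eq)

lemma norm_directions: "v \<in> directions \<Longrightarrow> norm v = 1"
  by (auto simp: directions_eq)

lemma card_directions: "card (directions :: (real ^ 'd) set) = 2 * CARD('d)"
proof -
  have "(Basis :: (real ^ 'd) set) \<inter> uminus ` Basis = {}"
  proof -
    have False if u: "u \<in> Basis" "- u \<in> Basis" for u :: "real ^ 'd"
    proof -
      have "inner u u = 1" using u(1) by simp
      moreover have "inner u (- u) = (if u = - u then 1 else 0)" using inner_Basis[OF u] .
      ultimately show False by (auto split: if_splits)
    qed
    then show ?thesis by force
  qed
  then show ?thesis
    unfolding directions_eq
    by (subst card_Un_disjoint) (auto simp: card_image inj_on_def)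
qed

lemma directions_nonempty: "(directions :: (real ^ 'd) set) \<noteq> {}"
  by (simp add: directions_eq)

lemma pmf_of_directions: "v \<in> directions \<Longrightarrow> pmf (pmf_of_set directions) v = 1 / real (card (directions :: (real ^ 'd) set))"
  for v :: "real ^ 'd"
  by (simp add: pmf_of_set finite_directions directions_nonempty)

lemma step_matrix_eq_mix: "step_matrix p n x y = mix directions (1 - p n) x y"
  by (simp add: step_matrix_def mix_def card_directions)

text \<open>A null conditioning event makes both sides 0, so the premise may be restricted to
  positive probability, just as the transition clauses of the walk and of the labels are.\<close>

lemma prob_eq_cond_prob:
  assumes "prob_space M" "\<P>(\<omega> in M. Q \<omega>) > 0 \<Longrightarrow> cond_prob M P Q = r"
    and "{\<omega> \<in> space M. P \<omega> \<and> Q \<omega>} \<in> sets M" "{\<omega> \<in> space M. Q \<omega>} \<in> sets M"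
  shows "\<P>(\<omega> in M. P \<omega> \<and> Q \<omega>) = \<P>(\<omega> in M. Q \<omega>) * r"
proof -
  interpret prob_space M by fact
  show ?thesis
  proof (cases "\<P>(\<omega> in M. Q \<omega>) > 0")
    case True
    then show ?thesis using assms(2) by (auto simp: cond_prob_def)
  next
    case False
    then have "\<P>(\<omega> in M. Q \<omega>) = 0" by (simp add: zero_less_measure_iff)
    moreover have "\<P>(\<omega> in M. P \<omega> \<and> Q \<omega>) \<le> \<P>(\<omega> in M. Q \<omega>)"
      using assms(3,4) by (intro finite_measure_mono) auto
    ultimately show ?thesis by (simp add: measure_le_0_iff)
  qed
qed

lemma conservative_steps_chain:
  fixes Y :: "nat \<Rightarrow> 'w \<Rightarrow> real ^ 'd"
  assumes "conservative_steps M p Y"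
  shows "mix_chain M directions (\<lambda>k. 1 - p k) Y"
proof -
  from assms have M: "prob_space M" and Y: "\<And>n. n \<ge> 1 \<Longrightarrow> Y n \<in> M \<rightarrow>\<^sub>M count_space directions"
    and Y1: "\<And>v. v \<in> directions \<Longrightarrow> \<P>(\<omega> in M. Y 1 \<omega> = v) = pmf (pmf_of_set directions) v"
    and transition: "\<And>n y v. n \<ge> 1 \<Longrightarrow> v \<in> directions \<Longrightarrow> \<P>(\<omega> in M. \<forall>k\<in>{1..n}. Y k \<omega> = y k) > 0 \<Longrightarrow>
        \<P>(\<omega> in M. Y (Suc n) \<omega> = v \<bar> \<forall>k\<in>{1..n}. Y k \<omega> = y k) = step_matrix p n (y n) v"
    unfolding conservative_steps_def by blast+
  interpret prob_space M by fact
  have ev: "{\<omega> \<in> space M. \<forall>k\<in>{1..n}. Y k \<omega> = w k} \<in> events" for w n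
    by (rule sets_finite_coordinates) (use Y in auto)
  have "\<P>(\<omega> in M. \<forall>k\<in>{1..n}. Y k \<omega> = w k) =
      1 / real (card (directions :: (real^'d) set)) * (\<Prod>k\<in>{1..<n}. mix directions (1 - p k) (w k) (w (Suc k)))"
    if "n \<ge> 1" "w \<in> {1..n} \<rightarrow> directions" for n w
    using that
  proof (induction n rule: dec_induct)
    case base
    then show ?case using Y1 pmf_of_directions by simp
  next
    case (step n)
    have ins: "{1..Suc n} = insert (Suc n) {1..n}" by auto
    have "\<P>(\<omega> in M. \<forall>k\<in>{1..Suc n}. Y k \<omega> = w k) =
        \<P>(\<omega> in M. Y (Suc n) \<omega> = w (Suc n) \<and> (\<forall>k\<in>{1..n}. Y k \<omega> = w k))"
      unfolding ins by simp
    also have "\<dots> = \<P>(\<omega> in M. \<forall>k\<in>{1..n}. Y k \<omega> = w k) * step_matrix p n (w n) (w (Suc n))"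
    proof (rule prob_eq_cond_prob)
      show "prob_space M" by fact
      show "{\<omega> \<in> space M. \<forall>k\<in>{1..n}. Y k \<omega> = w k} \<in> events" by (rule ev)
      show "{\<omega> \<in> space M. Y (Suc n) \<omega> = w (Suc n) \<and> (\<forall>k\<in>{1..n}. Y k \<omega> = w k)} \<in> events"
        using ev[of "Suc n" w] unfolding ins by simp
      show "\<P>(\<omega> in M. Y (Suc n) \<omega> = w (Suc n) \<bar> \<forall>k\<in>{1..n}. Y k \<omega> = w k) = step_matrix p n (w n) (w (Suc n))"
        if "\<P>(\<omega> in M. \<forall>k\<in>{1..n}. Y k \<omega> = w k) > 0"
        using that step.hyps step.prems by (intro transition) auto
    qed
    also have "\<P>(\<omega> in M. \<forall>k\<in>{1..n}. Y k \<omega> = w k) =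
       1 / real (card (directions :: (real^'d) set)) * (\<Prod>k\<in>{1..<n}. mix directions (1 - p k) (w k) (w (Suc k)))"
      using step.prems by (intro step.IH) auto
    finally show ?case
      using step.hyps by (simp add: step_matrix_eq_mix prod.op_ivl_Suc)
  qed
  then show ?thesis
    unfolding mix_chain_def using M Y finite_directions directions_nonempty by blast
qed

lemma chain_repeat:
  assumes chain: "mix_chain M S c X" and n: "n \<ge> 1"
  shows "{\<omega> \<in> space M. X (Suc n) \<omega> \<noteq> X n \<omega>} \<in> sets M"
    and "\<P>(\<omega> in M. X (Suc n) \<omega> \<noteq> X n \<omega>) = (1 - c n) * (1 - 1 / real (card S))"
proof -
  interpret prob_space M using chain by (simp add: mix_chain_def)
  note S = chain_S[OF chain]
  have eqS: "{\<omega> \<in> space M. X (Suc n) \<omega> = X n \<omega>} = (\<Union>x\<in>S. {\<omega> \<in> space M. X n \<omega> = x \<and> X (Suc n) \<omega> = x})"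
    using measurable_space[OF chain_measurable[OF chain n]] by auto
  have ev: "{\<omega> \<in> space M. X n \<omega> = x \<and> X (Suc n) \<omega> = x} \<in> events" for x
    using chain_event[OF chain n, of x] chain_event[OF chain, of "Suc n" x] by (intro sets.sets_Collect_conj) auto
  then have evU: "{\<omega> \<in> space M. X (Suc n) \<omega> = X n \<omega>} \<in> events"
    unfolding eqS using S by (intro sets.finite_UN) auto
  then show ev': "{\<omega> \<in> space M. X (Suc n) \<omega> \<noteq> X n \<omega>} \<in> events"
    by (rule sets.sets_Collect_neg)
  have "\<P>(\<omega> in M. X (Suc n) \<omega> = X n \<omega>) = (\<Sum>x\<in>S. \<P>(\<omega> in M. X n \<omega> = x \<and> X (Suc n) \<omega> = x))"
    unfolding eqS using S ev by (intro finite_measure_finite_Union) (auto simp: disjoint_family_on_def)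
  also have "\<dots> = (\<Sum>x\<in>S. 1 / real (card S) * (c n + (1 - c n) / real (card S)))"
  proof (rule sum.cong)
    fix x assume x: "x \<in> S"
    show "\<P>(\<omega> in M. X n \<omega> = x \<and> X (Suc n) \<omega> = x) = 1 / real (card S) * (c n + (1 - c n) / real (card S))"
      using chain_step[OF chain n x, of "\<lambda>_. True" x] chain_marginal[OF chain n x] by (simp add: mix_def)
  qed simp
  also have "\<dots> = c n + (1 - c n) / real (card S)"
    using S by simp
  finally have "\<P>(\<omega> in M. X (Suc n) \<omega> = X n \<omega>) = c n + (1 - c n) / real (card S)" .
  moreover have "\<P>(\<omega> in M. X (Suc n) \<omega> \<noteq> X n \<omega>) = 1 - \<P>(\<omega> in M. X (Suc n) \<omega> = X n \<omega>)"
    using prob_neg[OF evU] by simp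
  ultimately show "\<P>(\<omega> in M. X (Suc n) \<omega> \<noteq> X n \<omega>) = (1 - c n) * (1 - 1 / real (card S))"
    by (simp add: algebra_simps diff_divide_distrib)
qed

section \<open>Linear interpolation of partial sums\<close>

lemma interpolate_partial_sums_bound:
  fixes y :: "nat \<Rightarrow> 'a::real_normed_vector"
  assumes ut: "0 \<le> u" "u \<le> t" and r: "\<And>k. k \<in> {Suc (nat \<lfloor>u\<rfloor>)..Suc (nat \<lfloor>t\<rfloor>)} \<Longrightarrow> norm (y k) \<le> r"
  shows "norm (interpolate (\<lambda>m. \<Sum>k=1..m. y k) t - interpolate (\<lambda>m. \<Sum>k=1..m. y k) u) \<le> r * (t - u)"
proof -
  let ?s = "\<lambda>m. \<Sum>k=1..m. y k"
  let ?n = "nat \<lfloor>t\<rfloor>" and ?m = "nat \<lfloor>u\<rfloor>"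
  have eq: "interpolate ?s x = ?s (nat \<lfloor>x\<rfloor>) + frac x *\<^sub>R y (Suc (nat \<lfloor>x\<rfloor>))" for x
    unfolding interpolate_def by (simp add: algebra_simps)
  have fl: "real ?n = t - frac t" "real ?m = u - frac u"
    using ut by (auto simp: frac_def)
  have split: "?s n = ?s (Suc m) + (\<Sum>k=Suc (Suc m)..n. y k)" if "m < n" for m n
    using sum.ub_add_nat[of 1 "Suc m" y "n - Suc m"] that by (simp del: sum.cl_ivl_Suc)
  have mn: "?m \<le> ?n" using ut by (intro nat_mono floor_mono)
  have f: "0 \<le> frac t" "0 \<le> frac u" "frac u < 1"
    by (simp_all add: frac_lt_1)
  show ?thesis
  proof (cases "?m = ?n")
    case True
    then have "t - u = frac t - frac u" using fl by linarith
    moreover have "interpolate ?s t - interpolate ?s u = (frac t - frac u) *\<^sub>R y (Suc ?n)"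
      unfolding eq True by (simp add: scaleR_diff_left)
    ultimately show ?thesis
      using r[of "Suc ?n"] ut mn by (simp add: mult.commute[of r] mult_left_mono)
  next
    case False
    with mn have "?m < ?n" by (metis le_neq_implies_less)
    then have "?s ?n = ?s (Suc ?m) + (\<Sum>k=Suc (Suc ?m)..?n. y k)"
      by (rule split)
    \<comment> \<open>The path completes the step in progress at \<open>u\<close>, performs the full
      steps in between, and then a fraction \<open>frac t\<close> of the last one.\<close>
    then have "interpolate ?s t - interpolate ?s u =
       (\<Sum>k=Suc (Suc ?m)..?n. y k) + frac t *\<^sub>R y (Suc ?n) + (1 - frac u) *\<^sub>R y (Suc ?m)"
      unfolding eq by (simp add: algebra_simps)
    also have "norm \<dots> \<le> norm (\<Sum>k=Suc (Suc ?m)..?n. y k) + norm (frac t *\<^sub>R y (Suc ?n)) + norm ((1 - frac u) *\<^sub>R y (Suc ?m))"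
      by (intro norm_triangle_le add_mono) auto
    also have "\<dots> \<le> real (?n - Suc ?m) * r + frac t * r + (1 - frac u) * r"
    proof (intro add_mono)
      have "norm (\<Sum>k=Suc (Suc ?m)..?n. y k) \<le> (\<Sum>k=Suc (Suc ?m)..?n. r)"
        by (rule sum_norm_le) (use r in auto)
      then show "norm (\<Sum>k=Suc (Suc ?m)..?n. y k) \<le> real (?n - Suc ?m) * r" by simp
      show "norm (frac t *\<^sub>R y (Suc ?n)) \<le> frac t * r"
        using f r[of "Suc ?n"] mn by (simp add: mult_left_mono)
      show "norm ((1 - frac u) *\<^sub>R y (Suc ?m)) \<le> (1 - frac u) * r"
        using f r[of "Suc ?m"] mn by (simp add: mult_left_mono)
    qed
    also have "\<dots> = r * (real (?n - Suc ?m) + frac t + 1 - frac u)"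
      by (simp only: algebra_simps)
    also have "real (?n - Suc ?m) = real ?n - real ?m - 1"
      using of_nat_diff[OF Suc_leI[OF \<open>?m < ?n\<close>], where 'a=real] by (simp only: of_nat_Suc)
    also have "r * (real ?n - real ?m - 1 + frac t + 1 - frac u) = r * (t - u)"
      unfolding fl by (simp only: algebra_simps)
    finally show ?thesis .
  qed
qed

text \<open>Subtracting the drift \<open>v\<close> makes all steps met between \<open>u\<close> and
  \<open>t\<close> vanish, so the preceding bound with \<open>r = 0\<close> shows that the remainder
  is constant there. The same bound with \<open>r = 1\<close> gives the Lipschitz property of the
  walk.\<close>

lemma interpolate_partial_sums_linear:
  fixes y :: "nat \<Rightarrow> 'a::real_normed_vector"
  assumes ut: "0 \<le> u" "u \<le> t" and v: "\<And>k. k \<in> {Suc (nat \<lfloor>u\<rfloor>)..Suc (nat \<lfloor>t\<rfloor>)} \<Longrightarrow> y k = v"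
  shows "interpolate (\<lambda>m. \<Sum>k=1..m. y k) t = interpolate (\<lambda>m. \<Sum>k=1..m. y k) u + (t - u) *\<^sub>R v"
proof -
  have shift: "interpolate (\<lambda>m. \<Sum>k=1..m. y k - v) x = interpolate (\<lambda>m. \<Sum>k=1..m. y k) x - x *\<^sub>R v"
    if "x \<ge> 0" for x
  proof -
    have "real (nat \<lfloor>x\<rfloor>) + frac x = x" using that by (simp add: frac_def)
    then have "x *\<^sub>R v = real (nat \<lfloor>x\<rfloor>) *\<^sub>R v + frac x *\<^sub>R v"
      by (metis scaleR_left_distrib)
    then show ?thesis
      unfolding interpolate_def by (simp add: sum_subtractf sum_constant_scaleR algebra_simps)
  qed
  have "norm (interpolate (\<lambda>m. \<Sum>k=1..m. y k - v) t - interpolate (\<lambda>m. \<Sum>k=1..m. y k - v) u) \<le> 0 * (t - u)"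
    using ut by (intro interpolate_partial_sums_bound) (auto simp: v)
  then show ?thesis
    using shift[of t] shift[of u] ut unfolding scaleR_diff_left by (simp add: diff_eq_eq)
qed

lemma rescaled_walk_in_lip_paths:
  assumes "\<And>k. k \<ge> 1 \<Longrightarrow> norm (Y k \<omega>) \<le> 1"
  shows "rescaled_walk Y n \<omega> \<in> lip_paths"
proof -
  let ?g = "interpolate (\<lambda>m. walk Y m \<omega>)"
  have le: "dist (?g (real n * s) /\<^sub>R real n) (?g (real n * t) /\<^sub>R real n) \<le> t - s"
    if "0 \<le> s" "s \<le> t" for s t
  \<comment> \<open>The definition of weak convergence constrains every member of the sequence,
    including \<open>n = 0\<close>, where division by 0 gives the zero path.\<close>
  proof (cases "n = 0")
    case False
    have "norm (?g (real n * t) - ?g (real n * s)) \<le> 1 * (real n * t - real n * s)"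
      unfolding walk_def using that assms
      by (intro interpolate_partial_sums_bound) (auto intro: mult_left_mono)
    then have "norm (?g (real n * s) - ?g (real n * t)) \<le> real n * (t - s)"
      by (simp add: norm_minus_commute algebra_simps)
    moreover have "dist (?g (real n * s) /\<^sub>R real n) (?g (real n * t) /\<^sub>R real n)
        = norm (?g (real n * s) - ?g (real n * t)) / real n"
      unfolding dist_norm scaleR_diff_right[symmetric] norm_scaleR by (simp add: divide_inverse)
    ultimately show ?thesis
      using False by (simp add: divide_le_eq mult.commute)
  qed (use that in auto)
  have "dist (?g (real n * s) /\<^sub>R real n) (?g (real n * t) /\<^sub>R real n) \<le> \<bar>s - t\<bar>"
    if "0 \<le> s" "0 \<le> t" for s t
    using le[of s t] le[of t s] that by (cases "s \<le> t") (auto simp: dist_commute)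
  moreover have "?g 0 = 0"
    by (simp add: interpolate_def walk_def)
  ultimately show ?thesis
    unfolding lip_paths_def rescaled_walk_def by auto
qed

text \<open>The walk stopped after \<open>k\<close> steps is a function of finitely many discrete
  variables, and on a bounded time interval the stopping is invisible once \<open>k\<close> is
  large.\<close>

lemma rescaled_walk_measurable:
  fixes Y :: "nat \<Rightarrow> 'w \<Rightarrow> real ^ 'd"
  assumes Y: "\<And>k. k \<ge> 1 \<Longrightarrow> Y k \<in> M \<rightarrow>\<^sub>M count_space directions"
  shows "rescaled_walk Y n \<in> M \<rightarrow>\<^sub>M borel_of cpath_topology"
proof -
  \<comment> \<open>The path is rebuilt from a deterministic word, over the one-point sample space,
    and stands still after step \<open>k\<close>.\<close>
  define \<Phi> :: "nat \<Rightarrow> (nat \<Rightarrow> real ^ 'd) \<Rightarrow> real \<Rightarrow> real ^ 'd" where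
    "\<Phi> k w = rescaled_walk (\<lambda>j _. if j \<in> {1..k} then w j else 0) n ()" for k w
  define Xk where "Xk k \<omega> = \<Phi> k (\<lambda>j\<in>{1..k}. Y j \<omega>)" for k \<omega>
  have norm_Y: "norm (Y k \<omega>) \<le> 1" if "k \<ge> 1" "\<omega> \<in> space M" for k \<omega>
    using norm_directions[OF measurable_space[OF Y[OF that(1)] that(2), simplified]] by simp
  show ?thesis
  proof (rule measurable_cpath_limit)
    show "rescaled_walk Y n \<omega> \<in> cpaths" if "\<omega> \<in> space M" for \<omega>
      using rescaled_walk_in_lip_paths[of Y \<omega> n] norm_Y that lip_paths_subset_cpaths by blast
    show "Xk k \<in> M \<rightarrow>\<^sub>M count_space UNIV" for k
    proof -
      have "(\<lambda>\<omega>. \<lambda>j\<in>{1..k}. Y j \<omega>) \<in> M \<rightarrow>\<^sub>M count_space (PiE {1..k} (\<lambda>_. directions))"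
        by (rule measurable_finite_coordinates) (use Y finite_directions in auto)
      from measurable_compose[OF this, of "\<Phi> k" "count_space UNIV"]
      show ?thesis unfolding Xk_def by simp
    qed
    show "Xk k \<omega> \<in> cpaths" if "\<omega> \<in> space M" for k \<omega>
    proof -
      have "Xk k \<omega> \<in> lip_paths"
        unfolding Xk_def \<Phi>_def using norm_Y that by (intro rescaled_walk_in_lip_paths) auto
      then show ?thesis using lip_paths_subset_cpaths by blast
    qed
    show "\<forall>\<^sub>F k in sequentially. \<forall>t\<in>{0..T}. dist (Xk k \<omega> t) (rescaled_walk Y n \<omega> t) < e"
      if "\<omega> \<in> space M" "e > 0" for \<omega> T and e :: real
      using eventually_ge_at_top[of "Suc (nat \<lfloor>real n * T\<rfloor>)"]
    proof eventually_elim
      case (elim k)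
      have "Xk k \<omega> t = rescaled_walk Y n \<omega> t" if t: "t \<in> {0..T}" for t
      proof -
        have "nat \<lfloor>real n * t\<rfloor> \<le> nat \<lfloor>real n * T\<rfloor>"
          using t by (intro nat_mono floor_mono mult_left_mono) auto
        then have "Suc (nat \<lfloor>real n * t\<rfloor>) \<le> k" using elim by simp
        then have "(\<Sum>j=1..m. if j \<in> {1..k} then (\<lambda>j\<in>{1..k}. Y j \<omega>) j else 0) = (\<Sum>j=1..m. Y j \<omega>)"
          if "m \<le> Suc (nat \<lfloor>real n * t\<rfloor>)" for m
          using that by (intro sum.cong) auto
        then show ?thesis
          unfolding Xk_def \<Phi>_def rescaled_walk_def interpolate_def walk_def
          using t by (simp del: sum.cl_ivl_Suc)
      qed
      then show ?case using that by auto
    qed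
  qed
qed

section \<open>Asymptotics of the products of 1 - a / k\<close>

lemma prod_upper_bound:
  fixes a :: real
  assumes "a > 0" "m \<ge> 1" "m \<le> m'" "\<And>k. k \<ge> m \<Longrightarrow> 0 \<le> 1 - a / real k"
  shows "(\<Prod>k\<in>{m..<m'}. 1 - a / real k) \<le> (real m / real m') powr a"
  using assms(3)
proof (induction m' rule: dec_induct)
  case base
  then show ?case using assms(2) by simp
next
  case (step k)
  have k: "real k > 0" using step assms(2) by auto
  \<comment> \<open>The target \<open>(k / (k + 1)) powr a\<close> has telescoping products.
    \<open>exp (- a / k)\<close> lies in between because
    \<open>ln (1 + 1 / k) \<le> 1 / k\<close>.\<close>
  have "1 - a / real k \<le> exp (- a / real k)"
    using exp_ge_add_one_self[of "- a / real k"] by simp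
  also have "\<dots> \<le> exp (a * ln (real k / real (Suc k)))"
  proof -
    have "ln (1 + 1 / real k) \<le> 1 / real k"
      using k by (intro ln_add_one_self_le_self) auto
    moreover have "ln (real k / real (Suc k)) = - ln (1 + 1 / real k)"
    proof -
      have "1 + 1 / real k = real (Suc k) / real k" using k by (simp add: field_simps)
      then show ?thesis using k by (simp add: ln_div)
    qed
    ultimately have "- (1 / real k) \<le> ln (real k / real (Suc k))" by simp
    then have "a * (- (1 / real k)) \<le> a * ln (real k / real (Suc k))"
      using assms(1) by (intro mult_left_mono) auto
    then show ?thesis by simp
  qed
  also have "\<dots> = (real k / real (Suc k)) powr a"
    using k by (simp add: powr_def)
  finally have 1: "1 - a / real k \<le> (real k / real (Suc k)) powr a" .
  have "(\<Prod>k\<in>{m..<Suc k}. 1 - a / real k) = (\<Prod>k\<in>{m..<k}. 1 - a / real k) * (1 - a / real k)"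
    using step.hyps by (simp add: prod.op_ivl_Suc)
  also have "\<dots> \<le> (real m / real k) powr a * (real k / real (Suc k)) powr a"
    using step 1 assms(4) by (intro mult_mono) (auto intro!: prod_nonneg)
  also have "\<dots> = (real m / real (Suc k)) powr a"
    using k by (subst powr_mult[symmetric]) auto
  finally show ?case .
qed

text \<open>With \<open>z = k - a\<close> the factor equals \<open>1 / (1 + a / z)\<close>, which is
  at least \<open>exp (- a / z)\<close> and so at least \<open>((z - 1) / z) powr a\<close>. These
  bounds telescope too; the shift by \<open>a + 1\<close> disappears in the limit.\<close>

lemma prod_lower_bound:
  fixes a :: real
  assumes "a > 0" "real m > a + 1" "m \<le> m'"
  shows "((real m - a - 1) / (real m' - a - 1)) powr a \<le> (\<Prod>k\<in>{m..<m'}. 1 - a / real k)"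
  using assms(3)
proof (induction m' rule: dec_induct)
  case base
  then show ?case using assms(2) by simp
next
  case (step k)
  define z where "z = real k - a"
  have z: "z > 1" using step assms(2) by (simp add: z_def)
  have k: "real k = z + a" "real k > 0" using z assms(1) by (auto simp: z_def)
  have "((z - 1) / z) powr a = exp (a * ln (1 + (- 1 / z)))"
    using z by (simp add: powr_def diff_divide_distrib)
  also have "\<dots> \<le> exp (a * (- 1 / z))"
    using z assms(1) by (subst exp_le_cancel_iff, intro mult_left_mono ln_add_one_self_le_self2) (auto simp: field_simps)
  also have "\<dots> = inverse (exp (a / z))"
    by (simp add: exp_minus)
  also have "\<dots> \<le> inverse (1 + a / z)"
    using z assms(1) exp_ge_add_one_self[of "a / z"] by (intro le_imp_inverse_le) (auto simp: add_pos_pos)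
  also have "\<dots> = 1 - a / real k"
    unfolding k(1) using z assms(1) by (simp add: field_simps)
  finally have 1: "((z - 1) / z) powr a \<le> 1 - a / real k" .
  have ka: "0 \<le> 1 - a / real k'" if "k' \<ge> m" for k'
    using that assms(1,2) by (simp add: field_simps)
  have "((real m - a - 1) / (real (Suc k) - a - 1)) powr a =
      ((real m - a - 1) / (real k - a - 1)) powr a * ((z - 1) / z) powr a"
    using z assms(2) by (subst powr_mult[symmetric]) (auto simp: z_def)
  also have "\<dots> \<le> (\<Prod>k\<in>{m..<k}. 1 - a / real k) * (1 - a / real k)"
    using step 1 ka by (intro mult_mono) (auto intro!: prod_nonneg)
  also have "\<dots> = (\<Prod>k\<in>{m..<Suc k}. 1 - a / real k)"
    using step.hyps by (simp add: prod.op_ivl_Suc)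
  finally show ?case .
qed

text \<open>The shift \<open>e\<close> will be 0 for the upper bound and \<open>- a - 1\<close> for
  the lower one; division by \<open>n\<close> removes it, so both bounds have the same
  limit.\<close>

lemma tendsto_floor_over_n:
  assumes "x > 0"
  shows "(\<lambda>n. (real (Suc (nat \<lfloor>real n * x\<rfloor>)) + e) / real n) \<longlonglongrightarrow> x"
proof (rule tendsto_sandwich)
  have fl: "real (nat \<lfloor>real n * x\<rfloor>) \<le> real n * x" "real n * x - 1 \<le> real (nat \<lfloor>real n * x\<rfloor>)" for n
    using assms by (auto intro: of_nat_floor)
  show "\<forall>\<^sub>F n in sequentially. x + e * (1 / real n) \<le> (real (Suc (nat \<lfloor>real n * x\<rfloor>)) + e) / real n"
    using eventually_gt_at_top[of 0]
  proof eventually_elim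
    case (elim n)
    have "x + e * (1 / real n) = (real n * x + e) / real n" using elim by (simp add: field_simps)
    also have "\<dots> \<le> (real (Suc (nat \<lfloor>real n * x\<rfloor>)) + e) / real n"
      using fl(2)[of n] by (intro divide_right_mono) auto
    finally show ?case .
  qed
  show "\<forall>\<^sub>F n in sequentially. (real (Suc (nat \<lfloor>real n * x\<rfloor>)) + e) / real n \<le> x + (e + 1) * (1 / real n)"
    using eventually_gt_at_top[of 0]
  proof eventually_elim
    case (elim n)
    have "(real (Suc (nat \<lfloor>real n * x\<rfloor>)) + e) / real n \<le> (real n * x + (e + 1)) / real n"
      using fl(1)[of n] by (intro divide_right_mono) auto
    also have "\<dots> = x + (e + 1) * (1 / real n)" using elim by (simp add: field_simps)
    finally show ?case .
  qed
  show "(\<lambda>n. x + e * (1 / real n)) \<longlonglongrightarrow> x" "(\<lambda>n. x + (e + 1) * (1 / real n)) \<longlonglongrightarrow> x"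
    by (rule tendsto_eq_intros lim_1_over_n refl | simp)+
qed

lemma floor_index_at_top:
  assumes "x > 0"
  shows "eventually (\<lambda>n. N \<le> nat \<lfloor>real n * x\<rfloor>) sequentially"
  using eventually_ge_at_top[of "nat \<lceil>real N / x\<rceil>"]
proof eventually_elim
  case (elim n)
  then have "real N / x \<le> real n" by linarith
  then have "real N \<le> real n * x" using assms by (simp add: field_simps)
  then show ?case by (simp add: le_nat_floor)
qed

lemma prod_tendsto_powr:
  fixes a :: real
  assumes a: "a > 0" and p: "\<And>n. n \<ge> n0 \<Longrightarrow> p n = a / real n" and xy: "0 < x" "x \<le> y"
  shows "(\<lambda>n. \<Prod>k\<in>{Suc (nat \<lfloor>real n * x\<rfloor>)..<Suc (nat \<lfloor>real n * y\<rfloor>)}. 1 - p k) \<longlonglongrightarrow> (x / y) powr a"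
proof (rule tendsto_sandwich)
  let ?m = "\<lambda>x n. Suc (nat \<lfloor>real n * x\<rfloor>)"
  have lim: "(\<lambda>n. ((real (?m x n) + e) / (real (?m y n) + e)) powr a) \<longlonglongrightarrow> (x / y) powr a" for e
  proof (rule tendsto_powr)
    have "(\<lambda>n. ((real (?m x n) + e) / real n) / ((real (?m y n) + e) / real n)) \<longlonglongrightarrow> x / y"
      using xy by (intro tendsto_divide tendsto_floor_over_n) auto
    moreover have "\<forall>\<^sub>F n in sequentially. ((real (?m x n) + e) / real n) / ((real (?m y n) + e) / real n) =
        (real (?m x n) + e) / (real (?m y n) + e)"
      using eventually_gt_at_top[of 0] by eventually_elim simp
    ultimately show "(\<lambda>n. (real (?m x n) + e) / (real (?m y n) + e)) \<longlonglongrightarrow> x / y"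
      by (rule Lim_transform_eventually)
    show "(\<lambda>n. a) \<longlonglongrightarrow> a" by simp
    show "x / y \<noteq> 0" using xy by simp
  qed
  \<comment> \<open>Beyond this index both \<open>p k = a / k\<close> and the hypothesis
    \<open>real m > a + 1\<close> of the lower bound hold.\<close>
  have ev: "\<forall>\<^sub>F n in sequentially. max n0 (nat \<lceil>a + 1\<rceil>) \<le> nat \<lfloor>real n * x\<rfloor>"
    by (rule floor_index_at_top[OF xy(1)])
  have le: "?m x n \<le> ?m y n" for n
    using xy by (intro Suc_leI le_imp_less_Suc nat_mono floor_mono mult_left_mono) auto
  have prod: "(\<Prod>k\<in>{?m x n..<?m y n}. 1 - p k) = (\<Prod>k\<in>{?m x n..<?m y n}. 1 - a / real k)"
    if "max n0 (nat \<lceil>a + 1\<rceil>) \<le> nat \<lfloor>real n * x\<rfloor>" for n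
    using that p by (intro prod.cong) auto
  have big: "real (?m x n) > a + 1" if "max n0 (nat \<lceil>a + 1\<rceil>) \<le> nat \<lfloor>real n * x\<rfloor>" for n
    using that by linarith
  show "\<forall>\<^sub>F n in sequentially. (\<Prod>k\<in>{?m x n..<?m y n}. 1 - p k) \<le> ((real (?m x n) + 0) / (real (?m y n) + 0)) powr a"
    using ev
  proof eventually_elim
    case (elim n)
    have "0 \<le> 1 - a / real k" if "k \<ge> ?m x n" for k
    proof -
      have "real k \<ge> real (?m x n)" using that by (simp only: of_nat_le_iff)
      then have "a \<le> real k" "real k > 0" using big[OF elim] a by linarith+
      then show ?thesis by simp
    qed
    then show ?case
      unfolding prod[OF elim] using prod_upper_bound[OF a _ le[of n]] by simp
  qed
  show "\<forall>\<^sub>F n in sequentially. ((real (?m x n) + (- a - 1)) / (real (?m y n) + (- a - 1))) powr a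
      \<le> (\<Prod>k\<in>{?m x n..<?m y n}. 1 - p k)"
    using ev
  proof eventually_elim
    case (elim n)
    show ?case
      unfolding prod[OF elim] using prod_lower_bound[OF a big[OF elim] le[of n]] by (simp add: algebra_simps)
  qed
  show "(\<lambda>n. ((real (?m x n) + 0) / (real (?m y n) + 0)) powr a) \<longlonglongrightarrow> (x / y) powr a"
    by (rule lim)
  show "(\<lambda>n. ((real (?m x n) + (- a - 1)) / (real (?m y n) + (- a - 1))) powr a) \<longlonglongrightarrow> (x / y) powr a"
    by (rule lim)
qed

text \<open>The step in progress at time \<open>j * h\<close> of the rescaled walk: between
  \<open>m\<close> and \<open>m + 1\<close> the interpolation follows step \<open>m + 1\<close>,
  whence \<open>Suc\<close>.\<close>

definition grid_step :: "real \<Rightarrow> nat \<Rightarrow> nat \<Rightarrow> nat" where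
  "grid_step h n j = Suc (nat \<lfloor>real n * (real j * h)\<rfloor>)"

lemma grid_step_mono: "h > 0 \<Longrightarrow> i \<le> j \<Longrightarrow> grid_step h n i \<le> grid_step h n j"
  unfolding grid_step_def by (intro Suc_leI le_imp_less_Suc nat_mono floor_mono mult_left_mono mult_right_mono) auto

text \<open>Only the ratio \<open>j / (j + 1)\<close> of consecutive grid times survives in the
  limiting parameters, so the limit is the same for every mesh \<open>h\<close>.\<close>

lemma walk_fdd_tendsto:
  fixes Y :: "nat \<Rightarrow> 'w \<Rightarrow> real ^ 'd"
  assumes Y: "mix_chain M directions (\<lambda>k. 1 - p k) Y"
    and a: "a > 0" and p: "\<And>n. n \<ge> n0 \<Longrightarrow> p n = a / real n"
    and h: "h > 0" and J: "J \<ge> 1" and w: "w \<in> {1..J} \<rightarrow> directions"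
  shows "(\<lambda>n. \<P>(\<omega> in M. \<forall>j\<in>{1..J}. Y (grid_step h n j) \<omega> = w j)) \<longlonglongrightarrow>
     1 / real (card (directions :: (real ^ 'd) set)) *
       (\<Prod>j\<in>{1..<J}. mix directions ((real j / real (Suc j)) powr a) (w j) (w (Suc j)))"
proof -
  let ?u = "1 / real (card (directions :: (real ^ 'd) set))"
  have "(\<lambda>n. \<Prod>k\<in>{grid_step h n j..<grid_step h n (Suc j)}. 1 - p k) \<longlonglongrightarrow> (real j / real (Suc j)) powr a"
    if "j \<in> {1..<J}" for j
  proof -
    have "(real j * h) / (real (Suc j) * h) = real j / real (Suc j)" using h by simp
    then show ?thesis
      unfolding grid_step_def
      using prod_tendsto_powr[OF a p, of n0 "real j * h" "real (Suc j) * h"] h that by auto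
  qed
  then have "(\<lambda>n. ?u *
       (\<Prod>j\<in>{1..<J}. mix directions (\<Prod>k\<in>{grid_step h n j..<grid_step h n (Suc j)}. 1 - p k) (w j) (w (Suc j)))) \<longlonglongrightarrow>
     ?u *
       (\<Prod>j\<in>{1..<J}. mix directions ((real j / real (Suc j)) powr a) (w j) (w (Suc j)))"
    by (intro tendsto_mult tendsto_const tendsto_prod tendsto_mix)
  moreover have "\<P>(\<omega> in M. \<forall>j\<in>{1..J}. Y (grid_step h n j) \<omega> = w j) =
     ?u *
       (\<Prod>j\<in>{1..<J}. mix directions (\<Prod>k\<in>{grid_step h n j..<grid_step h n (Suc j)}. 1 - p k) (w j) (w (Suc j)))" for n
    by (rule chain_fdd[OF Y J]) (use w grid_step_mono[OF h] in \<open>auto simp: mono_on_def grid_step_def\<close>)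
  ultimately show ?thesis by simp
qed

text \<open>A cell meets at most \<open>n * h + 1 \<le> 2 * (n * h)\<close> passages from one step
  to the next, and each is a turn with probability at most \<open>a / (n * (j * h))\<close>. The
  union bound gives \<open>2 * a / j\<close>.\<close>

lemma walk_grid_approximable:
  fixes Y :: "nat \<Rightarrow> 'w \<Rightarrow> real ^ 'd"
  assumes Y: "mix_chain M directions (\<lambda>k. 1 - p k) Y"
    and a: "a > 0" and p: "\<And>n. n \<ge> n0 \<Longrightarrow> p n = a / real n" and h: "h > 0"
  shows "\<forall>\<^sub>F n in sequentially.
    grid_approximable M directions (2 * a) h J (rescaled_walk Y n) (\<lambda>j. Y (grid_step h n j))"
proof -
  interpret prob_space M using Y by (simp add: mix_chain_def)
  \<comment> \<open>This puts all steps from cell 1 on beyond \<open>n0\<close> and gives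
    \<open>n * h \<ge> 1\<close>, which absorbs the rounding term \<open>+ 1\<close> into the factor
    2.\<close>
  have "\<forall>\<^sub>F n in sequentially. max n0 1 \<le> nat \<lfloor>real n * h\<rfloor>"
    by (rule floor_index_at_top[OF h])
  then show ?thesis
  proof eventually_elim
    case (elim n)
    have nh: "real n * h \<ge> 1" "n > 0"
    proof -
      have "1 \<le> nat \<lfloor>real n * h\<rfloor>" using elim by simp
      then show "real n * h \<ge> 1" by linarith
      then show "n > 0" by (cases n) auto
    qed
    let ?m = "grid_step h n"
    define Bad where "Bad j = (\<Union>k\<in>{?m j..<?m (Suc j)}. {\<omega> \<in> space M. Y (Suc k) \<omega> \<noteq> Y k \<omega>})" for j
    have m1: "?m j \<ge> 1" for j by (simp add: grid_step_def)
    have mreal: "real (?m j) > real n * (real j * h)" "real (?m j) \<le> real n * (real j * h) + 1" for j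
    proof -
      have "0 \<le> real n * (real j * h)" using h by simp
      then show "real (?m j) > real n * (real j * h)" "real (?m j) \<le> real n * (real j * h) + 1"
        unfolding grid_step_def by linarith+
    qed
    have Bad: "Bad j \<in> events \<and> prob (Bad j) \<le> 2 * a / real j" if j: "j \<in> {1..J}" for j
    proof
      have ev: "{\<omega> \<in> space M. Y (Suc k) \<omega> \<noteq> Y k \<omega>} \<in> events" if "k \<ge> ?m j" for k
        using chain_repeat(1)[OF Y] m1[of j] that by auto
      then show "Bad j \<in> events" unfolding Bad_def by (intro sets.finite_UN) auto
      have mj: "?m 1 \<le> ?m j" using j by (intro grid_step_mono h) auto
      have step: "\<P>(\<omega> in M. Y (Suc k) \<omega> \<noteq> Y k \<omega>) \<le> a / (real n * (real j * h))"
        if k: "k \<ge> ?m j" for k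
      proof -
        have "k \<ge> n0" using k mj elim by (auto simp: grid_step_def)
        then have pk: "p k = a / real k" using p by simp
        have "\<P>(\<omega> in M. Y (Suc k) \<omega> \<noteq> Y k \<omega>) = p k * (1 - 1 / real (card (directions :: (real ^ 'd) set)))"
          using chain_repeat(2)[OF Y, of k] k m1[of j] by simp
        also have "\<dots> \<le> p k * 1" unfolding pk using a by (intro mult_left_mono) auto
        also have "p k * 1 = a / real k" by (simp add: pk)
        also have "\<dots> \<le> a / (real n * (real j * h))"
        proof -
          have pos: "0 < real n * (real j * h)" using nh h j by simp
          have "real k \<ge> real (?m j)" using k by simp
          then have le: "real n * (real j * h) \<le> real k" using mreal(1)[of j] by linarith
          then show ?thesis
            using divide_left_mono[OF le _ mult_pos_pos[OF _ pos], of a] a pos by linarith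
        qed
        finally show ?thesis .
      qed
      have "prob (Bad j) \<le> (\<Sum>k\<in>{?m j..<?m (Suc j)}. \<P>(\<omega> in M. Y (Suc k) \<omega> \<noteq> Y k \<omega>))"
        unfolding Bad_def using ev by (intro finite_measure_subadditive_finite) auto
      also have "\<dots> \<le> (\<Sum>k\<in>{?m j..<?m (Suc j)}. a / (real n * (real j * h)))"
        using step by (intro sum_mono) auto
      also have "\<dots> = real (?m (Suc j) - ?m j) * (a / (real n * (real j * h)))" by simp
      also have "\<dots> \<le> (2 * (real n * h)) * (a / (real n * (real j * h)))"
      proof (intro mult_right_mono)
        have "real (?m (Suc j) - ?m j) = real (?m (Suc j)) - real (?m j)"
          using grid_step_mono[OF h, of j "Suc j" n] by (simp add: of_nat_diff)
        also have "\<dots> \<le> real n * (real (Suc j) * h) + 1 - real n * (real j * h)"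
          using mreal[of j] mreal[of "Suc j"] by linarith
        also have "\<dots> = real n * h + 1" by (simp add: algebra_simps)
        finally show "real (?m (Suc j) - ?m j) \<le> 2 * (real n * h)" using nh by linarith
        show "0 \<le> a / (real n * (real j * h))" using a h by simp
      qed
      also have "\<dots> = 2 * a / real j" using nh h j by (simp add: field_simps)
      finally show "prob (Bad j) \<le> 2 * a / real j" .
    qed
    have linear: "rescaled_walk Y n \<omega> t =
        rescaled_walk Y n \<omega> (real j * h) + (t - real j * h) *\<^sub>R Y (?m j) \<omega>"
      if \<omega>: "\<omega> \<in> space M" and j: "j \<in> {1..J}" "\<omega> \<notin> Bad j" and t: "t \<in> {real j * h..real (Suc j) * h}" for \<omega> j t
    proof -
      have const: "Y k \<omega> = Y (?m j) \<omega>" if "?m j \<le> k" "k \<le> ?m (Suc j)" for k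
        using that
      proof (induction k rule: dec_induct)
        case (step k)
        then have "\<omega> \<notin> {\<omega> \<in> space M. Y (Suc k) \<omega> \<noteq> Y k \<omega>}" using j(2) unfolding Bad_def by auto
        then show ?case using step \<omega> by auto
      qed simp
      have "nat \<lfloor>real n * t\<rfloor> \<le> nat \<lfloor>real n * (real (Suc j) * h)\<rfloor>"
        using t by (intro nat_mono floor_mono mult_left_mono) auto
      then have tm: "Suc (nat \<lfloor>real n * t\<rfloor>) \<le> ?m (Suc j)" by (simp only: grid_step_def Suc_le_mono)
      have jh: "0 \<le> real j * h" using h by simp
      have "interpolate (\<lambda>m. walk Y m \<omega>) (real n * t) = interpolate (\<lambda>m. walk Y m \<omega>) (real n * (real j * h))
          + (real n * t - real n * (real j * h)) *\<^sub>R Y (?m j) \<omega>"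
        unfolding walk_def
      proof (rule interpolate_partial_sums_linear)
        show "0 \<le> real n * (real j * h)" using jh by simp
        show "real n * (real j * h) \<le> real n * t" using t by (intro mult_left_mono) auto
        show "Y k \<omega> = Y (?m j) \<omega>" if "k \<in> {Suc (nat \<lfloor>real n * (real j * h)\<rfloor>)..Suc (nat \<lfloor>real n * t\<rfloor>)}" for k
          using that tm by (intro const) (auto simp: grid_step_def)
      qed
      then show ?thesis
        using t jh nh(2) unfolding rescaled_walk_def
        by (simp add: scaleR_add_right right_diff_distrib[symmetric])
    qed
    show ?case
      unfolding grid_approximable_def
    proof (intro conjI ballI exI[of _ Bad])
      show "Y (?m j) \<in> M \<rightarrow>\<^sub>M count_space directions" for j
        using chain_measurable[OF Y] m1 by blast
      show "AE \<omega> in M. \<forall>j\<in>{1..J}. \<omega> \<notin> Bad j \<longrightarrow> (\<forall>t\<in>{real j * h..real (Suc j) * h}.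
          rescaled_walk Y n \<omega> t = rescaled_walk Y n \<omega> (real j * h) + (t - real j * h) *\<^sub>R Y (?m j) \<omega>)"
        by (rule AE_I2) (blast intro: linear)
    qed (use Bad in blast)+
  qed
qed

section \<open>Turning times and zigzag paths\<close>

lemma regular_points_finite:
  assumes "regular_points A" "x > 0"
  shows "finite (A \<inter> {x..y})"
proof -
  have "compact {x..y}" "{x..y} \<subseteq> {0<..}" using assms(2) by auto
  then show ?thesis using assms(1) unfolding regular_points_def by blast
qed

lemma regular_points_next:
  assumes A: "regular_points A" and x: "x > 0"
  shows "\<exists>y\<in>A. x < y \<and> A \<inter> {x<..<y} = {}"
proof -
  obtain z where z: "z \<in> A" "x < z" using A unfolding regular_points_def by blast
  let ?F = "A \<inter> {x<..z}"
  have "finite ?F" by (rule finite_subset[OF _ regular_points_finite[OF A x, of z]]) auto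
  moreover have "?F \<noteq> {}" using z by auto
  ultimately have F: "Min ?F \<in> ?F" "\<And>u. u \<in> ?F \<Longrightarrow> Min ?F \<le> u"
    using Min_in Min_le by blast+
  have "u \<notin> A \<inter> {x<..<Min ?F}" for u
    using F(1) F(2)[of u] by auto
  then have "A \<inter> {x<..<Min ?F} = {}" by blast
  then show ?thesis using F(1) by (intro bexI[of _ "Min ?F"]) auto
qed

lemma regular_points_prev:
  assumes A: "regular_points A" and x: "x > 0"
  shows "\<exists>y\<in>A. y < x \<and> A \<inter> {y<..<x} = {}"
proof -
  obtain z where z: "z \<in> A" "z < x" using A x unfolding regular_points_def by blast
  have "z > 0" using z A unfolding regular_points_def by auto
  let ?F = "A \<inter> {z..<x}"
  have "finite ?F" by (rule finite_subset[OF _ regular_points_finite[OF A \<open>z > 0\<close>, of x]]) auto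
  moreover have "?F \<noteq> {}" using z by auto
  ultimately have F: "Max ?F \<in> ?F" "\<And>u. u \<in> ?F \<Longrightarrow> u \<le> Max ?F"
    using Max_in Max_ge by blast+
  have "u \<notin> A \<inter> {Max ?F<..<x}" for u
    using F(1) F(2)[of u] by auto
  then have "A \<inter> {Max ?F<..<x} = {}" by blast
  then show ?thesis using F(1) by (intro bexI[of _ "Max ?F"]) auto
qed

lemma strict_mono_int_stepI:
  fixes T :: "int \<Rightarrow> real"
  assumes "\<And>i. T i < T (i + 1)"
  shows "strict_mono T"
proof -
  have "T i < T (i + 1 + int n)" for i n
  proof (induction n)
    case (Suc n)
    then show ?case using assms[of "i + 1 + int n"] by (simp add: algebra_simps)
  qed (use assms in simp)
  then show ?thesis
    by (intro strict_monoI) (metis add.assoc le_add_diff_inverse zle_iff_zadd zless_imp_add1_zle add.commute)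
qed

text \<open>An injective sequence in \<open>A\<close> cannot stay in a compact part of
  \<open>{0<..}\<close>, where \<open>A\<close> is finite; so \<open>T\<close> climbs above
  \<open>x\<close> and descends to or below it. The hypothesis is an inclusion because the
  surjectivity of the constructed enumeration is derived from this lemma.\<close>

lemma locate_in_enumeration:
  assumes A: "regular_points A" and T: "strict_mono T" "range T \<subseteq> A" and x: "x > 0"
  obtains i :: int where "T i \<le> x" "x < T (i + 1)"
proof -
  have pos: "T i > 0" for i using T(2) A unfolding regular_points_def by auto
  have inj: "inj T" using T(1) by (rule strict_mono_imp_inj_on)
  show ?thesis
  proof (cases "T 0 \<le> x")
    case True
    have "\<exists>n::nat. x < T (int n)"
    proof (rule ccontr)
      assume "\<not> ?thesis"
      then have "T (int n) \<le> x" for n by (simp add: not_less)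
      moreover have "T 0 \<le> T (int n)" for n using T(1) by (simp add: strict_mono_less_eq)
      ultimately have "range (\<lambda>n. T (int n)) \<subseteq> A \<inter> {T 0..x}" using T(2) by auto
      then have "finite (range (\<lambda>n. T (int n)))"
        using regular_points_finite[OF A pos] finite_subset by blast
      moreover have "inj (\<lambda>n. T (int n))" by (intro injI) (metis inj injD of_nat_eq_iff)
      ultimately show False using finite_imageD by blast
    qed
    then obtain n where n: "x < T (int n)" "\<And>k. k < n \<Longrightarrow> \<not> x < T (int k)"
      using exists_least_iff[of "\<lambda>n. x < T (int n)"] by blast
    then have "n > 0" using True by (cases n) auto
    show ?thesis
      by (rule that[of "int n - 1"]) (use n(1) n(2)[of "n - 1"] \<open>n > 0\<close> in \<open>auto simp: of_nat_diff not_less\<close>)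
  next
    case False
    have "\<exists>n::nat. T (- int n) \<le> x"
    proof (rule ccontr)
      assume "\<not> ?thesis"
      then have "x \<le> T (- int n)" for n by (simp add: not_le less_imp_le)
      moreover have "T (- int n) \<le> T 0" for n using T(1) by (simp add: strict_mono_less_eq)
      ultimately have "range (\<lambda>n. T (- int n)) \<subseteq> A \<inter> {x..T 0}" using T(2) by auto
      then have "finite (range (\<lambda>n. T (- int n)))"
        using regular_points_finite[OF A x] finite_subset by blast
      moreover have "inj (\<lambda>n. T (- int n))" by (intro injI) (metis inj injD neg_equal_iff_equal of_nat_eq_iff)
      ultimately show False using finite_imageD by blast
    qed
    then obtain n where n: "T (- int n) \<le> x" "\<And>k. k < n \<Longrightarrow> \<not> T (- int k) \<le> x"
      using exists_least_iff[of "\<lambda>n. T (- int n) \<le> x"] by blast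
    then have "n > 0" using False by (cases n) auto
    show ?thesis
      by (rule that[of "- int n"]) (use n(1) n(2)[of "n - 1"] \<open>n > 0\<close> in \<open>auto simp: of_nat_diff not_le algebra_simps\<close>)
  qed
qed

lemma enumeration_exists:
  assumes A: "regular_points A"
  shows "\<exists>T :: int \<Rightarrow> real. strict_mono T \<and> range T = A \<and> T 0 \<le> 1 \<and> 1 < T 1"
proof -
  obtain nxt where nxt: "\<And>x. x > 0 \<Longrightarrow> nxt x \<in> A \<and> x < nxt x \<and> A \<inter> {x<..<nxt x} = {}"
    using regular_points_next[OF A] by metis
  obtain prv where prv: "\<And>x. x > 0 \<Longrightarrow> prv x \<in> A \<and> prv x < x \<and> A \<inter> {prv x<..<x} = {}"
    using regular_points_prev[OF A] by metis
  have posA: "y > 0" if "y \<in> A" for y using that A unfolding regular_points_def by auto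
  \<comment> \<open>The last point at or before 1. It is reached through \<open>nxt 1\<close>
    because \<open>prv\<close> looks strictly to the left and 1 may itself be a point.\<close>
  define c where "c = prv (nxt 1)"
  have n1: "nxt 1 \<in> A" "1 < nxt 1" "A \<inter> {1<..<nxt 1} = {}" using nxt[of 1] by auto
  have c: "c \<in> A" "c < nxt 1" "A \<inter> {c<..<nxt 1} = {}"
    unfolding c_def using prv[of "nxt 1"] posA[OF n1(1)] by auto
  have c1: "c \<le> 1"
  proof (rule ccontr)
    assume "\<not> c \<le> 1"
    then have "c \<in> A \<inter> {1<..<nxt 1}" using c by auto
    then show False using n1(3) by auto
  qed
  define T where "T i = (if i \<ge> 0 then (nxt ^^ nat i) c else (prv ^^ nat (- i)) c)" for i :: int
  have up: "(nxt ^^ n) c \<in> A" for n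
    using nxt posA c(1) by (induction n) auto
  have down: "(prv ^^ n) c \<in> A" for n
    using prv posA c(1) by (induction n) auto
  have TA: "T i \<in> A" for i unfolding T_def using up down by simp
  have step: "T i < T (i + 1) \<and> A \<inter> {T i<..<T (i + 1)} = {}" for i
  proof (cases "i \<ge> 0")
    case True
    then have "T (i + 1) = nxt (T i)" by (simp add: T_def nat_add_distrib)
    then show ?thesis using nxt[of "T i"] posA[OF TA] by simp
  next
    case False
    then have "nat (- i) = Suc (nat (- (i + 1)))" by linarith
    then have "T i = prv (T (i + 1))" using False by (auto simp: T_def)
    then show ?thesis using prv[of "T (i + 1)"] posA[OF TA] by simp
  qed
  then have mono: "strict_mono T" by (intro strict_mono_int_stepI) auto
  have "range T = A"
  proof (intro equalityI subsetI)
    fix y assume y: "y \<in> A"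
    obtain i where i: "T i \<le> y" "y < T (i + 1)"
      using locate_in_enumeration[OF A mono _ posA[OF y]] TA by blast
    then have "y = T i" using step[of i] y by force
    then show "y \<in> range T" by simp
  qed (use TA in auto)
  moreover have "T 0 \<le> 1" using c1 by (simp add: T_def)
  moreover have "1 < T 1"
  proof (rule ccontr)
    assume "\<not> 1 < T 1"
    moreover have "T 0 < T 1" using step[of 0] by simp
    ultimately have "T 1 \<in> A \<inter> {c<..<nxt 1}" using TA[of 1] n1(2) by (simp add: T_def)
    then show False using c(3) by auto
  qed
  ultimately show ?thesis using mono by blast
qed

lemma enumeration_unique:
  fixes T T' :: "int \<Rightarrow> real"
  assumes T: "strict_mono T" "range T = A" "T 0 \<le> 1" "1 < T 1"
    and T': "strict_mono T'" "range T' = A" "T' 0 \<le> 1" "1 < T' 1"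
  shows "T = T'"
proof -
  \<comment> \<open>Each of the three inequalities is proved for an arbitrary pair of enumerations
    and used twice, with the roles exchanged, to give equality.\<close>
  have zero: "T' 0 \<le> T 0" if asm: "strict_mono T" "range T = A" "1 < T 1" "range T' = A" "T' 0 \<le> 1"
    for T T' :: "int \<Rightarrow> real"
  proof -
    obtain i where i: "T' 0 = T i" using asm by blast
    then have "T i < T 1" using asm by simp
    then have "i \<le> 0" using asm(1) by (simp add: strict_mono_less)
    then show ?thesis using i asm(1) by (simp add: strict_mono_less_eq)
  qed
  have up: "T' (i + 1) \<le> T (i + 1)"
    if asm: "strict_mono T" "strict_mono T'" "range T = A" "range T' = A" "T i = T' i" for T T' :: "int \<Rightarrow> real" and i
  proof -
    obtain k where k: "T (i + 1) = T' k" using asm by blast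
    have "T i < T (i + 1)" using asm(1) by (simp add: strict_mono_less)
    then have "T' i < T' k" using k asm by simp
    then have "i + 1 \<le> k" using asm(2) by (simp add: strict_mono_less)
    then show ?thesis using k asm(2) by (simp add: strict_mono_less_eq)
  qed
  have down: "T (i - 1) \<le> T' (i - 1)"
    if asm: "strict_mono T" "strict_mono T'" "range T = A" "range T' = A" "T i = T' i" for T T' :: "int \<Rightarrow> real" and i
  proof -
    obtain k where k: "T (i - 1) = T' k" using asm by blast
    have "T (i - 1) < T i" using asm(1) by (simp add: strict_mono_less)
    then have "T' k < T' i" using k asm by simp
    then have "k \<le> i - 1" using asm(2) by (simp add: strict_mono_less)
    then show ?thesis using k asm(2) by (simp add: strict_mono_less_eq)
  qed
  have "T i = T' i" for i
  proof (induction i rule: int_induct[where k=0])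
    case base
    show ?case using zero[of T T'] zero[of T' T] T T' by force
  next
    case (step1 i)
    show ?case using up[of T T' i] up[of T' T i] T T' step1 by force
  next
    case (step2 i)
    show ?case using down[of T T' i] down[of T' T i] T T' step2 by force
  qed
  then show ?thesis by auto
qed

lemma turning_time:
  assumes A: "regular_points A"
  shows "strict_mono (turning_time A)" "range (turning_time A) = A"
    "turning_time A 0 \<le> 1" "1 < turning_time A 1"
proof -
  have "\<exists>!T :: int \<Rightarrow> real. strict_mono T \<and> range T = A \<and> T 0 \<le> 1 \<and> 1 < T 1"
    using enumeration_exists[OF A] enumeration_unique by metis
  from theI'[OF this] show "strict_mono (turning_time A)" "range (turning_time A) = A"
    "turning_time A 0 \<le> 1" "1 < turning_time A 1"
    unfolding turning_time_def by blast+
qed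

text \<open>The truncation at 0 covers \<open>t < s\<close>, when the interval is empty. Applying
  the lemma in both orders recovers the signed difference \<open>k - i\<close>.\<close>

lemma card_points_between:
  assumes A: "regular_points A"
    and s: "turning_time A i \<le> s" "s < turning_time A (i + 1)"
    and t: "turning_time A k \<le> t" "t < turning_time A (k + 1)"
  shows "int (card (A \<inter> {s<..t})) = max 0 (k - i)"
proof -
  note T = turning_time[OF A]
  have "A \<inter> {s<..t} = turning_time A ` {i<..k}"
  proof (intro equalityI subsetI)
    fix x assume x: "x \<in> A \<inter> {s<..t}"
    then obtain j where j: "x = turning_time A j" using T(2) by blast
    have "turning_time A i < turning_time A j" using x s(1) j by auto
    moreover have "turning_time A j < turning_time A (k + 1)" using x t(2) j by auto
    ultimately show "x \<in> turning_time A ` {i<..k}" using T(1) j by (auto simp: strict_mono_less)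
  next
    fix x assume "x \<in> turning_time A ` {i<..k}"
    then obtain j where j: "x = turning_time A j" "i + 1 \<le> j" "j \<le> k" by auto
    then have "turning_time A (i + 1) \<le> x" "x \<le> turning_time A k"
      using T(1) by (simp_all add: strict_mono_less_eq)
    then show "x \<in> A \<inter> {s<..t}" using s(2) t(1) j(1) T(2) by auto
  qed
  moreover have "card (turning_time A ` {i<..k}) = card {i<..k}"
    using T(1) by (intro card_image) (auto intro: strict_mono_imp_inj_on inj_on_subset)
  ultimately show ?thesis by simp
qed

section \<open>Lengths of zigzag intervals and increments of zigzag paths\<close>

lemma zigzag_interval_measure_step:
  assumes "0 \<le> s" "s \<le> t"
  shows "measure lborel (zigzag_interval A i \<inter> {0..t}) =
    measure lborel (zigzag_interval A i \<inter> {0..s}) + measure lborel (zigzag_interval A i \<inter> {s<..t})"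
proof -
  have fin: "emeasure lborel (zigzag_interval A i \<inter> B) \<noteq> \<infinity>" if "B \<subseteq> {0..t}" for B
  proof -
    have "emeasure lborel (zigzag_interval A i \<inter> B) \<le> emeasure lborel {0..t}"
      using that by (intro emeasure_mono) auto
    also have "\<dots> < \<infinity>" using assms by simp
    finally show ?thesis by simp
  qed
  have eq: "zigzag_interval A i \<inter> {0..t} = (zigzag_interval A i \<inter> {0..s}) \<union> (zigzag_interval A i \<inter> {s<..t})"
    using assms by auto
  show ?thesis
    unfolding eq
  proof (rule measure_Union)
    show "emeasure lborel (zigzag_interval A i \<inter> {0..s}) \<noteq> \<infinity>" "emeasure lborel (zigzag_interval A i \<inter> {s<..t}) \<noteq> \<infinity>"
      using assms by (intro fin; auto)+
  qed (auto simp: zigzag_interval_def)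
qed

lemma zigzag_interval_disjoint:
  assumes A: "regular_points A"
  shows "disjoint_family (\<lambda>i. zigzag_interval A i)"
proof -
  note T = turning_time[OF A]
  have "zigzag_interval A i \<inter> zigzag_interval A j = {}" if "i < j" for i j
  proof -
    have "turning_time A (i + 1) \<le> turning_time A j"
      using that T(1) by (simp add: strict_mono_less_eq)
    then show ?thesis by (auto simp: zigzag_interval_def)
  qed
  then show ?thesis
    unfolding disjoint_family_on_def by (metis Int_commute linorder_less_linear)
qed

lemma sum_zigzag_interval_le:
  assumes A: "regular_points A" and st: "s \<le> t" and F: "finite F"
  shows "(\<Sum>i\<in>F. measure lborel (zigzag_interval A i \<inter> {s<..t})) \<le> t - s"
proof -
  have fin: "emeasure lborel (zigzag_interval A i \<inter> {s<..t}) \<noteq> \<infinity>" for i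
  proof -
    have "emeasure lborel (zigzag_interval A i \<inter> {s<..t}) \<le> emeasure lborel {s<..t}"
      by (intro emeasure_mono) auto
    also have "\<dots> < \<infinity>" using st by simp
    finally show ?thesis by simp
  qed
  have "(\<Sum>i\<in>F. measure lborel (zigzag_interval A i \<inter> {s<..t})) =
      measure lborel (\<Union>i\<in>F. zigzag_interval A i \<inter> {s<..t})"
  proof (rule measure_finite_Union[symmetric])
    show "disjoint_family_on (\<lambda>i. zigzag_interval A i \<inter> {s<..t}) F"
      using zigzag_interval_disjoint[OF A] unfolding disjoint_family_on_def by blast
  qed (use F fin in \<open>auto simp: zigzag_interval_def\<close>)
  also have "\<dots> \<le> measure lborel {s<..t}"
    using F st by (intro measure_mono_fmeasurable) (auto simp: fmeasurable_def zigzag_interval_def)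
  also have "\<dots> = t - s" using st by simp
  finally show ?thesis .
qed

text \<open>By disjointness the lengths within \<open>{s<..t}\<close> have partial sums at most
  \<open>t - s\<close>. This makes the two-sided series absolutely summable and at the same time
  bounds the increment.\<close>

lemma zigzag_path_increment:
  fixes v :: "int \<Rightarrow> real ^ 'd"
  assumes A: "regular_points A" and v: "\<And>i. norm (v i) \<le> 1" and st: "0 \<le> s" "s \<le> t"
  shows "zigzag_path A v t - zigzag_path A v s =
      (\<Sum>\<^sub>\<infinity>i. measure lborel (zigzag_interval A i \<inter> {s<..t}) *\<^sub>R v i)"
    and "norm (zigzag_path A v t - zigzag_path A v s) \<le> t - s"
proof -
  have sm: "(\<lambda>i. measure lborel (zigzag_interval A i \<inter> {s<..t})) summable_on UNIV" if "s \<le> t" for s t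
    using sum_zigzag_interval_le[OF A that]
    by (intro nonneg_bdd_above_summable_on) (auto simp: bdd_above_def)
  have sm0: "(\<lambda>i. measure lborel (zigzag_interval A i \<inter> {0..t})) summable_on UNIV" if "0 \<le> t" for t
  proof -
    \<comment> \<open>Turning times are positive, so enlarging the window to the left changes
      nothing and the half-open estimate becomes applicable.\<close>
    have "measure lborel (zigzag_interval A i \<inter> {0..t}) = measure lborel (zigzag_interval A i \<inter> {-1<..t})" for i
    proof -
      have "turning_time A i > 0" using turning_time(2)[OF A] A unfolding regular_points_def by auto
      then have "zigzag_interval A i \<inter> {0..t} = zigzag_interval A i \<inter> {-1<..t}"
        unfolding zigzag_interval_def by auto
      then show ?thesis by simp
    qed
    then show ?thesis using sm[of "-1" t] that by simp
  qed
  have scale: "(\<lambda>i. norm (f i *\<^sub>R v i)) summable_on UNIV" if "f summable_on UNIV" "\<And>i. f i \<ge> 0" for f :: "int \<Rightarrow> real"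
  proof (rule Infinite_Sum.abs_summable_on_comparison_test[of f])
    show "(\<lambda>i. norm (f i)) summable_on UNIV" using that by simp
    show "norm (f i *\<^sub>R v i) \<le> norm (f i)" for i using v[of i] that(2)[of i] by (simp add: mult_left_le)
  qed
  let ?D = "\<lambda>i. measure lborel (zigzag_interval A i \<inter> {s<..t})"
  have smD: "?D summable_on UNIV" by (rule sm[OF st(2)])
  have "zigzag_path A v t = (\<Sum>\<^sub>\<infinity>i. measure lborel (zigzag_interval A i \<inter> {0..s}) *\<^sub>R v i + ?D i *\<^sub>R v i)"
    unfolding zigzag_path_def using A st zigzag_interval_measure_step[OF st]
    by (simp add: scaleR_left_distrib)
  also have "\<dots> = (\<Sum>\<^sub>\<infinity>i. measure lborel (zigzag_interval A i \<inter> {0..s}) *\<^sub>R v i) + (\<Sum>\<^sub>\<infinity>i. ?D i *\<^sub>R v i)"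
    by (rule infsum_add) (rule abs_summable_summable, rule scale, rule sm0[OF st(1)] smD, simp)+
  also have "(\<Sum>\<^sub>\<infinity>i. measure lborel (zigzag_interval A i \<inter> {0..s}) *\<^sub>R v i) = zigzag_path A v s"
    unfolding zigzag_path_def using A st by simp
  finally show eq: "zigzag_path A v t - zigzag_path A v s = (\<Sum>\<^sub>\<infinity>i. ?D i *\<^sub>R v i)" by simp
  have "norm (\<Sum>\<^sub>\<infinity>i. ?D i *\<^sub>R v i) \<le> (\<Sum>\<^sub>\<infinity>i. norm (?D i *\<^sub>R v i))"
    by (rule norm_infsum_bound[OF scale[OF smD]]) simp
  also have "\<dots> \<le> infsum ?D UNIV"
  proof (rule infsum_mono)
    show "(\<lambda>i. norm (?D i *\<^sub>R v i)) summable_on UNIV" by (rule scale[OF smD]) simp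
    show "?D summable_on UNIV" by (rule smD)
    show "norm (?D i *\<^sub>R v i) \<le> ?D i" for i using v[of i] by (simp add: mult_left_le)
  qed
  also have "\<dots> \<le> t - s"
    by (rule infsum_le_finite_sums[OF smD]) (rule sum_zigzag_interval_le[OF A st(2)])
  finally show "norm (zigzag_path A v t - zigzag_path A v s) \<le> t - s" unfolding eq .
qed

lemma zigzag_path_in_lip_paths:
  fixes v :: "int \<Rightarrow> real ^ 'd"
  assumes v: "\<And>i. norm (v i) \<le> 1"
  shows "zigzag_path A v \<in> lip_paths"
proof (cases "regular_points A")
  case True
  have "dist (zigzag_path A v s) (zigzag_path A v t) \<le> \<bar>s - t\<bar>" if "0 \<le> s" "0 \<le> t" for s t
    using zigzag_path_increment(2)[OF True v, of s t] zigzag_path_increment(2)[OF True v, of t s] that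
    by (cases "s \<le> t") (auto simp: dist_norm norm_minus_commute)
  moreover have "zigzag_path A v 0 = 0"
  proof -
    have "measure lborel (zigzag_interval A i \<inter> {0}) = 0" for i
      by (rule measure_eq_0_null_sets, rule finite_imp_null_set_lborel) auto
    then show ?thesis by (simp add: zigzag_path_def)
  qed
  ultimately show ?thesis unfolding lip_paths_def by (auto simp: zigzag_path_def)
next
  case False
  then show ?thesis unfolding lip_paths_def by (auto simp: zigzag_path_def)
qed

lemma zigzag_path_linear:
  fixes v :: "int \<Rightarrow> real ^ 'd"
  assumes A: "regular_points A" and v: "\<And>i. norm (v i) \<le> 1" and st: "0 \<le> s" "s \<le> t"
    and i: "turning_time A i \<le> s" "s < turning_time A (i + 1)" and empty: "A \<inter> {s<..t} = {}"
  shows "zigzag_path A v t = zigzag_path A v s + (t - s) *\<^sub>R v i"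
proof -
  let ?D = "\<lambda>i. measure lborel (zigzag_interval A i \<inter> {s<..t})"
  have "t < turning_time A (i + 1)"
    using empty i(2) turning_time(2)[OF A] by (metis Int_iff empty_iff greaterThanAtMost_iff not_le rangeI)
  then have I: "zigzag_interval A i \<inter> {s<..t} = {s<..t}"
    using i(1) unfolding zigzag_interval_def by auto
  have "?D j = 0" if "j \<noteq> i" for j
  proof -
    have "zigzag_interval A j \<inter> zigzag_interval A i = {}"
      using zigzag_interval_disjoint[OF A] that unfolding disjoint_family_on_def by auto
    then have "zigzag_interval A j \<inter> {s<..t} = {}" using I by auto
    then show ?thesis by simp
  qed
  then have "(\<Sum>\<^sub>\<infinity>j. ?D j *\<^sub>R v j) = (\<Sum>\<^sub>\<infinity>j\<in>{i}. ?D j *\<^sub>R v j)"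
    by (intro infsum_cong_neutral) auto
  also have "\<dots> = (t - s) *\<^sub>R v i" using I st by simp
  finally show ?thesis
    using zigzag_path_increment(1)[OF A v st] by (simp add: algebra_simps)
qed

text \<open>The deterministic approximation behind measurability. Turning points accumulate at 0, so
  the cells starting before about \<open>e / 8\<close> are all counted as bad, at total cost
  \<open>e / 4\<close>; a later cell is bad only if it contains one of the \<open>N\<close> points
  up to \<open>T + 2\<close>. The total is \<open>h * (1 + 2 * N) + e / 4\<close>. With mesh
  \<open>1 / k\<close>, the \<open>k * k\<close> cells eventually reach beyond any fixed
  \<open>T\<close>.\<close>

lemma zigzag_path_grid_limit:
  fixes v :: "int \<Rightarrow> real ^ 'd"
  assumes A: "regular_points A" and v: "\<And>i. norm (v i) \<le> 1"
    and idx: "\<And>k j. k \<ge> 1 \<Longrightarrow> j \<ge> 1 \<Longrightarrow>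
      turning_time A (idx k j) \<le> real j * (1 / real k) \<and> real j * (1 / real k) < turning_time A (idx k j + 1)"
    and e: "e > 0"
  shows "\<forall>\<^sub>F k in sequentially. \<forall>t\<in>{0..T}.
    dist (grid_path (1 / real k) (k * k) (\<lambda>j. v (idx k j)) t) (zigzag_path A v t) < e"
proof -
  define N where "N = card (A \<inter> {e / 8..T + 2})"
  define R where "R = nat \<lceil>max T 0\<rceil> + 1"
  have R: "R \<ge> 1" "T \<le> real R" unfolding R_def by linarith+
  show ?thesis
    using eventually_ge_at_top[of "max (Suc R) (nat \<lceil>8 * (1 + 2 * real N) / e\<rceil> + 1)"]
  proof eventually_elim
    case (elim k)
    define h where "h = 1 / real k"
    have k: "k \<ge> 1" "R \<le> k" "real k > 8 * (1 + 2 * real N) / e"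
      using elim by (simp, simp, linarith)
    have h: "h > 0" "h \<le> 1" "h * (1 + 2 * real N) < e / 8"
      using k e by (auto simp: h_def field_simps)
    show ?case
    proof
      fix t assume t: "t \<in> {0..T}"
      \<comment> \<open>On \<open>[0, T]\<close> only the first \<open>J\<close> cells are visible.
        Cutting down to them is what bounds the bad cells by the points up to
        \<open>T + 2\<close>.\<close>
      define J where "J = nat \<lceil>T / h\<rceil>"
      have T0: "0 \<le> T" using t by auto
      have J: "T / h \<le> real J" "real J < T / h + 1" unfolding J_def using T0 h by (auto intro: of_nat_ceiling) linarith
      have JT: "T \<le> real J * h" "real J * h \<le> T + h" using J h by (auto simp: field_simps)
      have "J \<le> k * k"
      proof -
        have "T / h = T * real k" by (simp add: h_def)
        also have "\<dots> \<le> real (R * k)" using R by (simp add: mult_right_mono)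
        finally have "J \<le> R * k" unfolding J_def by (simp add: ceiling_le_iff nat_le_iff)
        also have "\<dots> \<le> k * k" using k by simp
        finally show ?thesis .
      qed
      have gp: "grid_path h (k * k) (\<lambda>j. v (idx k j)) t = grid_path h J (\<lambda>j. v (idx k j)) t"
      proof -
        have "t \<le> real j * h \<and> t \<le> real (Suc j) * h" if "j > J" for j
        proof -
          have "real J * h \<le> real j * h" "real J * h \<le> real (Suc j) * h" using that h by auto
          then show ?thesis using JT t by auto
        qed
        then show ?thesis
          unfolding grid_path_def using t \<open>J \<le> k * k\<close>
          by (auto intro!: sum.mono_neutral_right simp: min_def)
      qed
      define B where "B = {j. A \<inter> {real j * h<..real (Suc j) * h} \<noteq> {}}"
      have dist: "dist (zigzag_path A v t) (grid_path h J (\<lambda>j. v (idx k j)) t) \<le> h + 2 * h * real (card ({1..J} \<inter> B))"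
      proof (rule grid_path_approx)
        show "zigzag_path A v \<in> lip_paths" by (rule zigzag_path_in_lip_paths[OF v])
        show "t \<in> {0..real (Suc J) * h}" using t JT h by (auto simp: algebra_simps)
        fix j s assume j: "j \<in> {1..J}" "j \<notin> B" and s: "s \<in> {real j * h..real (Suc j) * h}"
        have jh: "0 \<le> real j * h" using h by simp
        have "A \<inter> {real j * h<..s} = {}" using j(2) s unfolding B_def by auto
        then show "zigzag_path A v s = zigzag_path A v (real j * h) + (s - real j * h) *\<^sub>R v (idx k j)"
          using idx[OF k(1), of j] j s jh h_def by (intro zigzag_path_linear[OF A v]) auto
      qed (use h v in auto)
      have "real (card ({1..J} \<inter> B)) \<le> e / 8 / h + real N"
      proof -
        let ?E = "{j. 1 \<le> j \<and> real j \<le> e / 8 / h}"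
        \<comment> \<open>A point in \<open>(j h, (j + 1) h]\<close> determines \<open>j\<close>:
          divide by \<open>h\<close>, round up, subtract 1. So there are no more late bad cells than
          points.\<close>
        let ?F = "(\<lambda>x. nat (\<lceil>x / h\<rceil> - 1)) ` (A \<inter> {e / 8..T + 2})"
        have sub: "{1..J} \<inter> B \<subseteq> ?E \<union> ?F"
        proof
          fix j assume j: "j \<in> {1..J} \<inter> B"
          show "j \<in> ?E \<union> ?F"
          proof (cases "real j \<le> e / 8 / h")
            case False
            then have jh: "e / 8 < real j * h" using h by (simp add: field_simps)
            obtain x where x: "x \<in> A" "real j * h < x" "x \<le> real (Suc j) * h"
              using j unfolding B_def by auto
            have "real j * h \<le> real J * h" using j h by auto
            moreover have "real (Suc j) * h = real j * h + h" by (simp add: algebra_simps)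
            ultimately have "real (Suc j) * h \<le> T + 2" using JT h by linarith
            then have "x \<in> A \<inter> {e / 8..T + 2}" using x jh by auto
            moreover have "\<lceil>x / h\<rceil> = int (Suc j)"
              using x h by (intro ceiling_unique) (auto simp: field_simps)
            then have "j = nat (\<lceil>x / h\<rceil> - 1)" by simp
            ultimately show ?thesis by blast
          qed (use j in auto)
        qed
        have E: "?E \<subseteq> {1..nat \<lfloor>e / 8 / h\<rfloor>}" by (auto simp: le_nat_floor)
        have finA: "finite (A \<inter> {e / 8..T + 2})" using regular_points_finite[OF A] e by simp
        have "card ({1..J} \<inter> B) \<le> card ({1..nat \<lfloor>e / 8 / h\<rfloor>} \<union> ?F)"
          using sub E finA by (intro card_mono) auto
        also have "\<dots> \<le> nat \<lfloor>e / 8 / h\<rfloor> + N"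
          using card_Un_le[of "{1..nat \<lfloor>e / 8 / h\<rfloor>}" ?F] card_image_le[OF finA, of "\<lambda>x. nat (\<lceil>x / h\<rceil> - 1)"]
          unfolding N_def by simp
        finally have "real (card ({1..J} \<inter> B)) \<le> real (nat \<lfloor>e / 8 / h\<rfloor>) + real N" by linarith
        moreover have "real (nat \<lfloor>e / 8 / h\<rfloor>) \<le> e / 8 / h" using e h by (intro of_nat_floor) auto
        ultimately show ?thesis by linarith
      qed
      then have "h + 2 * h * real (card ({1..J} \<inter> B)) \<le> h + 2 * h * (e / 8 / h + real N)"
        using h by (intro add_left_mono mult_left_mono) auto
      with dist have "dist (zigzag_path A v t) (grid_path h J (\<lambda>j. v (idx k j)) t) \<le> h + 2 * h * (e / 8 / h + real N)"
        by linarith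
      also have "\<dots> = h * (1 + 2 * real N) + e / 4" using h by (simp add: field_simps)
      also have "\<dots> < e" using h(3) e by linarith
      finally show "dist (grid_path (1 / real k) (k * k) (\<lambda>j. v (idx k j)) t) (zigzag_path A v t) < e"
        using gp unfolding h_def by (simp add: dist_commute)
    qed
  qed
qed

section \<open>The labels\<close>

lemma prod_int_shift:
  fixes f :: "int \<Rightarrow> real"
  shows "(\<Prod>i\<in>{a..<b}. f i) = (\<Prod>k\<in>{1..<nat (b - a + 1)}. f (int k - 1 + a))"
  by (rule prod.reindex_bij_witness[of _ "\<lambda>k. int k - 1 + a" "\<lambda>i. nat (i - a + 1)"]) auto

text \<open>Rows sum to 1, so summing out the last letter carries the formula from long words down
  to short ones. The labels call for this: their windows contain 0, so a window starting at
  \<open>- m\<close> gives words of length at least \<open>Suc m\<close> only.\<close>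

lemma mix_chainI_late:
  assumes M: "prob_space M" and S: "finite S" "S \<noteq> {}"
    and X: "\<And>k. k \<ge> 1 \<Longrightarrow> X k \<in> M \<rightarrow>\<^sub>M count_space S"
    and late: "\<And>n w. n \<ge> N \<Longrightarrow> w \<in> {1..n} \<rightarrow> S \<Longrightarrow>
        \<P>(\<omega> in M. \<forall>k\<in>{1..n}. X k \<omega> = w k) =
          1 / real (card S) * (\<Prod>k\<in>{1..<n}. mix S (c k) (w k) (w (Suc k)))"
  shows "mix_chain M S c X"
proof -
  interpret prob_space M by fact
  let ?word = "\<lambda>n. \<forall>w. w \<in> {1..n} \<rightarrow> S \<longrightarrow>
        \<P>(\<omega> in M. \<forall>k\<in>{1..n}. X k \<omega> = w k) =
          1 / real (card S) * (\<Prod>k\<in>{1..<n}. mix S (c k) (w k) (w (Suc k)))"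
  have ev: "{\<omega> \<in> space M. \<forall>k\<in>{1..n}. X k \<omega> = w k} \<in> events" for n w
    by (rule sets_finite_coordinates) (use X in auto)
  have step: "?word n" if n: "n \<ge> 1" and IH: "?word (Suc n)" for n
  proof (intro allI impI)
    fix w assume w: "w \<in> {1..n} \<rightarrow> S"
    have ins: "{1..Suc n} = insert (Suc n) {1..n}" by auto
    let ?A = "\<lambda>y. {\<omega> \<in> space M. \<forall>k\<in>{1..Suc n}. X k \<omega> = (w(Suc n := y)) k}"
    have "{\<omega> \<in> space M. \<forall>k\<in>{1..n}. X k \<omega> = w k} = (\<Union>y\<in>S. ?A y)"
      unfolding ins using measurable_space[OF X[of "Suc n"]] by auto
    then have "\<P>(\<omega> in M. \<forall>k\<in>{1..n}. X k \<omega> = w k) = prob (\<Union>y\<in>S. ?A y)" by simp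
    also have "\<dots> = (\<Sum>y\<in>S. prob (?A y))"
    proof (intro finite_measure_finite_Union S)
      show "?A ` S \<subseteq> events" using ev by blast
      show "disjoint_family_on ?A S" unfolding disjoint_family_on_def ins by auto
    qed
    also have "\<dots> = (\<Sum>y\<in>S. 1 / real (card S) * (\<Prod>k\<in>{1..<n}. mix S (c k) (w k) (w (Suc k))) * mix S (c n) (w n) y)"
    proof (rule sum.cong)
      fix y assume y: "y \<in> S"
      have "prob (?A y) = 1 / real (card S) * (\<Prod>k\<in>{1..<Suc n}. mix S (c k) ((w(Suc n := y)) k) ((w(Suc n := y)) (Suc k)))"
      proof -
        have "w(Suc n := y) \<in> {1..Suc n} \<rightarrow> S" using w y by (auto simp: Pi_iff)
        then show ?thesis using IH by blast
      qed
      also have "\<dots> = 1 / real (card S) * (\<Prod>k\<in>{1..<n}. mix S (c k) (w k) (w (Suc k))) * mix S (c n) (w n) y"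
        using n by (simp add: prod.op_ivl_Suc)
      finally show "prob (?A y) = 1 / real (card S) * (\<Prod>k\<in>{1..<n}. mix S (c k) (w k) (w (Suc k))) * mix S (c n) (w n) y" .
    qed simp
    also have "\<dots> = 1 / real (card S) * (\<Prod>k\<in>{1..<n}. mix S (c k) (w k) (w (Suc k)))"
    proof -
      have "w n \<in> S" using w n by auto
      then show ?thesis
        unfolding sum_distrib_left[symmetric] sum_mix[OF S(1) \<open>w n \<in> S\<close>] by simp
    qed
    finally show "\<P>(\<omega> in M. \<forall>k\<in>{1..n}. X k \<omega> = w k) =
        1 / real (card S) * (\<Prod>k\<in>{1..<n}. mix S (c k) (w k) (w (Suc k)))" .
  qed
  have "?word (N - d)" if "N - d \<ge> 1" for d
    using that
  proof (induction d)
    case 0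
    then show ?case using late[of N] by simp
  next
    case (Suc d)
    then have "Suc (N - Suc d) = N - d" by simp
    then show ?case using step[of "N - Suc d"] Suc by simp
  qed
  then have down: "\<And>d. N - d \<ge> 1 \<Longrightarrow> ?word (N - d)" .
  have "?word n" if "n \<ge> 1" for n
  proof (cases "n \<ge> N")
    case True
    then show ?thesis using late by blast
  next
    case False
    then have eq: "N - (N - n) = n" by simp
    from down[of "N - n", unfolded eq, OF that] show ?thesis .
  qed
  then show ?thesis
    unfolding mix_chain_def using M S X by blast
qed

context
  fixes M :: "'w measure" and V :: "int \<Rightarrow> 'w \<Rightarrow> real ^ 'd" and c :: real
  assumes labels: "zigzag_labels M V" and d: "CARD('d) \<ge> 2"
  defines "c \<equiv> - 1 / (2 * real CARD('d) - 1)"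
begin

interpretation prob_space M
  using labels by (simp add: zigzag_labels_def)

lemma label_measurable: "V i \<in> M \<rightarrow>\<^sub>M count_space directions"
  using labels by (simp add: zigzag_labels_def)

text \<open>\<open>c\<close> is the value for which the diagonal entry
  \<open>c + (1 - c) / (2 d)\<close> vanishes; the mass is then spread evenly over the other
  \<open>2 d - 1\<close> directions.\<close>

lemma label_transition:
  fixes x v :: "real ^ 'd"
  assumes "x \<in> directions" "v \<in> directions"
  shows "pmf (pmf_of_set (directions - {x})) v = mix directions c x v"
proof -
  have card: "card (directions - {x}) = 2 * CARD('d) - 1"
    using assms(1) by (simp add: card_Diff_singleton card_directions)
  then have "directions - {x} \<noteq> {}" using d by force
  then have "pmf (pmf_of_set (directions - {x})) v = indicator (directions - {x}) v / real (2 * CARD('d) - 1)"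
    using card by (subst pmf_of_set) (auto simp: finite_directions)
  moreover have "real (2 * CARD('d) - 1) = 2 * real CARD('d) - 1" using d by (simp add: of_nat_diff)
  moreover have "c + (1 - c) / (2 * real CARD('d)) = 0"
    "(1 - c) / (2 * real CARD('d)) = 1 / (2 * real CARD('d) - 1)"
    unfolding c_def using d by (simp_all add: field_simps)
  ultimately show ?thesis
    using assms by (auto simp: mix_def card_directions)
qed

lemma label_window_event: "{\<omega> \<in> space M. \<forall>i\<in>{a..b::int}. V i \<omega> = w i} \<in> events"
  by (rule sets_finite_coordinates) (simp, rule label_measurable)

text \<open>The window grows from 0 first to the right, then to the left. A backward choice
  contributes the entry from \<open>w (- m)\<close> to \<open>w (- m - 1)\<close>, which the
  symmetry of \<open>mix\<close> turns into a forward transition.\<close>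

lemma label_window:
  assumes "\<And>i. w i \<in> directions"
  shows "\<P>(\<omega> in M. \<forall>i\<in>{- int m..int n}. V i \<omega> = w i) =
    1 / real (card (directions :: (real ^ 'd) set)) * (\<Prod>i\<in>{- int m..<int n}. mix directions c (w i) (w (i + 1)))" (is "_ = ?u * ?p m n")
proof (induction m)
  case 0
  show ?case
  proof (induction n)
    case 0
    have "\<P>(\<omega> in M. V 0 \<omega> = w 0) = ?u"
      using labels assms by (simp add: zigzag_labels_def pmf_of_directions)
    then show ?case by simp
  next
    case (Suc n)
    have ins: "{- int 0..int (Suc n)} = insert (int n + 1) {- int 0..int n}" by auto
    have "\<P>(\<omega> in M. \<forall>i\<in>{- int 0..int (Suc n)}. V i \<omega> = w i) =
       \<P>(\<omega> in M. V (int n + 1) \<omega> = w (int n + 1) \<and> (\<forall>i\<in>{- int 0..int n}. V i \<omega> = w i))"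
      unfolding ins by simp
    also have "\<dots> = \<P>(\<omega> in M. \<forall>i\<in>{- int 0..int n}. V i \<omega> = w i) * mix directions c (w (int n)) (w (int n + 1))"
    proof (rule prob_eq_cond_prob)
      show "prob_space M" by unfold_locales
      show "{\<omega> \<in> space M. \<forall>i\<in>{- int 0..int n}. V i \<omega> = w i} \<in> events" by (rule label_window_event)
      show "{\<omega> \<in> space M. V (int n + 1) \<omega> = w (int n + 1) \<and> (\<forall>i\<in>{- int 0..int n}. V i \<omega> = w i)} \<in> events"
        using label_window_event[of "- int 0" "int (Suc n)" w] unfolding ins by simp
      show "\<P>(\<omega> in M. V (int n + 1) \<omega> = w (int n + 1) \<bar> \<forall>i\<in>{- int 0..int n}. V i \<omega> = w i)
          = mix directions c (w (int n)) (w (int n + 1))"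
        if "\<P>(\<omega> in M. \<forall>i\<in>{- int 0..int n}. V i \<omega> = w i) > 0"
        unfolding label_transition[OF assms assms, symmetric]
        using labels[unfolded zigzag_labels_def, THEN conjunct2, THEN conjunct2, THEN conjunct2, rule_format,
            of "int 0" "int n" "w (int n + 1)" w] that assms by simp
    qed
    also have "\<P>(\<omega> in M. \<forall>i\<in>{- int 0..int n}. V i \<omega> = w i) = ?u * ?p 0 n" by (rule Suc.IH)
    also have "\<dots> * mix directions c (w (int n)) (w (int n + 1)) = ?u * ?p 0 (Suc n)"
    proof -
      have "{- int 0..<int (Suc n)} = insert (int n) {- int 0..<int n}" by auto
      then show ?thesis by (simp add: mult.commute)
    qed
    finally show ?case .
  qed
next
  case (Suc m)
  have ins: "{- int (Suc m)..int n} = insert (- int m - 1) {- int m..int n}" by auto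
  have "\<P>(\<omega> in M. \<forall>i\<in>{- int (Suc m)..int n}. V i \<omega> = w i) =
     \<P>(\<omega> in M. V (- int m - 1) \<omega> = w (- int m - 1) \<and> (\<forall>i\<in>{- int m..int n}. V i \<omega> = w i))"
    unfolding ins by simp
  also have "\<dots> = \<P>(\<omega> in M. \<forall>i\<in>{- int m..int n}. V i \<omega> = w i) * mix directions c (w (- int m)) (w (- int m - 1))"
  proof (rule prob_eq_cond_prob)
    show "prob_space M" by unfold_locales
    show "{\<omega> \<in> space M. \<forall>i\<in>{- int m..int n}. V i \<omega> = w i} \<in> events" by (rule label_window_event)
    show "{\<omega> \<in> space M. V (- int m - 1) \<omega> = w (- int m - 1) \<and> (\<forall>i\<in>{- int m..int n}. V i \<omega> = w i)} \<in> events"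
      using label_window_event[of "- int (Suc m)" "int n" w] unfolding ins by simp
    show "\<P>(\<omega> in M. V (- int m - 1) \<omega> = w (- int m - 1) \<bar> \<forall>i\<in>{- int m..int n}. V i \<omega> = w i)
        = mix directions c (w (- int m)) (w (- int m - 1))"
      if "\<P>(\<omega> in M. \<forall>i\<in>{- int m..int n}. V i \<omega> = w i) > 0"
      unfolding label_transition[OF assms assms, symmetric]
      using labels[unfolded zigzag_labels_def, THEN conjunct2, THEN conjunct2, THEN conjunct2, rule_format,
          of "int m" "int n" "w (- int m - 1)" w] that assms by simp
  qed
  also have "\<P>(\<omega> in M. \<forall>i\<in>{- int m..int n}. V i \<omega> = w i) = ?u * ?p m n" by (rule Suc.IH)
  also have "\<dots> * mix directions c (w (- int m)) (w (- int m - 1)) = ?u * ?p (Suc m) n"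
  proof -
    have "{- int (Suc m)..<int n} = insert (- int m - 1) {- int m..<int n}" by auto
    then show ?thesis by (simp add: mult.commute mix_commute[of _ _ "w (- int m - 1)"])
  qed
  finally show ?case .
qed

text \<open>Read from its left end \<open>- m\<close>, the window is a one-sided chain with uniform
  start, so the results on \<open>mix_chain\<close> reach arbitrarily negative indices.\<close>

lemma label_chain: "mix_chain M directions (\<lambda>_. c) (\<lambda>k. V (int k - 1 - int m))"
proof (rule mix_chainI_late[where N = "Suc m"])
  show "prob_space M" by unfold_locales
  show "finite (directions :: (real ^ 'd) set)" "(directions :: (real ^ 'd) set) \<noteq> {}"
    by (rule finite_directions directions_nonempty)+
  show "V (int k - 1 - int m) \<in> M \<rightarrow>\<^sub>M count_space directions" for k by (rule label_measurable)
  fix n and w :: "nat \<Rightarrow> real ^ 'd" assume n: "Suc m \<le> n" and w: "w \<in> {1..n} \<rightarrow> directions"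
  obtain v0 :: "real ^ 'd" where v0: "v0 \<in> directions" using directions_nonempty by blast
  \<comment> \<open>\<open>label_window\<close> asks for a direction at every integer; outside the
    word the arbitrary \<open>v0\<close> is inserted.\<close>
  define w' where "w' i = (let k = nat (i + 1 + int m) in if k \<in> {1..n} then w k else v0)" for i :: int
  have w': "w' i \<in> directions" for i using w v0 by (auto simp: w'_def Let_def)
  have wk: "w' (int k - 1 - int m) = w k" if "k \<in> {1..n}" for k using that by (simp add: w'_def)
  have "(\<forall>k\<in>{1..n}. V (int k - 1 - int m) \<omega> = w k) \<longleftrightarrow> (\<forall>i\<in>{- int m..int (n - Suc m)}. V i \<omega> = w' i)" for \<omega>
  proof safe
    fix i assume a: "\<forall>k\<in>{1..n}. V (int k - 1 - int m) \<omega> = w k" and i: "i \<in> {- int m..int (n - Suc m)}"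
    define k where "k = nat (i + 1 + int m)"
    have k: "k \<in> {1..n}" "i = int k - 1 - int m" using i n by (auto simp: k_def)
    then show "V i \<omega> = w' i" using a wk by simp
  next
    fix k assume a: "\<forall>i\<in>{- int m..int (n - Suc m)}. V i \<omega> = w' i" and k: "k \<in> {1..n}"
    then have "int k - 1 - int m \<in> {- int m..int (n - Suc m)}" using n by auto
    then show "V (int k - 1 - int m) \<omega> = w k" using a wk[OF k] by simp
  qed
  then have "\<P>(\<omega> in M. \<forall>k\<in>{1..n}. V (int k - 1 - int m) \<omega> = w k) =
      1 / real (card (directions :: (real ^ 'd) set)) *
        (\<Prod>i\<in>{- int m..<int (n - Suc m)}. mix directions c (w' i) (w' (i + 1)))"
    using label_window[OF w'] by simp
  also have "(\<Prod>i\<in>{- int m..<int (n - Suc m)}. mix directions c (w' i) (w' (i + 1))) =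
      (\<Prod>k\<in>{1..<n}. mix directions c (w k) (w (Suc k)))"
  proof -
    have "nat (int (n - Suc m) - - int m + 1) = n" using n by linarith
    moreover have "w' (int k - 1 + - int m) = w k" "w' (int k - 1 + - int m + 1) = w (Suc k)" if "k \<in> {1..<n}" for k
      using wk[of k] wk[of "Suc k"] that by (auto simp: algebra_simps)
    ultimately show ?thesis
      unfolding prod_int_shift by (auto intro!: prod.cong)
  qed
  finally show "\<P>(\<omega> in M. \<forall>k\<in>{1..n}. V (int k - 1 - int m) \<omega> = w k) =
      1 / real (card (directions :: (real ^ 'd) set)) * (\<Prod>k\<in>{1..<n}. mix directions c (w k) (w (Suc k)))" .
qed

lemma label_fdd:
  fixes i :: "nat \<Rightarrow> int"
  assumes J: "J \<ge> 1" and i: "mono_on {1..J} i" and w: "w \<in> {1..J} \<rightarrow> directions"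
  shows "\<P>(\<omega> in M. \<forall>j\<in>{1..J}. V (i j) \<omega> = w j) =
    1 / real (card (directions :: (real ^ 'd) set)) *
      (\<Prod>j\<in>{1..<J}. mix directions (c ^ nat (i (Suc j) - i j)) (w j) (w (Suc j)))"
proof -
  \<comment> \<open>The shift brings the smallest index \<open>i 1\<close>, possibly negative, to a
    chain index of at least 1.\<close>
  define m where "m = nat (- i 1)"
  define k where "k j = nat (i j + 1 + int m)" for j
  have ge: "i j \<ge> - int m" if "j \<in> {1..J}" for j
    using mono_onD[OF i, of 1 j] that J by (auto simp: m_def)
  have ik: "int (k j) - 1 - int m = i j" if "j \<in> {1..J}" for j
    using ge[OF that] by (simp add: k_def)
  have "\<P>(\<omega> in M. \<forall>j\<in>{1..J}. V (int (k j) - 1 - int m) \<omega> = w j) =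
    1 / real (card (directions :: (real ^ 'd) set)) *
      (\<Prod>j\<in>{1..<J}. mix directions (\<Prod>l\<in>{k j..<k (Suc j)}. c) (w j) (w (Suc j)))"
  proof (rule chain_fdd[OF label_chain J _ _ w])
    show "1 \<le> k 1" using ge[of 1] J by (simp add: k_def)
    show "mono_on {1..J} k"
      using i unfolding mono_on_def k_def by (auto intro!: nat_mono)
  qed
  moreover have diff: "k (Suc j) - k j = nat (i (Suc j) - i j)" if "j \<in> {1..<J}" for j
    using ge[of j] ge[of "Suc j"] that by (simp add: k_def)
  moreover have "(\<forall>j\<in>{1..J}. V (int (k j) - 1 - int m) \<omega> = w j) \<longleftrightarrow> (\<forall>j\<in>{1..J}. V (i j) \<omega> = w j)" for \<omega>
    using ik by (intro ball_cong) auto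
  moreover have "(\<Prod>j\<in>{1..<J}. mix directions (\<Prod>l\<in>{k j..<k (Suc j)}. c) (w j) (w (Suc j))) =
      (\<Prod>j\<in>{1..<J}. mix directions (c ^ nat (i (Suc j) - i j)) (w j) (w (Suc j)))"
    by (rule prod.cong) (simp_all add: diff)
  ultimately show ?thesis by simp
qed

end

text \<open>Independence allows \<open>L\<close> to be frozen: on each of the countably many events
  \<open>L = u\<close> the probability of \<open>E u\<close> factors out. The sum over
  \<open>u\<close> is written as an integral over \<open>count_space\<close>, so that Tonelli
  exchanges it with the expectation.\<close>

lemma indep_countable_mixture:
  fixes L :: "'w \<Rightarrow> 'u::countable"
  assumes M: "prob_space M" and indep: "prob_space.indep_set M \<A> \<B>"
    and L: "\<And>u. L -` {u} \<inter> space M \<in> \<A>" and E: "\<And>u. E u \<in> \<B>"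
  shows "\<P>(\<omega> in M. \<omega> \<in> E (L \<omega>)) = (\<integral>\<omega>. measure M (E (L \<omega>)) \<partial>M)"
proof -
  interpret prob_space M by fact
  have ev: "L -` {u} \<inter> space M \<in> events" "E u \<in> events" for u
    using L[of u] E[of u] indep_setD_ev1[OF indep] indep_setD_ev2[OF indep] by auto
  let ?I = "\<lambda>u \<omega>. indicator (L -` {u} \<inter> space M) \<omega> :: ennreal"
  have sum: "(\<integral>\<^sup>+u. ?I u \<omega> * f u \<partial>count_space UNIV) = f (L \<omega>)" if "\<omega> \<in> space M" for \<omega> and f :: "'u \<Rightarrow> ennreal"
  proof -
    have "(\<integral>\<^sup>+u. ?I u \<omega> * f u \<partial>count_space UNIV) = (\<integral>\<^sup>+u. f u * indicator {L \<omega>} u \<partial>count_space UNIV)"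
      using that by (intro nn_integral_cong) (auto simp: indicator_def)
    also have "\<dots> = f (L \<omega>)" by (simp add: nn_integral_count_space_indicator[symmetric] nn_integral_count_space_finite)
    finally show ?thesis .
  qed
  have Lm: "L \<in> M \<rightarrow>\<^sub>M count_space UNIV"
    using ev by (simp add: measurable_count_space_eq2_countable)
  have set: "{\<omega> \<in> space M. \<omega> \<in> E (L \<omega>)} = (\<Union>u. (L -` {u} \<inter> space M) \<inter> E u)" by auto
  have evS: "{\<omega> \<in> space M. \<omega> \<in> E (L \<omega>)} \<in> events"
    unfolding set using ev by (intro sets.countable_UN'') auto
  have "emeasure M {\<omega> \<in> space M. \<omega> \<in> E (L \<omega>)} = (\<integral>\<^sup>+\<omega>. indicator {\<omega> \<in> space M. \<omega> \<in> E (L \<omega>)} \<omega> \<partial>M)"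
    by (rule nn_integral_indicator[symmetric, OF evS])
  also have "\<dots> = (\<integral>\<^sup>+\<omega>. indicator (E (L \<omega>)) \<omega> \<partial>M)"
    by (rule nn_integral_cong) (simp add: indicator_def)
  also have "\<dots> = (\<integral>\<^sup>+\<omega>. \<integral>\<^sup>+u. ?I u \<omega> * indicator (E u) \<omega> \<partial>count_space UNIV \<partial>M)"
    by (rule nn_integral_cong) (rule sum[symmetric])
  also have "\<dots> = (\<integral>\<^sup>+u. \<integral>\<^sup>+\<omega>. ?I u \<omega> * indicator (E u) \<omega> \<partial>M \<partial>count_space UNIV)"
    using ev by (intro nn_integral_count_space_nn_integral) auto
  also have "\<dots> = (\<integral>\<^sup>+u. \<integral>\<^sup>+\<omega>. ?I u \<omega> * emeasure M (E u) \<partial>M \<partial>count_space UNIV)"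
  proof (rule nn_integral_cong)
    fix u
    have "(\<integral>\<^sup>+\<omega>. ?I u \<omega> * indicator (E u) \<omega> \<partial>M) = emeasure M ((L -` {u} \<inter> space M) \<inter> E u)"
      using ev by (simp add: indicator_inter_arith[symmetric])
    also have "\<dots> = emeasure M (L -` {u} \<inter> space M) * emeasure M (E u)"
      using indep_setD[OF indep L E] by (simp add: emeasure_eq_measure ennreal_mult)
    also have "\<dots> = (\<integral>\<^sup>+\<omega>. ?I u \<omega> * emeasure M (E u) \<partial>M)"
      using ev by (simp add: nn_integral_multc)
    finally show "(\<integral>\<^sup>+\<omega>. ?I u \<omega> * indicator (E u) \<omega> \<partial>M) = (\<integral>\<^sup>+\<omega>. ?I u \<omega> * emeasure M (E u) \<partial>M)" .
  qed
  also have "\<dots> = (\<integral>\<^sup>+\<omega>. \<integral>\<^sup>+u. ?I u \<omega> * emeasure M (E u) \<partial>count_space UNIV \<partial>M)"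
    using ev by (intro nn_integral_count_space_nn_integral[symmetric]) auto
  also have "\<dots> = (\<integral>\<^sup>+\<omega>. ennreal (prob (E (L \<omega>))) \<partial>M)"
    unfolding emeasure_eq_measure[of "E _"] by (rule nn_integral_cong) (rule sum)
  also have "\<dots> = ennreal (\<integral>\<omega>. prob (E (L \<omega>)) \<partial>M)"
  proof (rule nn_integral_eq_integral)
    show "integrable M (\<lambda>\<omega>. prob (E (L \<omega>)))"
      by (rule integrable_const_bound[of _ 1]) (auto intro: measurable_compose[OF Lm])
  qed auto
  finally show ?thesis
    by (simp add: emeasure_eq_measure integral_nonneg_AE)
qed

section \<open>The intensity b / x\<close>

lemma emeasure_zigzag_intensity:
  assumes b: "b \<ge> 0" and st: "0 < s" "s \<le> t"
  shows "emeasure (zigzag_intensity b) {s<..t} = ennreal (b * ln (t / s))"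
proof -
  have set: "{s<..t} \<in> sets (restrict_space lborel {0<..})"
    using st by (auto simp: sets_restrict_space intro!: image_eqI[of _ _ "{s<..t}"])
  have "emeasure (zigzag_intensity b) {s<..t} =
      (\<integral>\<^sup>+x. ennreal (b / x) * indicator {s<..t} x \<partial>restrict_space lborel {0<..})"
    unfolding zigzag_intensity_def using set
    by (intro emeasure_density) (auto intro!: measurable_restrict_space1)
  also have "\<dots> = (\<integral>\<^sup>+x. ennreal (b / x) * indicator {s<..t} x * indicator {0<..} x \<partial>lborel)"
    by (intro nn_integral_restrict_space) auto
  also have "\<dots> = (\<integral>\<^sup>+x. ennreal (b / x) * indicator {s..t} x \<partial>lborel)"
  proof (rule nn_integral_cong_AE)
    show "AE x in lborel. ennreal (b / x) * indicator {s<..t} x * indicator {0<..} x = ennreal (b / x) * indicator {s..t} x"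
      using AE_lborel_singleton[of s] by eventually_elim (use st in \<open>auto simp: indicator_def\<close>)
  qed
  also have "\<dots> = ennreal (b * ln t - b * ln s)"
    using b st by (intro nn_integral_FTC_Icc) (auto intro!: derivative_eq_intros simp: field_simps)
  also have "b * ln t - b * ln s = b * ln (t / s)"
    using st by (simp add: ln_div algebra_simps)
  finally show ?thesis .
qed

lemma sets_zigzag_intensity: "sets (zigzag_intensity b) = {B. B \<in> sets borel \<and> B \<subseteq> {0<..}}"
  unfolding zigzag_intensity_def by (auto simp: sets_restrict_space)

lemma space_zigzag_intensity: "space (zigzag_intensity b) = {0<..}"
  unfolding zigzag_intensity_def by (simp add: space_restrict_space)

section \<open>The point process\<close>

lemma card_eq_point_count:
  "card (P \<omega> \<inter> B) = (case point_count P B \<omega> of enat k \<Rightarrow> k | \<infinity> \<Rightarrow> 0)"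
  by (simp add: point_count_def)

lemma point_count_eq_0_iff: "point_count P B \<omega> = 0 \<longleftrightarrow> P \<omega> \<inter> B = {}"
  by (auto simp: point_count_def zero_enat_def)

lemma point_count_eq_infinity_iff: "point_count P B \<omega> = \<infinity> \<longleftrightarrow> \<not> finite (P \<omega> \<inter> B)"
  by (simp add: point_count_def)

lemma measurable_card_points:
  assumes "point_count P B \<in> M \<rightarrow>\<^sub>M count_space UNIV"
  shows "(\<lambda>\<omega>. card (P \<omega> \<inter> B)) \<in> M \<rightarrow>\<^sub>M count_space UNIV"
  unfolding card_eq_point_count by (rule measurable_compose[OF assms]) simp

lemma measurable_binary_discrete:
  fixes f :: "'w \<Rightarrow> 'u::countable" and g :: "'w \<Rightarrow> 'x"
  assumes f: "f \<in> M \<rightarrow>\<^sub>M count_space UNIV" and g: "g \<in> M \<rightarrow>\<^sub>M count_space UNIV"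
  shows "(\<lambda>x. q (f x) (g x)) \<in> M \<rightarrow>\<^sub>M count_space UNIV"
  by (rule measurable_compose_countable[OF _ f]) (rule measurable_compose[OF g], simp)

lemma emeasure_zigzag_intensity_infinite:
  assumes b: "b > 0" and B: "B \<in> sets (zigzag_intensity b)"
    and sub: "\<And>r. r \<ge> 0 \<Longrightarrow> \<exists>s t. 0 < s \<and> s \<le> t \<and> {s<..t} \<subseteq> B \<and> ln (t / s) \<ge> r"
  shows "emeasure (zigzag_intensity b) B = \<infinity>"
proof (cases "emeasure (zigzag_intensity b) B")
  case (real r)
  obtain s t where st: "0 < s" "s \<le> t" "{s<..t} \<subseteq> B" "ln (t / s) \<ge> (r + 1) / b"
    using sub[of "(r + 1) / b"] real b by auto
  have "r + 1 \<le> b * ln (t / s)" using st(4) b by (simp add: field_simps)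
  then have "ennreal (r + 1) \<le> emeasure (zigzag_intensity b) {s<..t}"
    using emeasure_zigzag_intensity[of b s t] st b by (simp add: ennreal_leI)
  also have "\<dots> \<le> emeasure (zigzag_intensity b) B"
    using st(3) B by (rule emeasure_mono)
  finally show ?thesis using real by simp
qed simp

text \<open>Regularity quantifies over all compact sets and all reals; countably many conditions on
  counts replace these here, which makes it an event. The intervals from \<open>1 / Suc n\<close> to
  \<open>Suc n\<close> exhaust \<open>{0<..}\<close>.\<close>

lemma regular_points_iff:
  assumes "A \<subseteq> {0<..}"
  shows "regular_points A \<longleftrightarrow>
    (\<forall>n::nat. finite (A \<inter> {1 / real (Suc n)<..real (Suc n)})) \<and>
    (\<forall>n::nat. A \<inter> {0<..<1 / real (Suc n)} \<noteq> {}) \<and> (\<forall>n::nat. A \<inter> {real n<..} \<noteq> {})"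
    (is "_ \<longleftrightarrow> ?F \<and> ?Z \<and> ?I")
proof
  assume A: "regular_points A"
  show "?F \<and> ?Z \<and> ?I"
  proof (intro conjI allI)
    fix n
    show "finite (A \<inter> {1 / real (Suc n)<..real (Suc n)})"
      by (rule finite_subset[OF _ regular_points_finite[OF A, of "1 / real (Suc n)" "real (Suc n)"]]) auto
    have "1 / real (Suc n) > 0" by simp
    then obtain y where "y \<in> A" "y < 1 / real (Suc n)"
      using A unfolding regular_points_def by blast
    moreover have "y > 0" using \<open>y \<in> A\<close> assms by auto
    ultimately show "A \<inter> {0<..<1 / real (Suc n)} \<noteq> {}" by (metis IntI empty_iff greaterThanLessThan_iff)
    obtain y where "y \<in> A" "real n < y" using A unfolding regular_points_def by blast
    then show "A \<inter> {real n<..} \<noteq> {}" by auto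
  qed
next
  assume "?F \<and> ?Z \<and> ?I"
  then have F: ?F and Z: ?Z and I: ?I by auto
  show "regular_points A"
    unfolding regular_points_def
  proof (intro conjI allI impI assms)
    fix K :: "real set" assume K: "compact K \<and> K \<subseteq> {0<..}"
    show "finite (A \<inter> K)"
    proof (cases "K = {}")
      case False
      obtain m where m: "m \<in> K" "\<And>x. x \<in> K \<Longrightarrow> m \<le> x" using compact_attains_inf K False by metis
      obtain q where q: "q \<in> K" "\<And>x. x \<in> K \<Longrightarrow> x \<le> q" using compact_attains_sup K False by metis
      have "m > 0" using m(1) K by auto
      then obtain n1 where n1: "1 / real (Suc n1) < m" using nat_approx_posE by blast
      define n where "n = max n1 (nat \<lceil>q\<rceil>)"
      have "1 / real (Suc n) \<le> 1 / real (Suc n1)" unfolding n_def by (intro divide_left_mono) auto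
      moreover have "q \<le> real (Suc n)" unfolding n_def by linarith
      ultimately have "K \<subseteq> {1 / real (Suc n)<..real (Suc n)}" using m q n1 by force
      then show ?thesis using F by (meson finite_subset Int_mono order_refl)
    qed simp
  next
    fix x :: real assume "x > 0"
    then obtain n where "1 / real (Suc n) < x" using nat_approx_posE by blast
    moreover obtain y where y: "y \<in> A" "y < 1 / real (Suc n)" using Z by force
    ultimately have "y < x" by linarith
    then show "\<exists>y\<in>A. y < x" using y(1) by blast
  next
    fix x :: real
    have "x \<le> real (nat \<lceil>x\<rceil>)" by linarith
    moreover obtain y where y: "y \<in> A" "real (nat \<lceil>x\<rceil>) < y" using I by force
    ultimately have "x < y" by linarith
    then show "\<exists>y\<in>A. x < y" using y(1) by blast
  qed
qed

section \<open>Counts of the Poisson process and almost sure regularity\<close>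

context
  fixes N :: "'v measure" and b :: real and P :: "'v \<Rightarrow> real set"
  assumes ppp: "poisson_point_process N (zigzag_intensity b) P" and b: "b > 0"
begin

interpretation prob_space N
  using ppp by (simp add: poisson_point_process_def)

lemma points_positive: "\<omega> \<in> space N \<Longrightarrow> P \<omega> \<subseteq> {0<..}"
  using ppp by (simp add: poisson_point_process_def space_zigzag_intensity)

lemma point_count_measurable:
  "B \<in> sets borel \<Longrightarrow> B \<subseteq> {0<..} \<Longrightarrow> point_count P B \<in> N \<rightarrow>\<^sub>M count_space UNIV"
  using ppp by (simp add: poisson_point_process_def sets_zigzag_intensity)

lemma point_count_event:
  "B \<in> sets borel \<Longrightarrow> B \<subseteq> {0<..} \<Longrightarrow> {\<omega> \<in> space N. point_count P B \<omega> \<in> Q} \<in> events"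
  using measurable_sets[OF point_count_measurable, of B Q] by (simp add: vimage_def Int_def conj_commute)

lemma point_count_poisson:
  assumes "0 < s" "s \<le> t"
  shows "\<P>(\<omega> in N. point_count P {s<..t} \<omega> = enat k) =
    exp (- (b * ln (t / s))) * (b * ln (t / s)) ^ k / fact k"
proof -
  have B: "{s<..t} \<in> sets (zigzag_intensity b)" using assms by (auto simp: sets_zigzag_intensity)
  have e: "emeasure (zigzag_intensity b) {s<..t} = ennreal (b * ln (t / s))"
    using emeasure_zigzag_intensity[of b s t] b assms by simp
  have "0 \<le> b * ln (t / s)" using b assms by simp
  then have m: "measure (zigzag_intensity b) {s<..t} = b * ln (t / s)"
    using e by (simp add: measure_def)
  show ?thesis
    using ppp B e unfolding poisson_point_process_def m[symmetric] by simp
qed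

text \<open>The Poisson weights already sum to 1, so no mass is left for the value
  \<open>\<infinity>\<close>.\<close>

lemma AE_finite_points:
  assumes st: "0 < s" "s \<le> t"
  shows "AE \<omega> in N. point_count P {s<..t} \<omega> \<noteq> \<infinity>"
proof -
  define l where "l = b * ln (t / s)"
  let ?A = "\<lambda>k. {\<omega> \<in> space N. point_count P {s<..t} \<omega> = enat k}"
  have "{s<..t} \<subseteq> {0<..}" using st by auto
  then have ev: "?A k \<in> events" for k
    using point_count_event[of "{s<..t}" "{enat k}"] by simp
  have "(\<lambda>k. prob (?A k)) sums prob (\<Union>k. ?A k)"
    by (rule finite_measure_UNION) (use ev in \<open>auto simp: disjoint_family_on_def\<close>)
  moreover have "(\<lambda>k. exp (- l) * (l ^ k /\<^sub>R fact k)) sums (exp (- l) * exp l)"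
    by (intro sums_mult exp_converges)
  then have "(\<lambda>k. prob (?A k)) sums 1"
    unfolding point_count_poisson[OF st] l_def[symmetric] by (simp add: exp_minus divide_inverse mult_ac)
  ultimately have "prob (\<Union>k. ?A k) = 1" by (rule sums_unique2)
  then have "AE \<omega> in N. \<omega> \<in> (\<Union>k. ?A k)"
    using ev by (subst (asm) prob_eq_1) auto
  then show ?thesis by eventually_elim auto
qed

text \<open>The generating function of the Poisson law: a Poisson number of label transitions acts,
  on average, like one matrix \<open>mix\<close> with parameter
  \<open>exp (\<lambda> (c - 1))\<close>. Infinite sets, whose \<open>card\<close> is 0, occur with
  probability 0.\<close>

lemma expectation_power_card:
  assumes st: "0 < s" "s \<le> t" and c: "\<bar>c\<bar> \<le> 1"
  shows "(\<integral>\<omega>. c ^ card (P \<omega> \<inter> {s<..t}) \<partial>N) = exp (b * ln (t / s) * (c - 1))"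
proof -
  define l where "l = b * ln (t / s)"
  have l: "l \<ge> 0" unfolding l_def using b st by simp
  let ?A = "\<lambda>k. {\<omega> \<in> space N. point_count P {s<..t} \<omega> = enat k}"
  have "{s<..t} \<subseteq> {0<..}" using st by auto
  then have ev: "?A k \<in> events" for k
    using point_count_event[of "{s<..t}" "{enat k}"] by simp
  have pA: "prob (?A k) = exp (- l) * l ^ k / fact k" for k
    unfolding l_def by (rule point_count_poisson[OF st])
  \<comment> \<open>Used at \<open>c\<close> for the value and at \<open>\<bar>c\<bar>\<close> for
    the absolute summability that justifies exchanging sum and integral; \<open>c\<close> is
    negative in the application.\<close>
  have sums_c: "(\<lambda>k. x ^ k * prob (?A k)) sums (exp (- l) * exp (x * l))" for x
  proof -
    have "(\<lambda>k. exp (- l) * ((x * l) ^ k /\<^sub>R fact k)) sums (exp (- l) * exp (x * l))"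
      by (intro sums_mult exp_converges)
    then show ?thesis unfolding pA by (simp add: power_mult_distrib divide_inverse mult_ac)
  qed
  have "(\<integral>\<omega>. c ^ card (P \<omega> \<inter> {s<..t}) \<partial>N) = (\<integral>\<omega>. (\<Sum>k. c ^ k * indicator (?A k) \<omega>) \<partial>N)"
  proof (rule integral_cong_AE)
    have "(\<lambda>\<omega>. card (P \<omega> \<inter> {s<..t})) \<in> N \<rightarrow>\<^sub>M count_space UNIV"
      using st by (intro measurable_card_points point_count_measurable) auto
    from measurable_compose[OF this, of "\<lambda>k. c ^ k" borel]
    show "(\<lambda>\<omega>. c ^ card (P \<omega> \<inter> {s<..t})) \<in> borel_measurable N" by simp
    show "(\<lambda>\<omega>. \<Sum>k. c ^ k * indicator (?A k) \<omega>) \<in> borel_measurable N"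
      using ev by (intro borel_measurable_suminf borel_measurable_times borel_measurable_const borel_measurable_indicator)
    show "AE \<omega> in N. c ^ card (P \<omega> \<inter> {s<..t}) = (\<Sum>k. c ^ k * indicator (?A k) \<omega>)"
      using AE_finite_points[OF st] AE_space
    proof eventually_elim
      case (elim \<omega>)
      then obtain k where k: "point_count P {s<..t} \<omega> = enat k" by auto
      then have "card (P \<omega> \<inter> {s<..t}) = k" by (simp add: card_eq_point_count)
      moreover have "(\<lambda>i. c ^ i * indicator (?A i) \<omega> :: real) = (\<lambda>i. if i = k then c ^ k else 0)"
        using k elim by (auto simp: indicator_def fun_eq_iff)
      then have "(\<Sum>i. c ^ i * indicator (?A i) \<omega>) = c ^ k"
        using sums_single[of k "\<lambda>_. c ^ k"] by (simp add: sums_iff)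
      ultimately show ?case by simp
    qed
  qed
  also have "\<dots> = (\<Sum>k. \<integral>\<omega>. c ^ k * indicator (?A k) \<omega> \<partial>N)"
  proof (rule integral_suminf)
    show "integrable N (\<lambda>\<omega>. c ^ k * indicator (?A k) \<omega>)" for k
      using ev by (intro integrable_mult_right integrable_real_indicator) (auto simp: emeasure_eq_measure)
    show "AE \<omega> in N. summable (\<lambda>k. norm (c ^ k * indicator (?A k) \<omega>))"
    proof (rule AE_I2)
      fix \<omega>
      show "summable (\<lambda>k. norm (c ^ k * indicator (?A k) \<omega>))"
      proof (rule summable_finite[of "{the_enat (point_count P {s<..t} \<omega>)}"])
        fix k assume k: "k \<notin> {the_enat (point_count P {s<..t} \<omega>)}"
        have "\<omega> \<notin> ?A k" using k by auto
        then have "indicator (?A k) \<omega> = (0::real)" by (rule indicator_simps)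
        then show "norm (c ^ k * indicator (?A k) \<omega>) = 0" by simp
      qed simp
    qed
    have "(\<integral>\<omega>. norm (c ^ k * indicator (?A k) \<omega>) \<partial>N) = \<bar>c\<bar> ^ k * prob (?A k)" for k
    proof -
      have "(\<integral>\<omega>. norm (c ^ k * indicator (?A k) \<omega>) \<partial>N) = (\<integral>\<omega>. \<bar>c\<bar> ^ k * indicator (?A k) \<omega> \<partial>N)"
        by (intro Bochner_Integration.integral_cong) (auto simp: abs_mult power_abs)
      also have "\<dots> = \<bar>c\<bar> ^ k * prob (?A k)"
        using ev[of k] by (simp add: Int_absorb2 sets.sets_into_space)
      finally show ?thesis .
    qed
    then show "summable (\<lambda>k. \<integral>\<omega>. norm (c ^ k * indicator (?A k) \<omega>) \<partial>N)"
      using sums_c[of "\<bar>c\<bar>"] by (simp only: sums_iff)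
  qed
  also have "(\<lambda>k. \<integral>\<omega>. c ^ k * indicator (?A k) \<omega> \<partial>N) = (\<lambda>k. c ^ k * prob (?A k))"
    using ev by (intro ext) (simp add: Int_absorb2 sets.sets_into_space)
  also have "suminf \<dots> = exp (- l) * exp (c * l)"
    using sums_c[of c] by (simp only: sums_iff)
  also have "\<dots> = exp (l * (c - 1))"
    by (simp add: exp_add[symmetric] algebra_simps)
  finally show ?thesis unfolding l_def .
qed

lemma prob_some_point:
  assumes st: "0 < s" "s \<le> t"
  shows "\<P>(\<omega> in N. point_count P {s<..t} \<omega> \<noteq> 0) \<le> b * ln (t / s)"
proof -
  have "{s<..t} \<subseteq> {0<..}" using st by auto
  then have "{\<omega> \<in> space N. point_count P {s<..t} \<omega> = enat 0} \<in> events"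
    using point_count_event[of "{s<..t}" "{enat 0}"] by simp
  from prob_neg[OF this]
  have "\<P>(\<omega> in N. point_count P {s<..t} \<omega> \<noteq> enat 0) = 1 - exp (- (b * ln (t / s)))"
    unfolding point_count_poisson[OF st] by simp
  also have "\<dots> \<le> b * ln (t / s)"
    using exp_ge_add_one_self[of "- (b * ln (t / s))"] by simp
  finally show ?thesis by (simp add: zero_enat_def)
qed

lemma AE_infinite_points:
  assumes "B \<in> sets borel" "B \<subseteq> {0<..}"
    and "\<And>r. r \<ge> 0 \<Longrightarrow> \<exists>s t. 0 < s \<and> s \<le> t \<and> {s<..t} \<subseteq> B \<and> ln (t / s) \<ge> r"
  shows "AE \<omega> in N. point_count P B \<omega> = \<infinity>"
proof -
  have B: "B \<in> sets (zigzag_intensity b)" using assms by (simp add: sets_zigzag_intensity)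
  then have "emeasure (zigzag_intensity b) B = \<infinity>"
    using assms(3) b by (intro emeasure_zigzag_intensity_infinite) auto
  then show ?thesis using ppp B unfolding poisson_point_process_def by blast
qed

lemma regular_points_event: "{\<omega> \<in> space N. regular_points (P \<omega>)} \<in> events"
proof -
  have "{\<omega> \<in> space N. regular_points (P \<omega>)} =
    {\<omega> \<in> space N. (\<forall>n. point_count P {1 / real (Suc n)<..real (Suc n)} \<omega> \<in> - {\<infinity>}) \<and>
      (\<forall>n. point_count P {0<..<1 / real (Suc n)} \<omega> \<in> - {0}) \<and> (\<forall>n. point_count P {real n<..} \<omega> \<in> - {0})}"
  proof (rule Collect_cong, rule conj_cong[OF refl])
    fix \<omega> assume "\<omega> \<in> space N"
    from regular_points_iff[OF points_positive[OF this]]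
    show "regular_points (P \<omega>) \<longleftrightarrow>
      (\<forall>n. point_count P {1 / real (Suc n)<..real (Suc n)} \<omega> \<in> - {\<infinity>}) \<and>
      (\<forall>n. point_count P {0<..<1 / real (Suc n)} \<omega> \<in> - {0}) \<and> (\<forall>n. point_count P {real n<..} \<omega> \<in> - {0})"
      by (simp only: point_count_eq_0_iff point_count_eq_infinity_iff Compl_iff singleton_iff not_not)
  qed
  also have "\<dots> \<in> events"
  proof (intro sets.sets_Collect_conj sets.sets_Collect_countable_All point_count_event)
    fix n
    have "0 < 1 / real (Suc n)" by simp
    then show "{1 / real (Suc n)<..real (Suc n)} \<subseteq> {0<..}"
      by (metis greaterThanAtMost_iff greaterThan_iff less_trans subsetI)
    have "0 \<le> real n" by simp
    then show "{real n<..} \<subseteq> {0<..}"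
      by (metis greaterThan_iff le_less_trans subsetI)
  qed auto
  finally show ?thesis .
qed

text \<open>The mass of \<open>b / x\<close> diverges logarithmically at 0 and at infinity, which
  forces infinitely many points at either end, while it is finite on bounded intervals away from
  0.\<close>

lemma AE_regular_points: "AE \<omega> in N. regular_points (P \<omega>)"
proof -
  have 1: "AE \<omega> in N. \<forall>n. point_count P {1 / real (Suc n)<..real (Suc n)} \<omega> \<noteq> \<infinity>"
    unfolding AE_all_countable
  proof
    fix n
    show "AE \<omega> in N. point_count P {1 / real (Suc n)<..real (Suc n)} \<omega> \<noteq> \<infinity>"
    proof (rule AE_finite_points)
      have "1 / real (Suc n) \<le> 1" by simp
      then show "1 / real (Suc n) \<le> real (Suc n)" by linarith
    qed simp
  qed
  have 2: "AE \<omega> in N. \<forall>n. point_count P {0<..<1 / real (Suc n)} \<omega> = \<infinity>"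
    unfolding AE_all_countable
  proof
    fix n
    show "AE \<omega> in N. point_count P {0<..<1 / real (Suc n)} \<omega> = \<infinity>"
    proof (rule AE_infinite_points)
      fix r :: real assume r: "r \<ge> 0"
      \<comment> \<open>With \<open>x\<close> inside the interval, the pair
        \<open>x * exp (- r)\<close> and \<open>x\<close> has ratio \<open>exp r\<close> and stays
        below \<open>1 / Suc n\<close>.\<close>
      define x where "x = 1 / real (Suc n) / 2"
      have x: "x > 0" "x < 1 / real (Suc n)" by (auto simp: x_def field_simps)
      have eq: "x / (x * exp (- r)) = exp r" using x by (simp add: exp_minus field_simps)
      show "\<exists>s t. 0 < s \<and> s \<le> t \<and> {s<..t} \<subseteq> {0<..<1 / real (Suc n)} \<and> ln (t / s) \<ge> r"
      proof (intro exI conjI)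
        show pos: "0 < x * exp (- r)" using x by simp
        show "x * exp (- r) \<le> x" using x r by simp
        show "{x * exp (- r)<..x} \<subseteq> {0<..<1 / real (Suc n)}"
          using x(2) pos by (intro subsetI) (simp del: of_nat_Suc add: less_trans[OF pos] le_less_trans)
        show "r \<le> ln (x / (x * exp (- r)))" unfolding eq by simp
      qed
    qed auto
  qed
  have 3: "AE \<omega> in N. \<forall>n. point_count P {real n<..} \<omega> = \<infinity>"
    unfolding AE_all_countable
  proof
    fix n
    show "AE \<omega> in N. point_count P {real n<..} \<omega> = \<infinity>"
    proof (rule AE_infinite_points)
      fix r :: real assume "r \<ge> 0"
      then show "\<exists>s t. 0 < s \<and> s \<le> t \<and> {s<..t} \<subseteq> {real n<..} \<and> ln (t / s) \<ge> r"
        by (intro exI[of _ "real (Suc n)"] exI[of _ "real (Suc n) * exp r"]) auto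
    qed auto
  qed
  from 1 2 3 AE_space show ?thesis
  proof eventually_elim
    case (elim \<omega>)
    have inf: "P \<omega> \<inter> B \<noteq> {}" if "point_count P B \<omega> = \<infinity>" for B
      using that by (auto simp: point_count_def split: if_splits)
    show ?case
      unfolding regular_points_iff[OF points_positive[OF elim(4)]]
    proof (intro conjI allI)
      show "finite (P \<omega> \<inter> {1 / real (Suc n)<..real (Suc n)})" for n
        using elim(1) by (simp only: point_count_eq_infinity_iff not_not)
      show "P \<omega> \<inter> {0<..<1 / real (Suc n)} \<noteq> {}" for n
        using elim(2) by (intro inf) blast
      show "P \<omega> \<inter> {real n<..} \<noteq> {}" for n
        using elim(3) by (intro inf) blast
    qed
  qed
qed

end

text \<open>For \<open>j \<ge> 1\<close> and regular points, the number of the zigzag interval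
  containing \<open>j * h\<close>: the signed count of points between 1 and \<open>h\<close>, where
  one of the two sets is empty, plus the points of cells 1 to \<open>j - 1\<close>. Written with
  counts, it is measurable for the point process alone, and its increments are counts over disjoint
  cells.\<close>

definition grid_index :: "('v \<Rightarrow> real set) \<Rightarrow> real \<Rightarrow> nat \<Rightarrow> 'v \<Rightarrow> int" where
  "grid_index P h j \<omega> = int (card (P \<omega> \<inter> {1<..h})) - int (card (P \<omega> \<inter> {h<..1}))
     + (\<Sum>l\<in>{1..<j}. int (card (P \<omega> \<inter> {real l * h<..real (Suc l) * h})))"

lemma grid_index_Suc:
  "j \<ge> 1 \<Longrightarrow> grid_index P h (Suc j) \<omega> = grid_index P h j \<omega> + int (card (P \<omega> \<inter> {real j * h<..real (Suc j) * h}))"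
  unfolding grid_index_def by (simp add: sum.op_ivl_Suc)

lemma grid_index_mono:
  assumes "1 \<le> i" "i \<le> j"
  shows "grid_index P h i \<omega> \<le> grid_index P h j \<omega>"
  using assms(2)
proof (induction j rule: dec_induct)
  case (step j)
  then show ?case using grid_index_Suc[of j P h \<omega>] assms(1) by simp
qed simp

lemma grid_index_locate:
  assumes A: "regular_points (P \<omega>)" and h: "h > 0" and j: "j \<ge> 1"
  shows "turning_time (P \<omega>) (grid_index P h j \<omega>) \<le> real j * h \<and>
    real j * h < turning_time (P \<omega>) (grid_index P h j \<omega> + 1)"
  using j
proof (induction j rule: dec_induct)
  case base
  note T = turning_time[OF A]
  obtain i where i: "turning_time (P \<omega>) i \<le> h" "h < turning_time (P \<omega>) (i + 1)"
    using locate_in_enumeration[OF A T(1) _ h] T(2) by blast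
  have T1: "1 < turning_time (P \<omega>) (0 + 1)" using T(4) by simp
  have "grid_index P h 1 \<omega> = i"
    unfolding grid_index_def
    using card_points_between[OF A T(3) T1 i] card_points_between[OF A i T(3) T1] by simp
  then show ?case using i by simp
next
  case (step j)
  note T = turning_time[OF A]
  have pos: "real (Suc j) * h > 0" using h by simp
  obtain i where i: "turning_time (P \<omega>) i \<le> real (Suc j) * h" "real (Suc j) * h < turning_time (P \<omega>) (i + 1)"
    using locate_in_enumeration[OF A T(1) _ pos] T(2) by blast
  let ?k = "grid_index P h j \<omega>"
  have "real j * h \<le> real (Suc j) * h" using h by simp
  then have "turning_time (P \<omega>) ?k < turning_time (P \<omega>) (i + 1)" using step.IH i by linarith
  then have "?k \<le> i" using T(1) by (simp add: strict_mono_less)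
  then have "grid_index P h (Suc j) \<omega> = i"
    using grid_index_Suc[OF step.hyps(1), of P h \<omega>] card_points_between[OF A _ _ i, of ?k "real j * h"] step.IH by simp
  then show ?case using i by simp
qed

text \<open>\<open>M\<close> is left open because the lemma is applied both to \<open>N\<close> and
  to the \<sigma>-algebra generated by the counts, where it gives access to independence from the
  labels.\<close>

lemma measurable_grid_index:
  assumes h: "h > 0" and pc: "\<And>B. B \<in> sets borel \<Longrightarrow> B \<subseteq> {0<..} \<Longrightarrow> point_count P B \<in> M \<rightarrow>\<^sub>M count_space UNIV"
  shows "grid_index P h j \<in> M \<rightarrow>\<^sub>M count_space UNIV"
proof -
  have c: "(\<lambda>\<omega>. card (P \<omega> \<inter> {s<..t})) \<in> M \<rightarrow>\<^sub>M count_space UNIV" if "0 \<le> s" for s t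
    using that by (intro measurable_card_points pc) auto
  have "(\<lambda>\<omega>. \<Sum>l\<in>{1..<j}. int (card (P \<omega> \<inter> {real l * h<..real (Suc l) * h}))) \<in> M \<rightarrow>\<^sub>M count_space UNIV"
  proof (induction j)
    case (Suc j)
    show ?case
    proof (cases "j \<ge> 1")
      case True
      have "(\<lambda>\<omega>. card (P \<omega> \<inter> {real j * h<..real (Suc j) * h})) \<in> M \<rightarrow>\<^sub>M count_space UNIV"
        using h by (intro c) auto
      from measurable_binary_discrete[OF Suc.IH this, of "\<lambda>x y. x + int y"]
      show ?thesis using True by (simp add: sum.op_ivl_Suc)
    qed simp
  qed simp
  from measurable_binary_discrete[OF measurable_binary_discrete[OF c[of 1 h] c[of h 1], of "\<lambda>x y. int x - int y"] this,
      of "\<lambda>x y. x + y"]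
  show ?thesis unfolding grid_index_def using h by simp
qed

section \<open>Convergence to the zigzag process\<close>

lemma measurable_map_discrete:
  fixes f :: "'j \<Rightarrow> 'w \<Rightarrow> 'u::countable"
  assumes "\<And>j. f j \<in> M \<rightarrow>\<^sub>M count_space UNIV"
  shows "(\<lambda>\<omega>. map (\<lambda>j. f j \<omega>) xs) \<in> M \<rightarrow>\<^sub>M count_space UNIV"
proof (induction xs)
  case (Cons x xs)
  from measurable_binary_discrete[OF assms[of x] this, of "(#)"] show ?case by simp
qed simp

text \<open>Being affine in \<open>q\<close>, \<open>mix\<close> commutes with expectation.\<close>

lemma mix_affine: "mix S q x y = q * ((if x = y then 1 else 0) - 1 / real (card S)) + 1 / real (card S)"
  by (simp add: mix_def algebra_simps diff_divide_distrib)

context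
  fixes N :: "'v measure" and a b :: real and P :: "'v \<Rightarrow> real set" and V :: "int \<Rightarrow> 'v \<Rightarrow> real ^ 'd"
  assumes data: "zigzag_data N b P V" and d: "CARD('d) \<ge> 2" and a: "a > 0"
    and b_def: "b = (2 * real CARD('d) - 1) * a / (2 * real CARD('d))"
begin

interpretation prob_space N
  using data by (simp add: zigzag_data_def)

lemma rate_bounds: "b > 0" "b \<le> a"
proof -
  show "b > 0" unfolding b_def using a d by simp
  have "(2 * real CARD('d) - 1) * a \<le> a * (2 * real CARD('d))" using a by (simp add: algebra_simps)
  then show "b \<le> a" unfolding b_def using d by (simp add: divide_le_eq)
qed

lemma points_of_data: "poisson_point_process N (zigzag_intensity b) P" and labels_of_data: "zigzag_labels N V"
  using data by (simp_all add: zigzag_data_def)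

definition grid_slope :: "real \<Rightarrow> nat \<Rightarrow> 'v \<Rightarrow> real ^ 'd" where
  "grid_slope h j \<omega> = V (grid_index P h j \<omega>) \<omega>"

lemma grid_slope_measurable:
  assumes "h > 0"
  shows "grid_slope h j \<in> N \<rightarrow>\<^sub>M count_space directions"
  unfolding grid_slope_def
  by (rule measurable_compose_countable[OF label_measurable[OF labels_of_data d]
        measurable_grid_index[OF assms point_count_measurable[OF points_of_data rate_bounds(1)]]])

lemma norm_label: "\<omega> \<in> space N \<Longrightarrow> norm (V i \<omega>) \<le> 1"
  using norm_directions[OF measurable_space[OF label_measurable[OF labels_of_data d], simplified]] by simp

lemma zigzag_in_lip_paths: "\<omega> \<in> space N \<Longrightarrow> zigzag_path (P \<omega>) (\<lambda>i. V i \<omega>) \<in> lip_paths"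
  using norm_label by (intro zigzag_path_in_lip_paths)

text \<open>Grid paths whose slopes are the directions at grid times depend on finitely many
  discrete variables, and they converge locally uniformly when the points are regular.\<close>

lemma zigzag_measurable: "(\<lambda>\<omega>. zigzag_path (P \<omega>) (\<lambda>i. V i \<omega>)) \<in> N \<rightarrow>\<^sub>M borel_of cpath_topology"
proof (rule measurable_cpath_limit)
  \<comment> \<open>On irregular point sets the approximants are the zero path, in agreement with
    \<open>zigzag_path\<close>; \<open>Suc k\<close> keeps the mesh positive.\<close>
  define Xk where "Xk k \<omega> = (if regular_points (P \<omega>)
    then grid_path (1 / real (Suc k)) (Suc k * Suc k) (\<lambda>j. grid_slope (1 / real (Suc k)) j \<omega>)
    else (\<lambda>t\<in>{0..}. 0))" for k \<omega>
  show "zigzag_path (P \<omega>) (\<lambda>i. V i \<omega>) \<in> cpaths" if "\<omega> \<in> space N" for \<omega>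
    using zigzag_in_lip_paths[OF that] lip_paths_subset_cpaths by blast
  show "Xk k \<in> N \<rightarrow>\<^sub>M count_space UNIV" for k
    unfolding Xk_def
  proof (rule measurable_If)
    show "(\<lambda>\<omega>. grid_path (1 / real (Suc k)) (Suc k * Suc k) (\<lambda>j. grid_slope (1 / real (Suc k)) j \<omega>)) \<in> N \<rightarrow>\<^sub>M count_space UNIV"
      by (rule measurable_grid_path[OF finite_directions grid_slope_measurable]) simp
    show "{\<omega> \<in> space N. regular_points (P \<omega>)} \<in> events"
      by (rule regular_points_event[OF points_of_data rate_bounds(1)])
  qed simp
  show "Xk k \<omega> \<in> cpaths" if "\<omega> \<in> space N" for k \<omega>
  proof -
    have "grid_path (1 / real (Suc k)) (Suc k * Suc k) (\<lambda>j. grid_slope (1 / real (Suc k)) j \<omega>) \<in> lip_paths"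
      using norm_label[OF that] by (intro grid_path_in_lip_paths) (auto simp: grid_slope_def)
    moreover have "(\<lambda>t\<in>{0..}. 0 :: real ^ 'd) \<in> lip_paths" by (auto simp: lip_paths_def)
    ultimately show ?thesis using lip_paths_subset_cpaths by (auto simp: Xk_def)
  qed
  show "\<forall>\<^sub>F k in sequentially. \<forall>t\<in>{0..T}. dist (Xk k \<omega> t) (zigzag_path (P \<omega>) (\<lambda>i. V i \<omega>) t) < e"
    if \<omega>: "\<omega> \<in> space N" and e: "e > 0" for \<omega> T and e :: real
  proof (cases "regular_points (P \<omega>)")
    case True
    have "\<forall>\<^sub>F k in sequentially. \<forall>t\<in>{0..T}.
      dist (grid_path (1 / real k) (k * k) (\<lambda>j. V (grid_index P (1 / real k) j \<omega>) \<omega>) t)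
        (zigzag_path (P \<omega>) (\<lambda>i. V i \<omega>) t) < e"
    proof (rule zigzag_path_grid_limit[OF True norm_label[OF \<omega>] _ e])
      show "turning_time (P \<omega>) (grid_index P (1 / real k) j \<omega>) \<le> real j * (1 / real k) \<and>
          real j * (1 / real k) < turning_time (P \<omega>) (grid_index P (1 / real k) j \<omega> + 1)"
        if "k \<ge> 1" "j \<ge> 1" for k j
        using that by (intro grid_index_locate True) auto
    qed
    then have "\<forall>\<^sub>F k in sequentially. \<forall>t\<in>{0..T}.
      dist (grid_path (1 / real (Suc k)) (Suc k * Suc k) (\<lambda>j. V (grid_index P (1 / real (Suc k)) j \<omega>) \<omega>) t)
        (zigzag_path (P \<omega>) (\<lambda>i. V i \<omega>) t) < e"
      by (rule eventually_sequentially_Suc[THEN iffD2])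
    then show ?thesis unfolding Xk_def grid_slope_def using True by (simp only: if_True)
  next
    case False
    then show ?thesis using e by (simp add: Xk_def zigzag_path_def)
  qed
qed

lemma zigzag_grid_approximable:
  assumes h: "h > 0"
  shows "grid_approximable N directions (2 * a) h J (\<lambda>\<omega>. zigzag_path (P \<omega>) (\<lambda>i. V i \<omega>)) (grid_slope h)"
  unfolding grid_approximable_def
proof (intro conjI ballI)
  show "grid_slope h j \<in> N \<rightarrow>\<^sub>M count_space directions" for j by (rule grid_slope_measurable[OF h])
  define Bad where "Bad j = {\<omega> \<in> space N. point_count P {real j * h<..real (Suc j) * h} \<omega> \<noteq> 0}" for j
  have sub: "{real j * h<..real (Suc j) * h} \<subseteq> {0<..}" for j
    using h by (intro subsetI) (auto intro: le_less_trans[of 0 "real j * h"])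
  show "\<exists>Bad. (\<forall>j\<in>{1..J}. Bad j \<in> events \<and> prob (Bad j) \<le> 2 * a / real j) \<and>
      (AE \<omega> in N. \<forall>j\<in>{1..J}. \<omega> \<notin> Bad j \<longrightarrow> (\<forall>t\<in>{real j * h..real (Suc j) * h}.
         zigzag_path (P \<omega>) (\<lambda>i. V i \<omega>) t =
         zigzag_path (P \<omega>) (\<lambda>i. V i \<omega>) (real j * h) + (t - real j * h) *\<^sub>R grid_slope h j \<omega>))"
  proof (intro exI[of _ Bad] conjI ballI)
    fix j assume j: "j \<in> {1..J}"
    show "Bad j \<in> events"
      using point_count_event[OF points_of_data rate_bounds(1) _ sub[of j], of "- {0}"] by (simp add: Bad_def)
    have "0 < real j * h" "real j * h \<le> real (Suc j) * h" using j h by auto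
    from prob_some_point[OF points_of_data rate_bounds(1) this]
    have "prob (Bad j) \<le> b * ln ((real (Suc j) * h) / (real j * h))" by (simp only: Bad_def)
    also have "(real (Suc j) * h) / (real j * h) = 1 + 1 / real j" using h j by (simp add: field_simps)
    also have "b * ln (1 + 1 / real j) \<le> b * (1 / real j)"
      using rate_bounds(1) j by (intro mult_left_mono ln_add_one_self_le_self) auto
    \<comment> \<open>The estimate so far is \<open>b / j\<close>; the constant is raised to
      \<open>2 * a\<close> so that walk and limit share it.\<close>
    also have "\<dots> \<le> 2 * a * (1 / real j)" using rate_bounds(2) a by (intro mult_right_mono) auto
    finally show "prob (Bad j) \<le> 2 * a / real j" by simp
  next
    show "AE \<omega> in N. \<forall>j\<in>{1..J}. \<omega> \<notin> Bad j \<longrightarrow> (\<forall>t\<in>{real j * h..real (Suc j) * h}.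
         zigzag_path (P \<omega>) (\<lambda>i. V i \<omega>) t =
         zigzag_path (P \<omega>) (\<lambda>i. V i \<omega>) (real j * h) + (t - real j * h) *\<^sub>R grid_slope h j \<omega>)"
      using AE_regular_points[OF points_of_data rate_bounds(1)] AE_space
    proof eventually_elim
      case (elim \<omega>)
      show ?case
      proof (intro ballI impI)
        fix j t assume j: "j \<in> {1..J}" "\<omega> \<notin> Bad j" and t: "t \<in> {real j * h..real (Suc j) * h}"
        have "P \<omega> \<inter> {real j * h<..real (Suc j) * h} = {}"
          using j(2) elim(2) by (simp add: Bad_def point_count_eq_0_iff)
        then have "P \<omega> \<inter> {real j * h<..t} = {}" using t by auto
        then show "zigzag_path (P \<omega>) (\<lambda>i. V i \<omega>) t =
            zigzag_path (P \<omega>) (\<lambda>i. V i \<omega>) (real j * h) + (t - real j * h) *\<^sub>R grid_slope h j \<omega>"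
          unfolding grid_slope_def
          using grid_index_locate[where P = P and \<omega> = \<omega>, OF elim(1) h, of j] j(1) t h norm_label[OF elim(2)]
          by (intro zigzag_path_linear[OF elim(1)]) auto
      qed
    qed
  qed
qed

lemma expectation_mix_card:
  assumes h: "h > 0" and j: "j \<ge> 1"
  defines "c \<equiv> - 1 / (2 * real CARD('d) - 1)"
  shows "integrable N (\<lambda>\<omega>. mix S (c ^ card (P \<omega> \<inter> {real j * h<..real (Suc j) * h})) x y)"
    and "(\<integral>\<omega>. mix S (c ^ card (P \<omega> \<inter> {real j * h<..real (Suc j) * h})) x y \<partial>N) =
      mix S ((real j / real (Suc j)) powr a) x y"
proof -
  have c1: "\<bar>c\<bar> \<le> 1" unfolding c_def using d by (simp add: field_simps)
  have st: "0 < real j * h" "real j * h \<le> real (Suc j) * h" using j h by auto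
  let ?C = "\<lambda>\<omega>. card (P \<omega> \<inter> {real j * h<..real (Suc j) * h})"
  have "{real j * h<..real (Suc j) * h} \<subseteq> {0<..}"
    using st(1) by (intro subsetI) (auto intro: less_trans[OF st(1)])
  then have "?C \<in> N \<rightarrow>\<^sub>M count_space UNIV"
    by (intro measurable_card_points point_count_measurable[OF points_of_data rate_bounds(1)]) auto
  from measurable_compose[OF this, of "\<lambda>k. c ^ k" borel]
  have int: "integrable N (\<lambda>\<omega>. c ^ ?C \<omega>)"
    using c1 by (intro integrable_const_bound[of _ 1]) (auto simp: power_abs power_le_one)
  then show "integrable N (\<lambda>\<omega>. mix S (c ^ ?C \<omega>) x y)" unfolding mix_affine by auto
  have "(\<integral>\<omega>. c ^ ?C \<omega> \<partial>N) = exp (b * ln ((real (Suc j) * h) / (real j * h)) * (c - 1))"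
    by (rule expectation_power_card[OF points_of_data rate_bounds(1) st c1])
  also have "(real (Suc j) * h) / (real j * h) = real (Suc j) / real j" using h by simp
  also have "b * ln (real (Suc j) / real j) * (c - 1) = (b * (c - 1)) * ln (real (Suc j) / real j)" by simp
  \<comment> \<open>This identity is the origin of \<open>b\<close>: since
    \<open>1 - c = 2 d / (2 d - 1)\<close>, the exponent becomes the \<open>a\<close> of the
    walk.\<close>
  also have "b * (c - 1) = - a"
  proof -
    have "2 * real CARD('d) - 1 > 0" "real CARD('d) > 0" using d by auto
    then show ?thesis unfolding b_def c_def by (simp add: field_simps)
  qed
  also have "- a * ln (real (Suc j) / real j) = a * ln (real j / real (Suc j))"
    using j by (simp add: ln_div algebra_simps)
  also have "exp \<dots> = (real j / real (Suc j)) powr a" using j by (simp add: powr_def)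
  finally have "(\<integral>\<omega>. c ^ ?C \<omega> \<partial>N) = (real j / real (Suc j)) powr a" .
  then show "(\<integral>\<omega>. mix S (c ^ ?C \<omega>) x y \<partial>N) = mix S ((real j / real (Suc j)) powr a) x y"
    unfolding mix_affine using int by (simp add: prob_space)
qed

text \<open>Once the indices are frozen, the labels at the grid times form a chain whose parameters
  are \<open>c\<close> to the power of the cell counts. Counts in disjoint cells are independent, so
  the expectation of the product factors, and the Poisson generating function evaluates each
  factor.\<close>

theorem zigzag_fdd:
  assumes h: "h > 0" and J: "J \<ge> 1" and w: "w \<in> {1..J} \<rightarrow> directions"
  shows "\<P>(\<omega> in N. \<forall>j\<in>{1..J}. grid_slope h j \<omega> = w j) =
    1 / real (card (directions :: (real ^ 'd) set)) *
      (\<Prod>j\<in>{1..<J}. mix directions ((real j / real (Suc j)) powr a) (w j) (w (Suc j)))"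
proof -
  let ?u = "1 / real (card (directions :: (real ^ 'd) set))"
  define c where "c = - 1 / (2 * real CARD('d) - 1)"
  let ?gap = "\<lambda>j. {real j * h<..real (Suc j) * h}"
  let ?x = "\<lambda>j \<omega>. mix directions (c ^ card (P \<omega> \<inter> ?gap j)) (w j) (w (Suc j))"
  let ?Z = "sets (zigzag_intensity b)"
  define \<A> where "\<A> = vimage_algebra (space N) (\<lambda>\<omega>. \<lambda>B\<in>?Z. point_count P B \<omega>) (\<Pi>\<^sub>M B\<in>?Z. count_space UNIV)"
  define \<B> where "\<B> = vimage_algebra (space N) (\<lambda>\<omega> i. V i \<omega>) (\<Pi>\<^sub>M i\<in>UNIV. count_space (directions :: (real ^ 'd) set))"
  have indep: "indep_set (sets \<A>) (sets \<B>)"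
    using data by (simp add: zigzag_data_def \<A>_def \<B>_def)
  have pcA: "point_count P B \<in> \<A> \<rightarrow>\<^sub>M count_space UNIV" if "B \<in> ?Z" for B
  proof -
    have "(\<lambda>\<omega>. \<lambda>B\<in>?Z. point_count P B \<omega>) \<in> \<A> \<rightarrow>\<^sub>M (\<Pi>\<^sub>M B\<in>?Z. count_space UNIV)"
      unfolding \<A>_def by (rule measurable_vimage_algebra1) (auto simp: space_PiM)
    from measurable_compose[OF this measurable_component_singleton[OF that]]
    show ?thesis using that by simp
  qed
  have VB: "V i \<in> \<B> \<rightarrow>\<^sub>M count_space directions" for i
  proof -
    have "(\<lambda>\<omega> i. V i \<omega>) \<in> \<B> \<rightarrow>\<^sub>M (\<Pi>\<^sub>M i\<in>UNIV. count_space (directions :: (real ^ 'd) set))"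
      unfolding \<B>_def
      by (rule measurable_vimage_algebra1)
        (use measurable_space[OF label_measurable[OF labels_of_data d]] in \<open>auto simp: space_PiM\<close>)
    from measurable_compose[OF this measurable_component_singleton[of i]] show ?thesis by simp
  qed
  \<comment> \<open>The indices are collected in a list because the mixture lemma asks for a
    countable type; position \<open>j - 1\<close> holds the index for grid time
    \<open>j\<close>.\<close>
  define L where "L \<omega> = map (\<lambda>j. grid_index P h j \<omega>) [1..<Suc J]" for \<omega>
  define E where "E u = {\<omega> \<in> space N. \<forall>j\<in>{1..J}. V (u ! (j - 1)) \<omega> = w j}" for u
  have Lj: "L \<omega> ! (j - 1) = grid_index P h j \<omega>" if "j \<in> {1..J}" for j \<omega>
    using that unfolding L_def by (subst nth_map) (auto simp del: upt_Suc)
  have "\<P>(\<omega> in N. \<forall>j\<in>{1..J}. grid_slope h j \<omega> = w j) = \<P>(\<omega> in N. \<omega> \<in> E (L \<omega>))"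
    by (intro arg_cong[where f = prob] Collect_cong) (simp add: E_def grid_slope_def Lj del: One_nat_def)
  also have "\<dots> = (\<integral>\<omega>. prob (E (L \<omega>)) \<partial>N)"
  proof (rule indep_countable_mixture[OF _ indep])
    show "prob_space N" by unfold_locales
    fix u
    \<comment> \<open>Measurability is established for \<A>, not merely for \<open>N\<close>:
      independence concerns the events generated by the counts.\<close>
    have "L \<in> \<A> \<rightarrow>\<^sub>M count_space UNIV"
      unfolding L_def using pcA sets_zigzag_intensity
      by (intro measurable_map_discrete measurable_grid_index[OF h]) blast
    from measurable_sets[OF this, of "{u}"] show "L -` {u} \<inter> space N \<in> sets \<A>"
      by (simp add: \<A>_def)
    have "{\<omega> \<in> space \<B>. \<forall>j\<in>{1..J}. V (u ! (j - 1)) \<omega> = w j} \<in> sets \<B>"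
      by (rule sets_finite_coordinates) (simp, rule VB)
    then show "E u \<in> sets \<B>" by (simp add: E_def \<B>_def)
  qed
  also have "\<dots> = (\<integral>\<omega>. ?u *
      (\<Prod>j\<in>{1..<J}. ?x j \<omega>) \<partial>N)"
  proof (rule Bochner_Integration.integral_cong[OF refl])
    fix \<omega>
    have "E (L \<omega>) = {x \<in> space N. \<forall>j\<in>{1..J}. V (grid_index P h j \<omega>) x = w j}"
      unfolding E_def by (simp add: Lj del: One_nat_def)
    moreover have "mono_on {1..J} (\<lambda>j. grid_index P h j \<omega>)"
      by (auto simp: mono_on_def intro: grid_index_mono)
    ultimately have "prob (E (L \<omega>)) = ?u *
      (\<Prod>j\<in>{1..<J}. mix directions (c ^ nat (grid_index P h (Suc j) \<omega> - grid_index P h j \<omega>)) (w j) (w (Suc j)))"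
      unfolding c_def using label_fdd[OF labels_of_data d J _ w] by simp
    also have "(\<Prod>j\<in>{1..<J}. mix directions (c ^ nat (grid_index P h (Suc j) \<omega> - grid_index P h j \<omega>)) (w j) (w (Suc j))) =
      (\<Prod>j\<in>{1..<J}. ?x j \<omega>)"
      by (rule prod.cong[OF refl]) (simp add: grid_index_Suc)
    finally show "prob (E (L \<omega>)) = ?u *
      (\<Prod>j\<in>{1..<J}. ?x j \<omega>)" .
  qed
  also have "\<dots> = ?u *
      (\<integral>\<omega>. (\<Prod>j\<in>{1..<J}. ?x j \<omega>) \<partial>N)"
    by (rule integral_mult_right_zero)
  also have "(\<integral>\<omega>. (\<Prod>j\<in>{1..<J}. ?x j \<omega>) \<partial>N) =
      (\<Prod>j\<in>{1..<J}. \<integral>\<omega>. ?x j \<omega> \<partial>N)"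
  proof (rule indep_vars_lebesgue_integral)
    have "?gap ` {1..<J} \<subseteq> ?Z"
      using h unfolding sets_zigzag_intensity by (auto intro: le_less_trans[of 0 "real _ * h"])
    moreover have "disjoint_family_on ?gap {1..<J}"
    proof -
      have "?gap i \<inter> ?gap j = {}" if "i < j" for i j
      proof -
        have "real (Suc i) * h \<le> real j * h" using that h by (intro mult_right_mono) auto
        then show ?thesis by auto
      qed
      then show ?thesis unfolding disjoint_family_on_def by (metis Int_commute linorder_neqE_nat)
    qed
    moreover have "indep_vars (\<lambda>_. count_space UNIV) (\<lambda>j. point_count P (B j)) I"
      if "finite I" "B ` I \<subseteq> ?Z" "disjoint_family_on B I" for I :: "nat set" and B
      using points_of_data that unfolding poisson_point_process_def by simp
    ultimately have "indep_vars (\<lambda>_. count_space UNIV) (\<lambda>j. point_count P (?gap j)) {1..<J}"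
      by simp
    from indep_vars_compose2[OF this, of
        "\<lambda>j e. mix directions (c ^ (case e of enat k \<Rightarrow> k | \<infinity> \<Rightarrow> 0)) (w j) (w (Suc j))" "\<lambda>_. borel"]
    show "indep_vars (\<lambda>_. borel) (\<lambda>j \<omega>. ?x j \<omega>) {1..<J}"
      by (simp add: card_eq_point_count)
    show "integrable N (\<lambda>\<omega>. ?x j \<omega>)" if "j \<in> {1..<J}" for j
      unfolding c_def using that h by (intro expectation_mix_card(1)) auto
  qed simp
  also have "\<dots> = (\<Prod>j\<in>{1..<J}. mix directions ((real j / real (Suc j)) powr a) (w j) (w (Suc j)))"
    unfolding c_def using h by (intro prod.cong expectation_mix_card(2)) auto
  finally show ?thesis .
qed

end

theorem theorem4p1:
  fixes a :: real and p :: "nat \<Rightarrow> real"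
    and M :: "'w measure" and Y :: "nat \<Rightarrow> 'w \<Rightarrow> real ^ 'd"
    and N :: "'v measure" and P :: "'v \<Rightarrow> real set" and V :: "int \<Rightarrow> 'v \<Rightarrow> real ^ 'd"
  assumes "CARD('d) \<ge> 2"
    and "a > 0"
    and "p 1 = 1"
    and "\<And>n. n \<ge> 2 \<Longrightarrow> p n \<in> {0..1}"
    and "\<exists>n0. \<forall>n\<ge>n0. p n = a / real n"
    and "conservative_steps M p Y"
    and "zigzag_data N ((2 * real CARD('d) - 1) * a / (2 * real CARD('d))) P V"
  shows "weakly_converges cpath_topology
           (\<lambda>n. distr M (borel_of cpath_topology) (rescaled_walk Y n))
           (zigzag_law N P V)"
proof -
  obtain n0 where p: "\<And>n. n \<ge> n0 \<Longrightarrow> p n = a / real n" using assms(5) by blast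
  have chain: "mix_chain M directions (\<lambda>k. 1 - p k) Y"
    by (rule conservative_steps_chain[OF assms(6)])
  have M: "prob_space M" using chain by (simp add: mix_chain_def)
  have N: "prob_space N" using assms(7) by (simp add: zigzag_data_def)
  have norm_Y: "norm (Y k \<omega>) \<le> 1" if "k \<ge> 1" "\<omega> \<in> space M" for k \<omega>
    using norm_directions[OF measurable_space[OF chain_measurable[OF chain that(1)] that(2), simplified]] by simp
  show ?thesis
    unfolding zigzag_law_def
  proof (rule weakly_converges_via_grid[where S = directions and C = "2 * a"
        and E = "\<lambda>h n j. Y (grid_step h n j)" and D = "grid_slope P V"])
    show "rescaled_walk Y n \<in> M \<rightarrow>\<^sub>M borel_of cpath_topology" for n
      by (rule rescaled_walk_measurable) (rule chain_measurable[OF chain])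
    show "rescaled_walk Y n \<omega> \<in> lip_paths" if "\<omega> \<in> space M" for n \<omega>
      using norm_Y that by (intro rescaled_walk_in_lip_paths)
    show "norm v \<le> 1" if "v \<in> directions" for v :: "real ^ 'd"
      using norm_directions[OF that] by simp
    show "\<forall>\<^sub>F n in sequentially. grid_approximable M directions (2 * a) h J (rescaled_walk Y n) (\<lambda>j. Y (grid_step h n j))"
      if "h > 0" for h J
      by (rule walk_grid_approximable[OF chain assms(2) p that])
    show "(\<lambda>n. \<P>(\<omega> in M. \<forall>j\<in>{1..J}. Y (grid_step h n j) \<omega> = w j)) \<longlonglongrightarrow>
        \<P>(\<omega> in N. \<forall>j\<in>{1..J}. grid_slope P V h j \<omega> = w j)"
      if h: "h > 0" and w: "w \<in> PiE {1..J} (\<lambda>_. directions)" for h J w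
    proof (cases "J \<ge> 1")
      case True
      have w': "w \<in> {1..J} \<rightarrow> directions" using w by auto
      show ?thesis
        using walk_fdd_tendsto[OF chain assms(2) p h True w'] zigzag_fdd[OF assms(7,1,2) refl h True w'] by simp
    next
      case False
      \<comment> \<open>For \<open>J = 0\<close> both events are the whole space.\<close>
      then show ?thesis using prob_space.prob_space[OF M] prob_space.prob_space[OF N] by simp
    qed
  qed (use M N finite_directions zigzag_measurable[OF assms(7,1,2) refl] zigzag_in_lip_paths[OF assms(7,1,2) refl]
      zigzag_grid_approximable[OF assms(7,1,2) refl] in blast)+
qed

end
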